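(* Let $n \geq 1$, let $f:\mathbb{D}^n \to \mathbb{D}$ be a rational inner function in the Agler class, and write $f = q/p$ with $q,p \in \mathbb{C}[z_1,\dots,z_n]$, where $p$ has no zeros on $\mathbb{D}^n$. Then: (1) A sums of squares decomposition holds: there exist integers $N_1,\dots,N_n \geq 0$ and polynomials $A_{j,k} \in \mathbb{C}[z_1,\dots,z_n]$ ($1\le j\le n$, $1 \le k \le N_j$) such that for all $z=(z_1,\dots,z_n)\in\mathbb{C}^n$ \[ |p(z)|^2 - |q(z)|^2 = \sum_{j=1}^{n} (1-|z_j|^2) \sum_{k=1}^{N_j} |A_{j,k}(z)|^2 . \] (2) $f$ has a finite dimensional transfer function realization.
   Context: $\mathbb{D}$ is the open unit disk in $\mathbb{C}$, $\mathbb{T}$ the unit circle, $\mathbb{D}^n$ the polydisk, $\mathbb{T}^n$ the $n$-torus. A rational inner function on $\mathbb{D}^n$ is a rational function $f=q/p$ with $q,p\in\mathbb{C}[z_1,\dots,z_n]$, where $p$ has no zeros on $\mathbb{D}^n$ and $|f|=1$ a.e. on $\mathbb{T}^n$. A holomorphic function $f:\mathbb{D}^n\to\mathbb{D}$ is in the Agler class (Schur-Agler class) if $\|f(T)\|\le 1$ for all commuting $n$-tuples $T=(T_1,\dots,T_n)$ of strict contractions on a Hilbert space. By a theorem of Agler this is equivalent to the existence of an Agler decomposition: positive semi-definite kernels $K_j:\mathbb{D}^n\times\mathbb{D}^n\to\mathbb{C}$, $j=1,\dots,n$, with $1-f(z)\overline{f(\zeta)} = \sum_{j=1}^n (1-z_j\bar{\zeta}_j)K_j(z,\zeta)$.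 It is also equivalent to the existence of a transfer function realization as defined next (with the Hilbert spaces possibly infinite dimensional). A function $f:\mathbb{D}^n\to\mathbb{D}$ has a transfer function realization if there is a Hilbert space with an orthogonal decomposition $\mathcal{H}=\mathcal{H}_1\oplus\cdots\oplus\mathcal{H}_n$ and an isometric operator $V=\begin{bmatrix} A & B\\ C& D\end{bmatrix}$ on $\mathbb{C}\oplus\mathcal{H}$ (so $A:\mathbb{C}\to\mathbb{C}$, $B:\mathcal{H}\to\mathbb{C}$, $C:\mathbb{C}\to\mathcal{H}$, $D:\mathcal{H}\to\mathcal{H}$ are bounded) such that $f(z)=A+BE(z)(I-DE(z))^{-1}C$ for $z\in\mathbb{D}^n$, where $E(z)$ is the block diagonal operator on $\mathcal{H}$ with diagonal blocks $z_1I_{\mathcal{H}_1},\dots,z_nI_{\mathcal{H}_n}$. The realization is finite dimensional if every $\mathcal{H}_j$ is finite dimensional. Zero-dimensional summands are allowed, and empty sums equal $0$. *)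

theory Defs
  imports
    "HOL-Analysis.Analysis"
    "HOL-Library.Poly_Mapping"
    "HOL-Library.Function_Algebras"
begin

section \<open>Polynomials and power series in several variables\<close>

text \<open>
  The variables are indexed by a finite type \<open>'n\<close>, so that the number of variables is
  \<open>CARD('n) \<ge> 1\<close>. The type \<open>'n \<Rightarrow>\<^sub>0 nat\<close> is the type of multi-indices.
\<close>

type_synonym 'n cpoly = "('n \<Rightarrow>\<^sub>0 nat) \<Rightarrow>\<^sub>0 complex"

definition power_monomial :: "complex ^ 'n \<Rightarrow> ('n::finite \<Rightarrow>\<^sub>0 nat) \<Rightarrow> complex" where
  "power_monomial z \<alpha> = (\<Prod>j\<in>UNIV. (z $ j) ^ Poly_Mapping.lookup \<alpha> j)"

definition peval :: "'n::finite cpoly \<Rightarrow> complex ^ 'n \<Rightarrow> complex" where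
  "peval p z = (\<Sum>\<alpha>\<in>Poly_Mapping.keys p. Poly_Mapping.lookup p \<alpha> * power_monomial z \<alpha>)"

definition polydisk :: "(complex ^ 'n::finite) set" where
  "polydisk = {z. \<forall>j. cmod (z $ j) < 1}"

definition holomorphic_on_polydisk :: "(complex ^ 'n::finite \<Rightarrow> complex) \<Rightarrow> bool" where
  "holomorphic_on_polydisk f \<longleftrightarrow>
     (\<forall>z\<in>polydisk. \<exists>D. (f has_derivative D) (at z) \<and> (\<forall>c v. D (c *s v) = c * D v))"

definition polydisk_expansion ::
    "(complex ^ 'n::finite \<Rightarrow> complex) \<Rightarrow> (('n \<Rightarrow>\<^sub>0 nat) \<Rightarrow> complex) \<Rightarrow> bool" where
  "polydisk_expansion f a \<longleftrightarrow>
     (\<forall>z\<in>polydisk. ((\<lambda>\<alpha>. a \<alpha> * power_monomial z \<alpha>) has_sum f z) UNIV)"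


section \<open>Rational inner functions\<close>

text \<open>
  ``Almost everywhere on the torus'' is expressed through the parametrization
  \<open>\<theta> \<mapsto> (cis \<theta>\<^sub>j)\<^sub>j\<close>; by periodicity it does not matter that \<open>\<theta>\<close> ranges over the whole of
  Euclidean space and not just over a period box. On the torus \<open>f\<close> is understood as the
  rational function \<open>q/p\<close>; where \<open>p\<close> vanishes, the quotient is \<open>0\<close> and the condition fails.
\<close>

definition rational_inner :: "(complex ^ 'n::finite \<Rightarrow> complex) \<Rightarrow> bool" where
  "rational_inner f \<longleftrightarrow>
     (\<exists>q p. (\<forall>z\<in>polydisk. peval p z \<noteq> 0) \<and>
            (\<forall>z\<in>polydisk. f z = peval q z / peval p z) \<and>
            (AE \<theta> :: real ^ 'n in lborel.
               cmod (peval q (\<chi> j. cis (\<theta> $ j)) / peval p (\<chi> j. cis (\<theta> $ j))) = 1))"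


section \<open>Complex Hilbert spaces\<close>

text \<open>
  A complex Hilbert space is a linear subspace \<open>H\<close> of the vector space of all complex
  sequences together with an arbitrary inner product \<open>ip\<close> on \<open>H\<close> (linear in the first
  argument, and unrelated to the sequence structure) for which \<open>H\<close> is complete. Only the
  values of \<open>ip\<close> on \<open>H\<close> are relevant. Up to unitary equivalence, these are all the complex
  Hilbert spaces of vector space dimension at most the continuum, in particular all the
  separable ones.
\<close>

type_synonym cseq = "nat \<Rightarrow> complex"

definition cscale :: "complex \<Rightarrow> cseq \<Rightarrow> cseq" where
  "cscale c x = (\<lambda>i. c * x i)"

global_interpretation cseq: vector_space cscale
  by unfold_locales (auto simp: cscale_def fun_eq_iff algebra_simps)

definition hnorm :: "(cseq \<Rightarrow> cseq \<Rightarrow> complex) \<Rightarrow> cseq \<Rightarrow> real" where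
  "hnorm ip x = sqrt (Re (ip x x))"

locale complex_hilbert =
  fixes H :: "cseq set" and ip :: "cseq \<Rightarrow> cseq \<Rightarrow> complex"
  assumes subspace: "cseq.subspace H"
    and ip_add: "\<lbrakk>x \<in> H; y \<in> H; w \<in> H\<rbrakk> \<Longrightarrow> ip (x + y) w = ip x w + ip y w"
    and ip_scale: "\<lbrakk>x \<in> H; w \<in> H\<rbrakk> \<Longrightarrow> ip (cscale c x) w = c * ip x w"
    and ip_cnj: "\<lbrakk>x \<in> H; y \<in> H\<rbrakk> \<Longrightarrow> ip y x = cnj (ip x y)"
    and ip_pos: "\<lbrakk>x \<in> H; x \<noteq> 0\<rbrakk> \<Longrightarrow> Re (ip x x) > 0"
    and complete:
      "\<lbrakk>\<And>m. X m \<in> H; \<And>e. e > 0 \<Longrightarrow> \<exists>M. \<forall>m\<ge>M. \<forall>k\<ge>M. hnorm ip (X m - X k) < e\<rbrakk>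
        \<Longrightarrow> \<exists>x\<in>H. (\<lambda>m::nat. hnorm ip (X m - x)) \<longlonglongrightarrow> 0"

definition linear_operator :: "cseq set \<Rightarrow> (cseq \<Rightarrow> cseq) \<Rightarrow> bool" where
  "linear_operator H T \<longleftrightarrow>
     (\<forall>x\<in>H. T x \<in> H) \<and>
     (\<forall>x\<in>H. \<forall>y\<in>H. T (x + y) = T x + T y) \<and>
     (\<forall>c. \<forall>x\<in>H. T (cscale c x) = cscale c (T x))"

text \<open>The operator norm of \<open>T\<close> on \<open>H\<close> is at most \<open>r\<close>.\<close>

definition opnorm_le ::
    "cseq set \<Rightarrow> (cseq \<Rightarrow> cseq \<Rightarrow> complex) \<Rightarrow> (cseq \<Rightarrow> cseq) \<Rightarrow> real \<Rightarrow> bool" where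
  "opnorm_le H ip T r \<longleftrightarrow> (\<forall>x\<in>H. hnorm ip (T x) \<le> r * hnorm ip x)"

definition strict_contraction ::
    "cseq set \<Rightarrow> (cseq \<Rightarrow> cseq \<Rightarrow> complex) \<Rightarrow> (cseq \<Rightarrow> cseq) \<Rightarrow> bool" where
  "strict_contraction H ip T \<longleftrightarrow> linear_operator H T \<and> (\<exists>r<1. opnorm_le H ip T r)"


section \<open>The Agler class\<close>

text \<open>
  The product of the powers of the operators is taken along a fixed enumeration of the index
  type; for operators that commute on \<open>H\<close>, its restriction to \<open>H\<close> does not depend on the
  enumeration.
\<close>

definition index_list :: "'n::finite list" where
  "index_list = (SOME js. distinct js \<and> set js = UNIV)"

definition op_monomial :: "('n::finite \<Rightarrow> cseq \<Rightarrow> cseq) \<Rightarrow> ('n \<Rightarrow>\<^sub>0 nat) \<Rightarrow> cseq \<Rightarrow> cseq" where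
  "op_monomial T \<alpha> = foldr (\<lambda>j S. (T j ^^ Poly_Mapping.lookup \<alpha> j) \<circ> S) index_list id"

text \<open>
  The operator \<open>F\<close> is the sum of \<open>a \<alpha> T\<^sup>\<alpha>\<close> over all multi-indices, the series converging
  unconditionally in operator norm. If \<open>a\<close> is the family of Taylor coefficients of a
  holomorphic function \<open>f\<close> on the polydisk and \<open>T\<close> is a commuting tuple of strict
  contractions, there is exactly one such operator on \<open>H\<close>, namely \<open>f(T)\<close>.
\<close>

definition is_functional_calculus ::
    "cseq set \<Rightarrow> (cseq \<Rightarrow> cseq \<Rightarrow> complex) \<Rightarrow> (('n::finite \<Rightarrow>\<^sub>0 nat) \<Rightarrow> complex) \<Rightarrow>
     ('n \<Rightarrow> cseq \<Rightarrow> cseq) \<Rightarrow> (cseq \<Rightarrow> cseq) \<Rightarrow> bool" where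
  "is_functional_calculus H ip a T F \<longleftrightarrow>
     linear_operator H F \<and>
     (\<forall>e>0. \<forall>\<^sub>F S in finite_subsets_at_top UNIV.
        opnorm_le H ip (\<lambda>x. F x - (\<Sum>\<alpha>\<in>S. cscale (a \<alpha>) (op_monomial T \<alpha> x))) e)"

text \<open>
  The family \<open>a\<close> exists for every function that is holomorphic on the polydisk, and it is
  unique. Considering only the Hilbert spaces of \<^locale>\<open>complex_hilbert\<close> does not enlarge the
  class: for a vector \<open>x\<close> of an arbitrary Hilbert space, the closed linear span of all the
  \<open>T\<^sup>\<alpha> x\<close> is separable, invariant under \<open>T\<close>, and contains \<open>f(T) x\<close>.
\<close>

definition agler_class :: "(complex ^ 'n::finite \<Rightarrow> complex) \<Rightarrow> bool" where
  "agler_class f \<longleftrightarrow>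
     holomorphic_on_polydisk f \<and> f ` polydisk \<subseteq> ball 0 1 \<and>
     (\<exists>a. polydisk_expansion f a \<and>
        (\<forall>H ip T F.
           complex_hilbert H ip \<longrightarrow>
           (\<forall>j. strict_contraction H ip (T j)) \<longrightarrow>
           (\<forall>i j. \<forall>x\<in>H. T i (T j x) = T j (T i x)) \<longrightarrow>
           is_functional_calculus H ip a T F \<longrightarrow>
           opnorm_le H ip F 1))"


section \<open>Transfer function realizations\<close>

text \<open>
  Because \<open>H\<close> is complete and the summands are mutually orthogonal with sum \<open>H\<close>, they are
  automatically closed.
\<close>

definition orthogonal_decomposition ::
    "cseq set \<Rightarrow> (cseq \<Rightarrow> cseq \<Rightarrow> complex) \<Rightarrow> ('n::finite \<Rightarrow> cseq set) \<Rightarrow> bool" where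
  "orthogonal_decomposition H ip Hs \<longleftrightarrow>
     (\<forall>j. cseq.subspace (Hs j)) \<and>
     (\<forall>i j. i \<noteq> j \<longrightarrow> (\<forall>x\<in>Hs i. \<forall>y\<in>Hs j. ip x y = 0)) \<and>
     H = {\<Sum>j\<in>UNIV. xs j | xs. \<forall>j. xs j \<in> Hs j}"

definition block_diagonal ::
    "('n::finite \<Rightarrow> cseq set) \<Rightarrow> complex ^ 'n \<Rightarrow> cseq \<Rightarrow> cseq" where
  "block_diagonal Hs z x =
     (let xs = (THE xs. (\<forall>j. xs j \<in> Hs j) \<and> x = (\<Sum>j\<in>UNIV. xs j))
      in \<Sum>j\<in>UNIV. cscale (z $ j) (xs j))"

definition isometric_operator ::
    "cseq set \<Rightarrow> (cseq \<Rightarrow> cseq \<Rightarrow> complex) \<Rightarrow> (complex \<times> cseq \<Rightarrow> complex \<times> cseq) \<Rightarrow> bool" where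
  "isometric_operator H ip V \<longleftrightarrow>
     (\<forall>u\<in>UNIV \<times> H. V u \<in> UNIV \<times> H) \<and>
     (\<forall>u\<in>UNIV \<times> H. \<forall>v\<in>UNIV \<times> H. V (u + v) = V u + V v) \<and>
     (\<forall>c. \<forall>(b, x)\<in>UNIV \<times> H.
        V (c * b, cscale c x) = (c * fst (V (b, x)), cscale c (snd (V (b, x))))) \<and>
     (\<forall>(b, x)\<in>UNIV \<times> H.
        (cmod (fst (V (b, x))))\<^sup>2 + (hnorm ip (snd (V (b, x))))\<^sup>2 = (cmod b)\<^sup>2 + (hnorm ip x)\<^sup>2)"

text \<open>
  The operators between the complex numbers and another space that occur as blocks of \<open>V\<close> are
  identified with their values at \<open>1\<close> (that is, \<open>A\<close> with a number and \<open>C\<close> with a vector).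
\<close>

definition transfer_function_realization ::
    "(complex ^ 'n::finite \<Rightarrow> complex) \<Rightarrow> cseq set \<Rightarrow> (cseq \<Rightarrow> cseq \<Rightarrow> complex) \<Rightarrow>
     ('n \<Rightarrow> cseq set) \<Rightarrow> (complex \<times> cseq \<Rightarrow> complex \<times> cseq) \<Rightarrow> bool" where
  "transfer_function_realization f H ip Hs V \<longleftrightarrow>
     complex_hilbert H ip \<and> orthogonal_decomposition H ip Hs \<and> isometric_operator H ip V \<and>
     (let A = fst (V (1, 0));
          B = (\<lambda>x. fst (V (0, x)));
          C = snd (V (1, 0));
          D = (\<lambda>x. snd (V (0, x)));
          E = block_diagonal Hs
      in \<forall>z\<in>polydisk.
           bij_betw (\<lambda>x. x - D (E z x)) H H \<and>
           f z = A + B (E z (the_inv_into H (\<lambda>x. x - D (E z x)) C)))"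

definition has_finite_dim_realization :: "(complex ^ 'n::finite \<Rightarrow> complex) \<Rightarrow> bool" where
  "has_finite_dim_realization f \<longleftrightarrow>
     (\<exists>H ip Hs V. transfer_function_realization f H ip Hs V \<and>
        (\<forall>j. \<exists>S. finite S \<and> Hs j = cseq.span S))"

end

theory Submission
  imports Defs
begin

text \<open>
  Let \<open>N\<close> bound the total degrees of \<open>p\<close> and \<open>q\<close>. On the coefficient families indexed by
  \<open>|\<alpha>| \<le> N\<close>, multiplication by \<open>z\<^sub>j\<close> followed by truncation gives commuting nilpotent operators
  \<open>T\<^sub>j\<close>. If the Hermitian matrix \<open>p p\<^sup>* - q q\<^sup>*\<close> were not a truncated sum
  \<open>\<Sum>\<^sub>j (1 - z\<^sub>j w\<^sub>j\<^sup>*) A\<^sub>j\<close> with positive semidefinite \<open>A\<^sub>j\<close>, a separating functional would be an inner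
  product for which all \<open>T\<^sub>j\<close> are contractions but \<open>\<parallel>f(T) p\<parallel> = \<parallel>q\<parallel> > \<parallel>p\<parallel>\<close>, which contradicts the
  Agler property. Summing the diagonal entries of the truncated identity gives
  \<open>\<Sum>\<^sub>j \<Sum>\<^bsub>|\<alpha>| = N\<^esub> A\<^sub>j(\<alpha>,\<alpha>) = \<Sum>\<^sub>\<alpha> (|p\<^sub>\<alpha>|\<^sup>2 - |q\<^sub>\<alpha>|\<^sup>2)\<close>, and this is \<open>0\<close> by Parseval because
  \<open>|p| = |q|\<close> on the torus. So every \<open>A\<^sub>j\<close> has degree less than \<open>N\<close>, nothing has been truncated, and
  factoring the \<open>A\<^sub>j\<close> gives the sums of squares. The same identity says that two finite families of
  vectors have equal Gram matrices; the isometry that maps one to the other is the realization.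
\<close>

section \<open>Positive semidefinite matrices\<close>

text \<open>Fixing the degree bound \<open>N\<close> at the outset keeps the dual problem among
  finite Hermitian matrices instead of kernels on the polydisk, whose polynomial nature would have
  to be proved. The price is that a truncated identity is silent above degree \<open>N\<close>; the
  torus condition, entering only through the trace, repairs this.

  Two mismatches shape the duality. \<open>agler_class\<close> asks for strict contractions on
  genuine Hilbert spaces, whereas separation yields a form that is only semidefinite and for which
  the shifts are merely contractive. Adding the identity makes the form definite, and truncated
  shifts are contractive for the identity as well. The weights \<open>r ^ mdeg \<alpha>\<close> make
  them strict, and \<open>r\<close> tends to 1 at the end.

  Nilpotency serves twice: it makes the functional calculus a finite sum, and it forces the
  separating form to be semidefinite. The vector p is the right test because f(T) p collects the
  coefficients of the product f p = q, so the difference of the forms at p and at q is the value of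
  the functional on the matrix to be decomposed.\<close>

definition form :: "'i set \<Rightarrow> ('i \<Rightarrow> 'i \<Rightarrow> complex) \<Rightarrow> ('i \<Rightarrow> complex) \<Rightarrow> real" where
  "form I a g = Re (\<Sum>\<alpha>\<in>I. \<Sum>\<beta>\<in>I. a \<alpha> \<beta> * g \<alpha> * cnj (g \<beta>))"

definition hermitian :: "'i set \<Rightarrow> ('i \<Rightarrow> 'i \<Rightarrow> complex) \<Rightarrow> bool" where
  "hermitian I a \<longleftrightarrow> (\<forall>\<alpha>\<in>I. \<forall>\<beta>\<in>I. a \<beta> \<alpha> = cnj (a \<alpha> \<beta>))"

definition psd :: "'i set \<Rightarrow> ('i \<Rightarrow> 'i \<Rightarrow> complex) \<Rightarrow> bool" where
  "psd I a \<longleftrightarrow> hermitian I a \<and> (\<forall>g. 0 \<le> form I a g)"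

lemma hermitianD: "hermitian I a \<Longrightarrow> \<alpha> \<in> I \<Longrightarrow> \<beta> \<in> I \<Longrightarrow> a \<beta> \<alpha> = cnj (a \<alpha> \<beta>)"
  unfolding hermitian_def by blast

lemma psdD: "psd I a \<Longrightarrow> \<alpha> \<in> I \<Longrightarrow> \<beta> \<in> I \<Longrightarrow> a \<beta> \<alpha> = cnj (a \<alpha> \<beta>)" "psd I a \<Longrightarrow> 0 \<le> form I a g"
  unfolding psd_def hermitian_def by blast+

lemma form_cong:
  "(\<And>\<alpha> \<beta>. \<alpha> \<in> I \<Longrightarrow> \<beta> \<in> I \<Longrightarrow> a \<alpha> \<beta> = b \<alpha> \<beta>) \<Longrightarrow> (\<And>\<alpha>. \<alpha> \<in> I \<Longrightarrow> g \<alpha> = h \<alpha>) \<Longrightarrow> form I a g = form I b h"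
  unfolding form_def by (intro arg_cong[where f=Re] sum.cong) auto

lemma form_restrict:
  assumes "finite I" "J \<subseteq> I" "\<And>\<alpha>. \<alpha> \<in> I - J \<Longrightarrow> g \<alpha> = 0"
  shows "form I a g = form J a g"
  unfolding form_def
  using assms by (intro arg_cong[where f=Re] sum.mono_neutral_cong_right sum.cong) auto

lemma form_rank_one:
  "form I (\<lambda>\<alpha> \<beta>. v \<alpha> * cnj (v \<beta>)) g = (cmod (\<Sum>\<alpha>\<in>I. v \<alpha> * g \<alpha>))\<^sup>2"
proof -
  have "(\<Sum>\<alpha>\<in>I. \<Sum>\<beta>\<in>I. v \<alpha> * cnj (v \<beta>) * g \<alpha> * cnj (g \<beta>)) =
      (\<Sum>\<alpha>\<in>I. v \<alpha> * g \<alpha>) * cnj (\<Sum>\<alpha>\<in>I. v \<alpha> * g \<alpha>)"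
    by (simp add: cnj_sum sum_product mult_ac)
  then show ?thesis
    unfolding form_def by (simp only: complex_norm_square[symmetric] Re_complex_of_real)
qed

lemma psd_rank_one: "psd I (\<lambda>\<alpha> \<beta>. v \<alpha> * cnj (v \<beta>))"
  by (simp add: psd_def hermitian_def form_rank_one)

lemma form_add: "form I (\<lambda>\<alpha> \<beta>. a \<alpha> \<beta> + b \<alpha> \<beta>) g = form I a g + form I b g"
  by (simp add: form_def algebra_simps sum.distrib)

lemma form_diff: "form I (\<lambda>\<alpha> \<beta>. a \<alpha> \<beta> - b \<alpha> \<beta>) g = form I a g - form I b g"
  by (simp add: form_def algebra_simps sum_subtractf)

lemma form_scale: "form I (\<lambda>\<alpha> \<beta>. of_real t * a \<alpha> \<beta>) g = t * form I a g"
proof -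
  have "(\<Sum>\<alpha>\<in>I. \<Sum>\<beta>\<in>I. of_real t * a \<alpha> \<beta> * g \<alpha> * cnj (g \<beta>)) =
    of_real t * (\<Sum>\<alpha>\<in>I. \<Sum>\<beta>\<in>I. a \<alpha> \<beta> * g \<alpha> * cnj (g \<beta>))"
    by (simp add: sum_distrib_left mult_ac)
  then show ?thesis
    unfolding form_def by (simp only: Re_complex_of_real Re_divide) simp
qed

lemma psd_scale_add:
  assumes "psd I a" "psd I b" "0 \<le> s" "0 \<le> t"
  shows "psd I (\<lambda>\<alpha> \<beta>. of_real s * a \<alpha> \<beta> + of_real t * b \<alpha> \<beta>)"
  unfolding psd_def hermitian_def
proof (intro conjI ballI allI)
  fix \<alpha> \<beta> assume I: "\<alpha> \<in> I" "\<beta> \<in> I"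
  show "of_real s * a \<beta> \<alpha> + of_real t * b \<beta> \<alpha> = cnj (of_real s * a \<alpha> \<beta> + of_real t * b \<alpha> \<beta>)"
    unfolding psdD(1)[OF assms(1) I] psdD(1)[OF assms(2) I] by simp
next
  show "0 \<le> form I (\<lambda>\<alpha> \<beta>. of_real s * a \<alpha> \<beta> + of_real t * b \<alpha> \<beta>) g" for g
    using assms(3,4) psdD(2)[OF assms(1)] psdD(2)[OF assms(2)] by (simp add: form_add form_scale)
qed

lemma psd_subset:
  assumes "finite I" "J \<subseteq> I" "psd I a"
  shows "psd J a"
  unfolding psd_def
proof (intro conjI allI)
  show "hermitian J a" using assms unfolding psd_def hermitian_def by blast
  fix g :: "'a \<Rightarrow> complex"
  let ?g = "\<lambda>\<alpha>. if \<alpha> \<in> J then g \<alpha> else 0"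
  have "form I a ?g = form J a ?g" using assms by (intro form_restrict) auto
  also have "\<dots> = form J a g" by (rule form_cong) auto
  finally show "0 \<le> form J a g" using assms by (metis psd_def)
qed

lemma psd_diag:
  assumes "finite I" "psd I a" "\<alpha> \<in> I"
  shows "0 \<le> Re (a \<alpha> \<alpha>)" "a \<alpha> \<alpha> = of_real (Re (a \<alpha> \<alpha>))"
proof -
  have "psd {\<alpha>} a" using assms psd_subset[of I "{\<alpha>}"] by auto
  then have "0 \<le> form {\<alpha>} a (\<lambda>_. 1)" by (simp add: psd_def)
  then show "0 \<le> Re (a \<alpha> \<alpha>)" by (simp add: form_def)
  have "a \<alpha> \<alpha> = cnj (a \<alpha> \<alpha>)" using psdD(1)[OF assms(2,3,3)] .
  then show "a \<alpha> \<alpha> = of_real (Re (a \<alpha> \<alpha>))" by (metis Reals_cnj_iff of_real_Re)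
qed

lemma psd_two:
  assumes "finite I" "psd I a" "\<alpha> \<in> I" "\<beta> \<in> I" "\<alpha> \<noteq> \<beta>"
  shows "0 \<le> Re (a \<alpha> \<alpha>) * (cmod x)\<^sup>2 + Re (a \<beta> \<beta>) * (cmod y)\<^sup>2 + 2 * Re (a \<alpha> \<beta> * x * cnj y)"
proof -
  have p: "psd {\<alpha>,\<beta>} a" using assms psd_subset[of I "{\<alpha>,\<beta>}"] by auto
  have d: "Re (c * z * cnj z) = Re c * (cmod z)\<^sup>2" for c z
    unfolding cmod_power2 by (simp add: power2_eq_square algebra_simps)
  have c: "a \<beta> \<alpha> * y * cnj x = cnj (a \<alpha> \<beta> * x * cnj y)"
    using psdD(1)[OF p, of \<alpha> \<beta>] by simp
  have "0 \<le> form {\<alpha>,\<beta>} a (\<lambda>i. if i = \<alpha> then x else y)" using p by (simp add: psd_def)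
  also have "\<dots> = Re (a \<alpha> \<alpha> * x * cnj x) + Re (a \<beta> \<beta> * y * cnj y) +
      (Re (a \<alpha> \<beta> * x * cnj y) + Re (a \<beta> \<alpha> * y * cnj x))"
    using assms(5) by (simp add: form_def)
  also have "Re (a \<beta> \<alpha> * y * cnj x) = Re (a \<alpha> \<beta> * x * cnj y)" by (simp only: c cnj.simps(1))
  finally show ?thesis by (simp only: d)
qed

text \<open>The 2 by 2 principal submatrix is tested on a vector whose phase turns the off-diagonal
  entry into minus its modulus. The bound is linear in the diagonal, which is what the trace
  identity controls.\<close>

lemma psd_bound:
  assumes "finite I" "psd I a" "\<alpha> \<in> I" "\<beta> \<in> I"
  shows "cmod (a \<alpha> \<beta>) \<le> Re (a \<alpha> \<alpha>) + Re (a \<beta> \<beta>)"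
proof (cases "\<alpha> = \<beta>")
  case True
  have "cmod (a \<alpha> \<alpha>) = Re (a \<alpha> \<alpha>)"
    by (subst psd_diag(2)[OF assms(1-3)]) (use psd_diag(1)[OF assms(1-3)] in simp)
  then show ?thesis using psd_diag(1)[OF assms(1-3)] True by simp
next
  case False
  define c where "c = a \<alpha> \<beta>"
  show ?thesis
  proof (cases "c = 0")
    case True
    then show ?thesis using psd_diag[OF assms(1,2)] assms(3,4) c_def by auto
  next
    case nz: False
    have "c * (- cnj c / cmod c) = - cmod c"
      using nz by (simp add: complex_norm_square[symmetric] power2_eq_square)
    then have "0 \<le> Re (a \<alpha> \<alpha>) + Re (a \<beta> \<beta>) - 2 * cmod c"
      using psd_two[OF assms False, of "- cnj c / cmod c" 1] nz
      by (simp add: c_def[symmetric] norm_divide)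
    then show ?thesis using norm_ge_zero[of c] unfolding c_def by linarith
  qed
qed

text \<open>With \<open>c = a \<alpha> \<beta>\<close>, the form at the vector
  \<open>(- t * cnj c, 1)\<close> is affine in \<open>t\<close> with slope
  \<open>- 2 * (cmod c)^2\<close>; it stays nonnegative for all \<open>t\<close> only if
  \<open>c = 0\<close>.\<close>

lemma psd_zero_row:
  assumes "finite I" "psd I a" "\<alpha> \<in> I" "\<beta> \<in> I" "a \<alpha> \<alpha> = 0"
  shows "a \<alpha> \<beta> = 0"
proof (cases "\<alpha> = \<beta>")
  case False
  define c where "c = a \<alpha> \<beta>"
  have cc: "Re c * Re c + Im c * Im c = (cmod c)\<^sup>2" unfolding cmod_power2 by (simp add: power2_eq_square)
  have *: "2 * t * (cmod c)\<^sup>2 \<le> Re (a \<beta> \<beta>)" for t :: real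
    using psd_two[OF assms(1-4) False, of "- of_real t * cnj c" 1] assms(5)
    by (simp add: c_def[symmetric] cc[symmetric] algebra_simps)
  have "c = 0"
  proof (rule ccontr)
    assume "c \<noteq> 0"
    then have "0 < (cmod c)\<^sup>2" by simp
    then show False using *[of "(Re (a \<beta> \<beta>) + 1) / (cmod c)\<^sup>2"] psd_diag(1)[OF assms(1,2,4)]
      by (simp add: field_simps) (smt (verit) mult_nonneg_nonneg zero_less_power2 norm_eq_zero)
  qed
  then show ?thesis by (simp add: c_def)
qed (use assms in auto)

text \<open>Cholesky factorization: subtracting the rank one kernel built from column
  \<open>i\<close> clears row and column \<open>i\<close>, and the Schur complement is again
  positive semidefinite.\<close>

lemma psd_factor:
  assumes "finite I" "psd I a"
  shows "\<exists>v. \<forall>\<alpha>\<in>I. \<forall>\<beta>\<in>I. a \<alpha> \<beta> = (\<Sum>k<card I. v k \<alpha> * cnj (v k \<beta>))"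
  using assms
proof (induction I arbitrary: a rule: finite_induct)
  case empty
  then show ?case by auto
next
  case (insert i I)
  define s where "s = Re (a i i)"
  \<comment> \<open>For \<open>s = 0\<close> the division by zero gives \<open>w = 0\<close>; this
    is the correct value, since row \<open>i\<close> then vanishes by
    \<open>psd_zero_row\<close>.\<close>
  define w where "w = (\<lambda>\<alpha>. a \<alpha> i / sqrt s)"
  define b where "b = (\<lambda>\<alpha> \<beta>. a \<alpha> \<beta> - w \<alpha> * cnj (w \<beta>))"
  have fin: "finite (insert i I)" using insert by simp
  have s0: "0 \<le> s" and aii: "a i i = of_real s"
    using psd_diag[OF fin insert.prems] by (auto simp: s_def)
  have sq: "complex_of_real (sqrt s) * complex_of_real (sqrt s) = of_real s"
    using s0 by (metis of_real_mult real_sqrt_mult_self abs_of_nonneg)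
  have herm: "a \<beta> \<alpha> = cnj (a \<alpha> \<beta>)" if "\<alpha> \<in> insert i I" "\<beta> \<in> insert i I" for \<alpha> \<beta>
    using psdD(1)[OF insert.prems that] .
  have row: "a i \<beta> = w i * cnj (w \<beta>)" if "\<beta> \<in> insert i I" for \<beta>
  proof (cases "s = 0")
    case True
    then have "a i i = 0" using aii by simp
    then show ?thesis using psd_zero_row[OF fin insert.prems _ that] True by (simp add: w_def)
  next
    case False
    have "w i * cnj (w \<beta>) = of_real s * cnj (a \<beta> i) / (of_real (sqrt s) * of_real (sqrt s))"
      by (simp add: w_def aii)
    then show ?thesis using False herm[of \<beta> i] that by (simp add: sq)
  qed
  have brow: "b i \<beta> = 0" "b \<beta> i = 0" if "\<beta> \<in> insert i I" for \<beta>
    using row[OF that] herm[of i \<beta>] that by (auto simp: b_def)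
  have "psd I b"
    unfolding psd_def
  proof (intro conjI allI)
    show "hermitian I b" unfolding hermitian_def
    proof (intro ballI)
      fix \<alpha> \<beta> assume "\<alpha> \<in> I" "\<beta> \<in> I"
      then show "b \<beta> \<alpha> = cnj (b \<alpha> \<beta>)" using herm[of \<alpha> \<beta>] by (simp add: b_def)
    qed
    fix g
    \<comment> \<open>The entry at \<open>i\<close> is free because \<open>b\<close> vanishes there.
      It is chosen so that \<open>w\<close> annihilates \<open>h\<close>, whence \<open>a\<close>
      and \<open>b\<close> have the same form at \<open>h\<close>.\<close>
    define h where "h = (\<lambda>\<alpha>. if \<alpha> = i then - (\<Sum>\<beta>\<in>I. w \<beta> * g \<beta>) / w i else g \<alpha>)"
    have hI: "(\<Sum>\<alpha>\<in>I. w \<alpha> * h \<alpha>) = (\<Sum>\<alpha>\<in>I. w \<alpha> * g \<alpha>)"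
      using insert.hyps by (intro sum.cong) (auto simp: h_def)
    have w0: "w \<alpha> = 0" if "w i = 0" "\<alpha> \<in> I" for \<alpha>
    proof -
      have "s = 0" using that(1) aii by (auto simp: w_def)
      then show ?thesis by (simp add: w_def)
    qed
    have "(\<Sum>\<alpha>\<in>insert i I. w \<alpha> * h \<alpha>) = 0"
      using insert.hyps w0 hI by (cases "w i = 0") (auto simp: h_def)
    then have "0 \<le> form (insert i I) a h - form (insert i I) (\<lambda>\<alpha> \<beta>. w \<alpha> * cnj (w \<beta>)) h"
      using insert.prems by (simp add: form_rank_one psd_def)
    also have "\<dots> = form (insert i I) b h" unfolding b_def form_diff ..
    also have "\<dots> = form I b h"
      unfolding form_def using insert.hyps brow by simp
    also have "\<dots> = form I b g" using insert.hyps by (intro form_cong) (auto simp: h_def)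
    finally show "0 \<le> form I b g" .
  qed
  then obtain v where v: "\<forall>\<alpha>\<in>I. \<forall>\<beta>\<in>I. b \<alpha> \<beta> = (\<Sum>k<card I. v k \<alpha> * cnj (v k \<beta>))"
    using insert.IH by blast
  define u where "u = (\<lambda>k \<alpha>. if k = card I then w \<alpha> else if \<alpha> = i then 0 else v k \<alpha>)"
  have "a \<alpha> \<beta> = (\<Sum>k<card (insert i I). u k \<alpha> * cnj (u k \<beta>))"
    if "\<alpha> \<in> insert i I" "\<beta> \<in> insert i I" for \<alpha> \<beta>
  proof -
    have "(\<Sum>k<card I. u k \<alpha> * cnj (u k \<beta>)) = b \<alpha> \<beta>"
    proof (cases "\<alpha> = i \<or> \<beta> = i")
      case True
      then show ?thesis using brow that by (auto simp: u_def)
    next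
      case False
      then show ?thesis using v that by (simp add: u_def)
    qed
    then show ?thesis using insert.hyps by (simp add: b_def u_def)
  qed
  then show ?case by (intro exI[of _ u] ballI)
qed

section \<open>Isometries and contractions of Hilbert spaces\<close>

context complex_hilbert
begin

lemma H_add: "x \<in> H \<Longrightarrow> y \<in> H \<Longrightarrow> x + y \<in> H"
  and H_diff: "x \<in> H \<Longrightarrow> y \<in> H \<Longrightarrow> x - y \<in> H"
  and H_scale: "x \<in> H \<Longrightarrow> cscale c x \<in> H"
  and H_zero: "0 \<in> H"
  using subspace cseq.subspace_add cseq.subspace_diff cseq.subspace_scale cseq.subspace_0 by auto

lemma H_sum: "(\<And>i. i \<in> I \<Longrightarrow> x i \<in> H) \<Longrightarrow> (\<Sum>i\<in>I. x i) \<in> H"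
  using cseq.subspace_sum[OF subspace] by auto

lemma cscale_minus_one: "cscale (-1) x = - x"
  by (simp add: cscale_def fun_eq_iff)

lemma ip_diff: "\<lbrakk>x \<in> H; y \<in> H; w \<in> H\<rbrakk> \<Longrightarrow> ip (x - y) w = ip x w - ip y w"
  using ip_add[of x "cscale (-1) y" w] ip_scale[of y w "-1"] H_scale[of y "-1"]
  by (simp add: cscale_minus_one)

lemma ip_zero: "w \<in> H \<Longrightarrow> ip 0 w = 0"
  using ip_diff[of w w w] by simp

lemma ip_add_right: "\<lbrakk>x \<in> H; y \<in> H; w \<in> H\<rbrakk> \<Longrightarrow> ip w (x + y) = ip w x + ip w y"
  using ip_add[of x y w] ip_cnj[of x w] ip_cnj[of y w] ip_cnj[of "x+y" w] H_add by simp

lemma ip_diff_right: "\<lbrakk>x \<in> H; y \<in> H; w \<in> H\<rbrakk> \<Longrightarrow> ip w (x - y) = ip w x - ip w y"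
  using ip_diff[of x y w] ip_cnj[of x w] ip_cnj[of y w] ip_cnj[of "x-y" w] H_diff by simp

lemma ip_scale_right: "\<lbrakk>x \<in> H; w \<in> H\<rbrakk> \<Longrightarrow> ip w (cscale c x) = cnj c * ip w x"
  using ip_scale[of x w c] ip_cnj[of x w] ip_cnj[of "cscale c x" w] H_scale by simp

lemma ip_real: "x \<in> H \<Longrightarrow> ip x x = of_real (Re (ip x x))"
  using ip_cnj[of x x] by (metis Reals_cnj_iff of_real_Re)

lemma ip_nonneg: "x \<in> H \<Longrightarrow> 0 \<le> Re (ip x x)"
  using ip_pos[of x] ip_zero[of 0] H_zero by (cases "x = 0") auto

lemma hnorm_sq: "x \<in> H \<Longrightarrow> (hnorm ip x)\<^sup>2 = Re (ip x x)"
  using ip_nonneg by (simp add: hnorm_def)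

lemma hnorm_nonneg: "x \<in> H \<Longrightarrow> 0 \<le> hnorm ip x"
  using ip_nonneg by (simp add: hnorm_def)

lemma hnorm_eq_0: "x \<in> H \<Longrightarrow> hnorm ip x = 0 \<longleftrightarrow> x = 0"
  using ip_pos[of x] ip_zero[of 0] H_zero by (cases "x = 0") (auto simp: hnorm_def)

lemma linear_operator_diff:
  assumes "linear_operator H T" "x \<in> H" "y \<in> H"
  shows "T (x - y) = T x - T y"
proof -
  have "T (x - y + y) = T (x - y) + T y"
    using assms H_diff unfolding linear_operator_def by blast
  then show ?thesis by simp
qed

text \<open>
  The witness is \<open>x \<mapsto> x - (\<langle>x,w\<rangle> / \<langle>a,w\<rangle>) w\<close> with \<open>w = a - b\<close>; it is isometric because
  \<open>\<langle>a,w\<rangle> + \<langle>w,a\<rangle> = \<langle>w,w\<rangle>\<close>.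
\<close>

lemma reflection:
  assumes a: "a \<in> H" and b: "b \<in> H" and n: "ip a a = ip b b"
  shows "\<exists>W. linear_operator H W \<and> (\<forall>x\<in>H. \<forall>y\<in>H. ip (W x) (W y) = ip x y) \<and> W a = b \<and>
    (\<forall>x\<in>H. ip x a = ip x b \<longrightarrow> W x = x)"
proof (cases "a = b")
  case True
  then show ?thesis by (intro exI[of _ id]) (auto simp: linear_operator_def)
next
  case False
  define w where "w = a - b"
  have w: "w \<in> H" using a b H_diff w_def by auto
  define d where "d = ip a w"
  have d: "d + cnj d = ip w w"
  proof -
    have "cnj d = ip w a" using ip_cnj[OF a w] d_def by simp
    moreover have "ip w a = ip a a - ip b a" "d = ip a a - ip a b"
      "ip w w = ip a a - ip a b - (ip b a - ip b b)"
      using a b w by (auto simp: d_def w_def ip_diff ip_diff_right H_diff)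
    ultimately show ?thesis using n by simp
  qed
  have dnz: "d \<noteq> 0"
  proof
    assume "d = 0"
    then have "ip w w = 0" using d by simp
    then show False using ip_pos[OF w] False w_def by auto
  qed
  define W where "W = (\<lambda>x. x - cscale (ip x w / d) w)"
  have WH: "W x \<in> H" if "x \<in> H" for x using that w by (simp add: W_def H_diff H_scale)
  have "linear_operator H W"
    unfolding linear_operator_def
  proof (intro conjI ballI allI WH)
    show "W (x + y) = W x + W y" if "x \<in> H" "y \<in> H" for x y
      using that w by (simp add: W_def ip_add fun_eq_iff cscale_def add_divide_distrib algebra_simps)
    show "W (cscale c x) = cscale c (W x)" if "x \<in> H" for c x
      using that w by (simp add: W_def ip_scale) (simp add: fun_eq_iff cscale_def algebra_simps)
  qed
  moreover have "ip (W x) (W y) = ip x y" if "x \<in> H" "y \<in> H" for x y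
  proof -
    define s t where "s = ip x w / d" and "t = ip y w / d"
    have sd: "ip x w = s * d" "ip y w = t * d" using dnz by (auto simp: s_def t_def)
    have wy: "ip w y = cnj t * cnj d" using ip_cnj[OF that(2) w] sd by simp
    have e1: "ip (W x) z = ip x z - s * ip w z" if "z \<in> H" for z
      using that \<open>x \<in> H\<close> w by (simp add: W_def s_def ip_diff H_scale ip_scale)
    have "W y = y - cscale t w" by (simp add: W_def t_def)
    then have "ip (W x) (W y) = ip (W x) y - cnj t * ip (W x) w"
      using that w WH by (simp add: ip_diff_right H_scale ip_scale_right)
    also have "\<dots> = ip x y - s * (cnj t * cnj d) - cnj t * (s * d - s * (d + cnj d))"
      using that w by (simp only: e1 sd wy d)
    also have "\<dots> = ip x y" by (simp add: algebra_simps)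
    finally show ?thesis .
  qed
  moreover have "W a = b"
    using dnz unfolding W_def d_def[symmetric] by (simp add: w_def)
  moreover have "W x = x" if "x \<in> H" "ip x a = ip x b" for x
    using that a b unfolding W_def by (simp add: w_def ip_diff_right cscale_def fun_eq_iff)
  ultimately show ?thesis by blast
qed

text \<open>One vector is corrected at a time by a \<open>reflection\<close> of the whole space, so
  neither well-definedness on a span nor an extension to its complement has to be discussed. Earlier
  images stay fixed because they have equal inner products with the old and the new image of
  \<open>u i\<close>.\<close>

lemma isometry_extension:
  assumes "finite I" "\<And>\<alpha>. \<alpha> \<in> I \<Longrightarrow> u \<alpha> \<in> H" "\<And>\<alpha>. \<alpha> \<in> I \<Longrightarrow> v \<alpha> \<in> H"
    "\<And>\<alpha> \<beta>. \<alpha> \<in> I \<Longrightarrow> \<beta> \<in> I \<Longrightarrow> ip (u \<alpha>) (u \<beta>) = ip (v \<alpha>) (v \<beta>)"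
  shows "\<exists>V. linear_operator H V \<and> (\<forall>x\<in>H. \<forall>y\<in>H. ip (V x) (V y) = ip x y) \<and> (\<forall>\<alpha>\<in>I. V (u \<alpha>) = v \<alpha>)"
  using assms
proof (induction I rule: finite_induct)
  case empty
  show ?case by (intro exI[of _ id]) (auto simp: linear_operator_def)
next
  case (insert i I)
  obtain V where V: "linear_operator H V" "\<forall>x\<in>H. \<forall>y\<in>H. ip (V x) (V y) = ip x y"
    "\<forall>\<alpha>\<in>I. V (u \<alpha>) = v \<alpha>"
    using insert.IH insert.prems by auto
  have VH: "V x \<in> H" if "x \<in> H" for x using V(1) that by (auto simp: linear_operator_def)
  obtain W where W: "linear_operator H W" "\<forall>x\<in>H. \<forall>y\<in>H. ip (W x) (W y) = ip x y"
    "W (V (u i)) = v i" "\<forall>x\<in>H. ip x (V (u i)) = ip x (v i) \<longrightarrow> W x = x"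
    using reflection[of "V (u i)" "v i"] insert.prems V(2) VH by auto
  have "W (V (u \<alpha>)) = v \<alpha>" if "\<alpha> \<in> I" for \<alpha>
  proof -
    have "ip (v \<alpha>) (V (u i)) = ip (V (u \<alpha>)) (V (u i))" using V(3) that by simp
    also have "\<dots> = ip (u \<alpha>) (u i)" using V(2) that insert.prems by simp
    also have "\<dots> = ip (v \<alpha>) (v i)" using insert.prems that by simp
    finally show ?thesis using W(4) V(3) that insert.prems by simp
  qed
  then have "\<forall>\<alpha>\<in>insert i I. (W \<circ> V) (u \<alpha>) = v \<alpha>" using W(3) by simp
  moreover have "\<forall>x\<in>H. \<forall>y\<in>H. ip ((W \<circ> V) x) ((W \<circ> V) y) = ip x y"
    using V(2) W(2) VH by simp
  moreover have "linear_operator H (W \<circ> V)"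
    using V(1) W(1) unfolding linear_operator_def by simp
  ultimately show ?case by (intro exI[of _ "W \<circ> V"] conjI)
qed


section \<open>The metric of a Hilbert space and the inversion of I - T\<close>

lemma ip_cauchy_schwarz:
  assumes x: "x \<in> H" and y: "y \<in> H"
  shows "cmod (ip x y) \<le> hnorm ip x * hnorm ip y"
proof (cases "y = 0")
  case True
  then have "ip x y = 0" using ip_cnj[OF y x] ip_zero[OF x] by (metis complex_cnj_zero_iff)
  then show ?thesis using hnorm_nonneg x y by simp
next
  case False
  define n where "n = Re (ip y y)"
  have n: "n > 0" "ip y y = of_real n" using ip_pos[OF y False] ip_real[OF y] by (auto simp: n_def)
  define c where "c = ip x y / of_real n"
  define m where "m = (cmod (ip x y))\<^sup>2"
  have m: "ip x y * cnj (ip x y) = of_real m" unfolding m_def by (rule complex_norm_square[symmetric])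
  have z: "x - cscale c y \<in> H" using x y by (simp add: H_diff H_scale)
  have "ip (x - cscale c y) (x - cscale c y) =
      ip x x - cnj c * ip x y - (c * ip y x - c * (cnj c * ip y y))"
    using x y by (simp add: ip_diff ip_diff_right H_diff H_scale ip_scale ip_scale_right algebra_simps)
  also have "c * (cnj c * ip y y) = c * cnj (ip x y)" using n by (simp add: c_def)
  also have "c * ip y x = c * cnj (ip x y)" using ip_cnj[OF x y] by simp
  also have "cnj c * ip x y = of_real (m / n)" using m by (simp add: c_def mult.commute)
  also have "ip x x - of_real (m / n) - (c * cnj (ip x y) - c * cnj (ip x y)) = ip x x - of_real (m / n)"
    by simp
  finally have "ip (x - cscale c y) (x - cscale c y) = ip x x - of_real (m / n)" .
  then have "m / n \<le> Re (ip x x)" using ip_nonneg[OF z] by simp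
  then have "(cmod (ip x y))\<^sup>2 \<le> (hnorm ip x * hnorm ip y)\<^sup>2"
    using n(1) x y by (simp add: power_mult_distrib hnorm_sq m_def n_def[symmetric] pos_divide_le_eq)
  then show ?thesis using hnorm_nonneg x y by (meson mult_nonneg_nonneg power2_le_imp_le)
qed

lemma hnorm_triangle:
  assumes x: "x \<in> H" and y: "y \<in> H"
  shows "hnorm ip (x + y) \<le> hnorm ip x + hnorm ip y"
proof -
  have r: "Re (ip y x) = Re (ip x y)" using ip_cnj[OF x y] by simp
  have "(hnorm ip (x + y))\<^sup>2 = Re (ip (x + y) (x + y))" using x y by (simp add: hnorm_sq H_add)
  also have "\<dots> = Re (ip x x) + Re (ip y y) + 2 * Re (ip x y)"
    using x y r by (simp add: ip_add ip_add_right H_add)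
  also have "\<dots> \<le> (hnorm ip x)\<^sup>2 + (hnorm ip y)\<^sup>2 + 2 * (hnorm ip x * hnorm ip y)"
    using ip_cauchy_schwarz[OF x y] complex_Re_le_cmod[of "ip x y"] x y by (simp add: hnorm_sq)
  also have "\<dots> = (hnorm ip x + hnorm ip y)\<^sup>2" by (simp add: power2_sum)
  finally show ?thesis using hnorm_nonneg x y by (meson add_nonneg_nonneg power2_le_imp_le)
qed

lemma hnorm_minus_commute: "x \<in> H \<Longrightarrow> y \<in> H \<Longrightarrow> hnorm ip (x - y) = hnorm ip (y - x)"
  by (simp add: hnorm_def ip_diff ip_diff_right H_diff algebra_simps)

text \<open>\<open>Metric_space\<close> requires nonnegativity and symmetry for all arguments, while
  \<open>ip\<close> is only controlled on \<open>H\<close>; hence the default 0 outside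
  \<open>H\<close>.\<close>

definition hdist :: "cseq \<Rightarrow> cseq \<Rightarrow> real" where
  "hdist x y = (if x \<in> H \<and> y \<in> H then hnorm ip (x - y) else 0)"

sublocale Metric_space H hdist
proof
  show "0 \<le> hdist x y" "hdist x y = hdist y x" for x y
    by (auto simp: hdist_def hnorm_nonneg H_diff hnorm_minus_commute)
  show "hdist x y = 0 \<longleftrightarrow> x = y" if "x \<in> H" "y \<in> H" for x y
    using that hnorm_eq_0[of "x - y"] by (simp add: hdist_def H_diff)
  show "hdist x z \<le> hdist x y + hdist y z" if "x \<in> H" "y \<in> H" "z \<in> H" for x y z
    using hnorm_triangle[of "x - y" "y - z"] that by (simp add: hdist_def H_diff)
qed

lemma mcomplete_H: mcomplete
  unfolding mcomplete_def
proof (intro allI impI)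
  fix X assume X: "MCauchy X"
  then have XH: "X m \<in> H" for m by (auto simp: MCauchy_def)
  have "\<exists>M. \<forall>m\<ge>M. \<forall>k\<ge>M. hnorm ip (X m - X k) < e" if "e > 0" for e
    using X that XH unfolding MCauchy_def hdist_def by simp
  then obtain x where x: "x \<in> H" "(\<lambda>m. hnorm ip (X m - x)) \<longlonglongrightarrow> 0"
    using complete[of X] XH by blast
  then have "limitin mtopology X x sequentially"
    unfolding limit_metric_sequentially hdist_def LIMSEQ_def
    using XH by (auto simp: hnorm_nonneg H_diff)
  then show "\<exists>l. limitin mtopology X l sequentially" by (rule exI[of _ x])
qed

text \<open>Solving \<open>x - T x = y\<close> is a fixed point problem for the contraction
  \<open>x \<mapsto> y + T x\<close>, so Banach's theorem takes the place of a Neumann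
  series.\<close>

lemma bij_betw_id_minus:
  assumes T: "linear_operator H T" and le: "opnorm_le H ip T r" and r: "r < 1"
  shows "bij_betw (\<lambda>x. x - T x) H H"
proof -
  have TH: "T x \<in> H" if "x \<in> H" for x using T that by (auto simp: linear_operator_def)
  have d0: "hdist (T x) (T x') \<le> r * hdist x x'" if "x \<in> H" "x' \<in> H" for x x'
  proof -
    have "hnorm ip (T (x - x')) \<le> r * hnorm ip (x - x')"
      using le that H_diff by (simp only: opnorm_le_def)
    then show ?thesis using that TH linear_operator_diff[OF T that] by (simp only: hdist_def) simp
  qed
  have ex: "\<exists>x\<in>H. x - T x = y" if y: "y \<in> H" for y
  proof -
    have "hdist (y + T x) (y + T x') \<le> r * hdist x x'" if "x \<in> H" "x' \<in> H" for x x'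
    proof -
      have "y + T x - (y + T x') = T x - T x'" by (rule add_diff_cancel_left)
      then show ?thesis using d0[OF that] that y TH H_add by (simp only: hdist_def)
    qed
    then obtain x where "x \<in> H" "y + T x = x"
      using Banach_fixedpoint_thm[of "\<lambda>x. y + T x" r] mcomplete_H y TH r H_add H_zero by blast
    then show ?thesis by (intro bexI[of _ x]) (metis add_diff_cancel_right')
  qed
  have inj: "inj_on (\<lambda>x. x - T x) H"
  proof (rule inj_onI)
    fix x x' assume xx: "x \<in> H" "x' \<in> H" "x - T x = x' - T x'"
    then have "x - x' = T x - T x'" by (metis add_diff_cancel_left diff_add_cancel diff_diff_eq2 add.commute)
    then have "hdist x x' = hdist (T x) (T x')" using xx TH by (simp only: hdist_def)
    then have "hdist x x' \<le> r * hdist x x'" using d0[OF xx(1,2)] by simp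
    moreover have "r * hdist x x' < 1 * hdist x x'" if "hdist x x' > 0"
      using r that by (rule mult_strict_right_mono)
    ultimately have "\<not> hdist x x' > 0" by linarith
    then have "hdist x x' = 0" using nonneg[of x x'] by linarith
    then show "x = x'" using xx by simp
  qed
  show ?thesis
    unfolding bij_betw_def
  proof (intro conjI inj equalityI subsetI)
    show "y \<in> H" if "y \<in> (\<lambda>x. x - T x) ` H" for y
      using that TH H_diff by (elim imageE) metis
    show "y \<in> (\<lambda>x. x - T x) ` H" if "y \<in> H" for y
      using ex[OF that] by (elim bexE) (metis imageI)
  qed
qed

end

section \<open>Finite dimensional Hilbert spaces with a prescribed Gram matrix\<close>

definition fin_space :: "nat \<Rightarrow> cseq set" where
  "fin_space d = {x. \<forall>i\<ge>d. x i = 0}"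

definition gram_ip :: "nat \<Rightarrow> (nat \<Rightarrow> nat \<Rightarrow> complex) \<Rightarrow> cseq \<Rightarrow> cseq \<Rightarrow> complex" where
  "gram_ip d G x y = (\<Sum>i<d. \<Sum>k<d. G i k * x i * cnj (y k))"

lemma Re_gram_ip: "Re (gram_ip d G x x) = form {..<d} G x"
  by (simp add: gram_ip_def form_def)

text \<open>By the lower bound the norm dominates every coordinate. A Cauchy sequence therefore
  converges coordinatewise, and the form is a finite sum, hence continuous in the
  coordinates.\<close>

lemma complex_hilbert_fin_space:
  assumes G: "hermitian {..<d} G" and c: "c > 0"
    and lb: "\<And>x. c * (\<Sum>i<d. (cmod (x i))\<^sup>2) \<le> form {..<d} G x"
  shows "complex_hilbert (fin_space d) (gram_ip d G)"
proof
  show "cseq.subspace (fin_space d)"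
    by (auto simp: cseq.subspace_def fin_space_def cscale_def)
  show "gram_ip d G (x + y) w = gram_ip d G x w + gram_ip d G y w" for x y w
    by (simp add: gram_ip_def algebra_simps sum.distrib)
  show "gram_ip d G (cscale e x) w = e * gram_ip d G x w" for e x w
    by (simp add: gram_ip_def cscale_def sum_distrib_left mult_ac)
  show "gram_ip d G y x = cnj (gram_ip d G x y)" for x y
  proof -
    have "gram_ip d G y x = (\<Sum>k<d. \<Sum>i<d. G k i * y k * cnj (x i))" by (simp add: gram_ip_def)
    also have "\<dots> = (\<Sum>i<d. \<Sum>k<d. G k i * y k * cnj (x i))" by (rule sum.swap)
    also have "\<dots> = (\<Sum>i<d. \<Sum>k<d. cnj (G i k * x i * cnj (y k)))"
      by (intro sum.cong refl) (simp add: hermitianD[OF G, symmetric])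
    finally show ?thesis by (simp add: gram_ip_def cnj_sum)
  qed
  have coord: "c * (cmod (x i))\<^sup>2 \<le> form {..<d} G x" if "i < d" for x i
  proof -
    have "(cmod (x i))\<^sup>2 \<le> (\<Sum>i<d. (cmod (x i))\<^sup>2)"
      using that by (intro member_le_sum) auto
    then show ?thesis using lb[of x] c by (meson mult_left_mono order_trans less_imp_le)
  qed
  show "Re (gram_ip d G x x) > 0" if x: "x \<in> fin_space d" "x \<noteq> 0" for x
  proof -
    obtain i where "x i \<noteq> 0" using x(2) by (auto simp: fun_eq_iff)
    moreover from this have "i < d" using x(1) unfolding fin_space_def mem_Collect_eq by (metis not_le)
    ultimately have "0 < c * (cmod (x i))\<^sup>2" "c * (cmod (x i))\<^sup>2 \<le> form {..<d} G x"
      using c coord by auto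
    then show ?thesis by (simp add: Re_gram_ip)
  qed
  fix X :: "nat \<Rightarrow> cseq" assume X: "\<And>m. X m \<in> fin_space d"
    and C: "\<And>e. e > 0 \<Longrightarrow> \<exists>M. \<forall>m\<ge>M. \<forall>k\<ge>M. hnorm (gram_ip d G) (X m - X k) < e"
  have coord': "sqrt c * cmod (x i) \<le> hnorm (gram_ip d G) x" if "i < d" for x i
    using coord[OF that, of x] by (metis hnorm_def Re_gram_ip real_sqrt_le_mono real_sqrt_mult
        real_sqrt_abs abs_norm_cancel)
  have "Cauchy (\<lambda>m. X m i)" if "i < d" for i
  proof (rule CauchyI)
    fix e :: real assume "e > 0"
    then have "sqrt c * e > 0" using c by simp
    then obtain M where M: "\<forall>m\<ge>M. \<forall>k\<ge>M. hnorm (gram_ip d G) (X m - X k) < sqrt c * e" using C by blast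
    have "norm (X m i - X k i) < e" if "m \<ge> M" "k \<ge> M" for m k
    proof -
      have "sqrt c * norm (X m i - X k i) < sqrt c * e"
        using coord'[OF \<open>i < d\<close>, of "X m - X k"] M that by (auto intro: le_less_trans)
      then show ?thesis using c by simp
    qed
    then show "\<exists>M. \<forall>m\<ge>M. \<forall>n\<ge>M. norm (X m i - X n i) < e" by blast
  qed
  then have "\<forall>i. \<exists>l. i < d \<longrightarrow> (\<lambda>m. X m i) \<longlonglongrightarrow> l"
    using Cauchy_convergent convergent_def by blast
  then obtain l where l: "\<And>i. i < d \<Longrightarrow> (\<lambda>m. X m i) \<longlonglongrightarrow> l i" by metis
  define x where "x = (\<lambda>i. if i < d then l i else 0)"
  have "(\<lambda>m. (X m - x) i) \<longlonglongrightarrow> 0" if "i < d" for i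
    using tendsto_diff[OF l[OF that] tendsto_const[of "l i"]] that by (simp add: x_def)
  then have "(\<lambda>m. gram_ip d G (X m - x) (X m - x)) \<longlonglongrightarrow> (\<Sum>i<d. \<Sum>k<d. G i k * 0 * cnj 0)"
    unfolding gram_ip_def by (intro tendsto_sum tendsto_mult tendsto_cnj tendsto_const) auto
  then have "(\<lambda>m. hnorm (gram_ip d G) (X m - x)) \<longlonglongrightarrow> sqrt (Re 0)"
    unfolding hnorm_def by (intro tendsto_real_sqrt tendsto_Re) simp
  then show "\<exists>x\<in>fin_space d. (\<lambda>m. hnorm (gram_ip d G) (X m - x)) \<longlonglongrightarrow> 0"
    by (intro bexI[of _ x]) (auto simp: x_def fin_space_def)
qed

section \<open>Multi-indices and coefficient families\<close>

abbreviation lookup :: "('a \<Rightarrow>\<^sub>0 'b::zero) \<Rightarrow> 'a \<Rightarrow> 'b" where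
  "lookup \<equiv> Poly_Mapping.lookup"

abbreviation keys :: "('a \<Rightarrow>\<^sub>0 'b::zero) \<Rightarrow> 'a set" where
  "keys \<equiv> Poly_Mapping.keys"

definition mdeg :: "('n::finite \<Rightarrow>\<^sub>0 nat) \<Rightarrow> nat" where
  "mdeg \<alpha> = (\<Sum>j\<in>UNIV. lookup \<alpha> j)"

definition indices :: "nat \<Rightarrow> ('n::finite \<Rightarrow>\<^sub>0 nat) set" where
  "indices N = {\<alpha>. mdeg \<alpha> \<le> N}"

definition below :: "('n \<Rightarrow>\<^sub>0 nat) \<Rightarrow> ('n \<Rightarrow>\<^sub>0 nat) \<Rightarrow> bool" where
  "below \<gamma> \<beta> \<longleftrightarrow> (\<forall>j. lookup \<gamma> j \<le> lookup \<beta> j)"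

text \<open>On coefficient families, \<open>shift \<gamma>\<close> is multiplication by the monomial \<open>z\<^sup>\<gamma>\<close>.\<close>

definition shift :: "('n \<Rightarrow>\<^sub>0 nat) \<Rightarrow> (('n \<Rightarrow>\<^sub>0 nat) \<Rightarrow> complex) \<Rightarrow> ('n \<Rightarrow>\<^sub>0 nat) \<Rightarrow> complex" where
  "shift \<gamma> g \<beta> = (if below \<gamma> \<beta> then g (\<beta> - \<gamma>) else 0)"

definition unit_index :: "'n \<Rightarrow> ('n \<Rightarrow>\<^sub>0 nat)" where
  "unit_index j = Poly_Mapping.single j 1"

lemma lookup_le_mdeg: "lookup \<alpha> j \<le> mdeg (\<alpha> :: 'n::finite \<Rightarrow>\<^sub>0 nat)"
  unfolding mdeg_def by (rule member_le_sum) auto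

lemma finite_indices [simp]: "finite (indices N :: ('n::finite \<Rightarrow>\<^sub>0 nat) set)"
proof (rule finite_imageD)
  have "lookup ` (indices N :: ('n \<Rightarrow>\<^sub>0 nat) set) \<subseteq> Pi\<^sub>E UNIV (\<lambda>_. {..N})"
    using le_trans[OF lookup_le_mdeg] by (auto simp: indices_def)
  then show "finite (lookup ` (indices N :: ('n \<Rightarrow>\<^sub>0 nat) set))"
    by (rule finite_subset) (intro finite_PiE; simp)
  show "inj_on lookup (indices N :: ('n \<Rightarrow>\<^sub>0 nat) set)"
    by (simp add: inj_on_def poly_mapping.lookup_inject)
qed

lemma mdeg_add: "mdeg (\<alpha> + \<beta>) = mdeg \<alpha> + mdeg (\<beta> :: 'n::finite \<Rightarrow>\<^sub>0 nat)"
  by (simp add: mdeg_def lookup_add sum.distrib)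

lemma mdeg_single [simp]: "mdeg (Poly_Mapping.single j k :: 'n::finite \<Rightarrow>\<^sub>0 nat) = k"
  by (simp add: mdeg_def lookup_single when_def)

lemma mdeg_unit [simp]: "mdeg (unit_index j :: 'n::finite \<Rightarrow>\<^sub>0 nat) = 1"
  by (simp add: unit_index_def)

lemma single_Suc: "Poly_Mapping.single j (Suc k) = unit_index j + Poly_Mapping.single j k"
  by (simp add: unit_index_def flip: single_add)

lemma below_add [simp]: "below \<gamma> (\<gamma> + \<beta>)"
  by (simp add: below_def lookup_add)

lemma below_minus: "below \<gamma> \<beta> \<Longrightarrow> \<gamma> + (\<beta> - \<gamma>) = \<beta>"
  by (rule poly_mapping_eqI) (simp add: below_def lookup_add lookup_minus)

lemma mdeg_minus: "below \<gamma> \<beta> \<Longrightarrow> mdeg \<beta> = mdeg \<gamma> + mdeg (\<beta> - \<gamma> :: 'n::finite \<Rightarrow>\<^sub>0 nat)"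
  using mdeg_add[of \<gamma> "\<beta> - \<gamma>"] by (simp add: below_minus)

lemma shift_add [simp]: "shift \<gamma> g (\<gamma> + \<beta>) = g \<beta>"
  by (simp add: shift_def)

lemma shift_zero [simp]: "shift 0 g = g"
  by (simp add: shift_def fun_eq_iff below_def)

lemma shift_shift: "shift \<gamma> (shift \<delta> g) = shift (\<gamma> + \<delta>) g"
proof
  fix \<beta>
  have "below \<gamma> \<beta> \<and> below \<delta> (\<beta> - \<gamma>) \<longleftrightarrow> below (\<gamma> + \<delta>) \<beta>"
  proof -
    have "lookup \<gamma> j \<le> lookup \<beta> j \<and> lookup \<delta> j \<le> lookup \<beta> j - lookup \<gamma> j \<longleftrightarrow>
        lookup \<gamma> j + lookup \<delta> j \<le> lookup \<beta> j" for j by auto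
    then show ?thesis by (simp add: below_def lookup_minus lookup_add flip: all_conj_distrib)
  qed
  moreover have "\<beta> - \<gamma> - \<delta> = \<beta> - (\<gamma> + \<delta>)"
    by (rule poly_mapping_eqI) (simp add: lookup_minus lookup_add)
  ultimately show "shift \<gamma> (shift \<delta> g) \<beta> = shift (\<gamma> + \<delta>) g \<beta>"
    by (auto simp: shift_def)
qed

text \<open>This is the nilpotency of the truncated shifts: a monomial of degree above
  \<open>N\<close> acts as zero on coefficients of degree at most \<open>N\<close>.\<close>

lemma shift_eq_0:
  assumes "mdeg \<beta> < mdeg (\<gamma> :: 'n::finite \<Rightarrow>\<^sub>0 nat)"
  shows "shift \<gamma> g \<beta> = 0"
  using assms mdeg_minus[of \<gamma> \<beta>] by (auto simp: shift_def)

text \<open>Multiplication by a monomial never lowers degrees. Truncating before or after it gives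
  the same result up to degree \<open>N\<close>, so truncated shifts still compose like
  monomials.\<close>

lemma shift_cong:
  assumes "\<And>\<alpha>. mdeg \<alpha> \<le> mdeg \<beta> \<Longrightarrow> g \<alpha> = h \<alpha>"
  shows "shift \<gamma> g \<beta> = shift \<gamma> h (\<beta> :: 'n::finite \<Rightarrow>\<^sub>0 nat)"
  using assms mdeg_minus[of \<gamma> \<beta>] by (auto simp: shift_def)

lemma power_monomial_add: "power_monomial z (\<alpha> + \<beta>) = power_monomial z \<alpha> * power_monomial z \<beta>"
  by (simp add: power_monomial_def lookup_add power_add prod.distrib)

lemma power_monomial_unit [simp]: "power_monomial z (unit_index j) = z $ j"
proof -
  have "power_monomial z (unit_index j) = (\<Prod>i\<in>UNIV. if i = j then z $ i else 1)"
    unfolding power_monomial_def by (intro prod.cong) (auto simp: unit_index_def lookup_single when_def)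
  then show ?thesis by simp
qed

lemma power_monomial_scale:
  "power_monomial (\<chi> j. c * z $ j) \<alpha> = c ^ mdeg \<alpha> * power_monomial z \<alpha>"
  by (simp add: power_monomial_def mdeg_def power_mult_distrib prod.distrib power_sum)

lemma peval_superset:
  assumes "finite I" "keys p \<subseteq> I"
  shows "peval p z = (\<Sum>\<alpha>\<in>I. lookup p \<alpha> * power_monomial z \<alpha>)"
  unfolding peval_def using assms by (intro sum.mono_neutral_left) (auto simp: in_keys_iff)

lemma ex_peval:
  assumes "finite I"
  shows "\<exists>A :: 'n::finite cpoly. \<forall>z. peval A z = (\<Sum>\<alpha>\<in>I. g \<alpha> * power_monomial z \<alpha>)"
proof -
  define A where "A = Abs_poly_mapping (\<lambda>\<alpha>. if \<alpha> \<in> I then g \<alpha> else 0)"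
  have "finite {\<alpha>. (if \<alpha> \<in> I then g \<alpha> else 0) \<noteq> 0}"
    by (rule finite_subset[OF _ assms]) auto
  then have l: "lookup A = (\<lambda>\<alpha>. if \<alpha> \<in> I then g \<alpha> else 0)"
    unfolding A_def by (rule lookup_Abs_poly_mapping)
  have "keys A \<subseteq> I" by (auto simp: in_keys_iff l split: if_splits)
  then show ?thesis
    by (intro exI[of _ A] allI) (simp add: peval_superset[OF assms] l)
qed

section \<open>Orthogonality of monomials on grids of roots of unity\<close>

lemma sum_root_unity:
  assumes "L > 0"
  shows "(\<Sum>k<L. exp (2 * of_real pi * \<i> * of_nat k / of_nat L) ^ a *
      cnj (exp (2 * of_real pi * \<i> * of_nat k / of_nat L)) ^ b) =
    (if a mod L = b mod L then of_nat L else 0)"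
proof -
  define e where "e = (\<lambda>m. exp (2 * of_real pi * \<i> * of_nat m / of_nat L))"
  \<comment> \<open>Since \<open>e k ^ a = e a ^ k\<close>, the summand is \<open>w ^ k\<close> and
    the sum is geometric.\<close>
  define w where "w = e a * cnj (e b)"
  have n1: "e m * cnj (e m) = 1" for m
    by (simp add: e_def exp_cnj flip: exp_add)
  have ek: "e k ^ m = e m ^ k" for k m
    unfolding e_def by (simp add: mult_ac flip: exp_of_nat_mult)
  have "(\<Sum>k<L. e k ^ a * cnj (e k) ^ b) = (\<Sum>k<L. w ^ k)"
    by (simp add: w_def power_mult_distrib ek flip: complex_cnj_power)
  moreover have "w = 1 \<longleftrightarrow> a mod L = b mod L"
  proof -
    have "w = 1 \<longleftrightarrow> e a = e b"
      using n1[of b] by (metis mult.assoc mult.commute mult.right_neutral w_def)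
    also have "\<dots> \<longleftrightarrow> a mod L = b mod L"
      unfolding e_def using complex_root_unity_eq[of L a b] assms by (simp add: mult_ac)
    finally show ?thesis .
  qed
  moreover have "w ^ L = 1"
  proof -
    have "e m ^ L = 1" for m
    proof -
      have "e m ^ L = exp (of_real (2 * real m * pi) * \<i>)"
        unfolding e_def using assms by (simp add: mult_ac flip: exp_of_nat_mult)
      also have "\<dots> = 1" using exp_integer_2pi[of "real m"] by simp
      finally show ?thesis .
    qed
    then show ?thesis by (simp add: w_def power_mult_distrib flip: complex_cnj_power)
  qed
  ultimately have "(\<Sum>k<L. e k ^ a * cnj (e k) ^ b) = (if a mod L = b mod L then of_nat L else 0)"
    using geometric_sum[of w L] by auto
  then show ?thesis by (simp add: e_def)
qed

definition root_point :: "nat \<Rightarrow> ('n \<Rightarrow> nat) \<Rightarrow> complex ^ 'n" where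
  "root_point L k = (\<chi> j. exp (2 * of_real pi * \<i> * of_nat (k j) / of_nat L))"

abbreviation root_grid :: "nat \<Rightarrow> ('n \<Rightarrow> nat) set" where
  "root_grid L \<equiv> Pi\<^sub>E UNIV (\<lambda>_. {..<L})"

lemma cmod_root_point [simp]: "cmod (root_point L k $ j) = 1"
  by (simp add: root_point_def norm_exp_eq_Re)

lemma root_point_orthogonality:
  fixes \<alpha> \<beta> :: "'n::finite \<Rightarrow>\<^sub>0 nat"
  assumes "L > 0"
  shows "(\<Sum>k\<in>root_grid L. power_monomial (root_point L k) \<alpha> * cnj (power_monomial (root_point L k) \<beta>)) =
    (if \<forall>j. lookup \<alpha> j mod L = lookup \<beta> j mod L then of_nat L ^ CARD('n) else 0)"
proof -
  let ?e = "\<lambda>k. exp (2 * of_real pi * \<i> * of_nat k / of_nat L)"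
  have "(\<Sum>k\<in>root_grid L. power_monomial (root_point L k) \<alpha> * cnj (power_monomial (root_point L k) \<beta>)) =
    (\<Sum>k\<in>root_grid L. \<Prod>j\<in>UNIV. ?e (k j) ^ lookup \<alpha> j * cnj (?e (k j)) ^ lookup \<beta> j)"
    by (simp add: power_monomial_def root_point_def prod.distrib)
  also have "\<dots> = (\<Prod>j\<in>UNIV. \<Sum>k<L. ?e k ^ lookup \<alpha> j * cnj (?e k) ^ lookup \<beta> j)"
    by (rule prod_sum_PiE[symmetric]) auto
  also have "\<dots> = (\<Prod>j\<in>UNIV. if lookup \<alpha> j mod L = lookup \<beta> j mod L then of_nat L else 0)"
    by (simp add: sum_root_unity[OF assms])
  also have "\<dots> = (if \<forall>j. lookup \<alpha> j mod L = lookup \<beta> j mod L then of_nat L ^ CARD('n) else 0)"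
    by (auto simp: prod_zero_iff)
  finally show ?thesis .
qed

text \<open>For \<open>L > N\<close> the exponents of \<open>p\<close> are their own residues modulo
  \<open>L\<close>, so the finite grid already separates the monomials and replaces the integral
  over the torus.\<close>

lemma parseval:
  fixes p :: "'n::finite cpoly"
  assumes "keys p \<subseteq> indices N" "L > N"
  shows "(\<Sum>k\<in>root_grid L. (cmod (peval p (root_point L k)))\<^sup>2) =
    real L ^ CARD('n) * (\<Sum>\<alpha>\<in>indices N. (cmod (lookup p \<alpha>))\<^sup>2)"
proof -
  let ?I = "indices N :: ('n \<Rightarrow>\<^sub>0 nat) set"
  let ?m = "\<lambda>k. power_monomial (root_point L k)"
  have L: "L > 0" using assms by simp
  have "complex_of_real (\<Sum>k\<in>root_grid L. (cmod (peval p (root_point L k)))\<^sup>2) =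
    (\<Sum>k\<in>root_grid L. \<Sum>\<alpha>\<in>?I. \<Sum>\<beta>\<in>?I. (lookup p \<alpha> * cnj (lookup p \<beta>)) * (?m k \<alpha> * cnj (?m k \<beta>)))"
    by (simp add: complex_norm_square peval_superset[OF finite_indices assms(1)] cnj_sum sum_product mult_ac del: of_real_power)
  also have "\<dots> = (\<Sum>\<alpha>\<in>?I. \<Sum>\<beta>\<in>?I. \<Sum>k\<in>root_grid L. (lookup p \<alpha> * cnj (lookup p \<beta>)) * (?m k \<alpha> * cnj (?m k \<beta>)))"
    by (subst sum.swap, intro sum.cong refl, subst sum.swap, rule refl)
  also have "\<dots> = (\<Sum>\<alpha>\<in>?I. \<Sum>\<beta>\<in>?I. (lookup p \<alpha> * cnj (lookup p \<beta>)) * (if \<alpha> = \<beta> then of_nat L ^ CARD('n) else 0))"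
  proof (intro sum.cong refl)
    fix \<alpha> \<beta> assume ab: "\<alpha> \<in> ?I" "\<beta> \<in> ?I"
    have "lookup \<gamma> j mod L = lookup \<gamma> j" if "\<gamma> \<in> ?I" for \<gamma> j
      using lookup_le_mdeg[of \<gamma> j] that assms(2) by (simp add: indices_def)
    then have "(\<forall>j. lookup \<alpha> j mod L = lookup \<beta> j mod L) \<longleftrightarrow> \<alpha> = \<beta>"
      using ab by (auto intro: poly_mapping_eqI)
    then show "(\<Sum>k\<in>root_grid L. (lookup p \<alpha> * cnj (lookup p \<beta>)) * (?m k \<alpha> * cnj (?m k \<beta>))) =
      (lookup p \<alpha> * cnj (lookup p \<beta>)) * (if \<alpha> = \<beta> then of_nat L ^ CARD('n) else 0)"
      by (simp add: root_point_orthogonality[OF L] flip: sum_distrib_left)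
  qed
  also have "\<dots> = (\<Sum>\<alpha>\<in>?I. (lookup p \<alpha> * cnj (lookup p \<alpha>)) * of_nat L ^ CARD('n))"
    by (intro sum.cong refl) (simp add: if_distrib[of "\<lambda>x. _ * x"] cong: if_cong)
  also have "\<dots> = complex_of_real (real L ^ CARD('n) * (\<Sum>\<alpha>\<in>?I. (cmod (lookup p \<alpha>))\<^sup>2))"
    by (simp only: of_real_mult of_real_sum complex_norm_square) (simp add: sum_distrib_left mult_ac)
  finally show ?thesis by (simp only: of_real_eq_iff)
qed

section \<open>Uniqueness of power series coefficients and products with polynomials\<close>

lemma has_sum_finite_sum:
  fixes g :: "'k \<Rightarrow> 'a \<Rightarrow> complex"
  assumes "finite K" "\<And>k. k \<in> K \<Longrightarrow> (g k has_sum s k) A"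
  shows "((\<lambda>x. \<Sum>k\<in>K. g k x) has_sum (\<Sum>k\<in>K. s k)) A"
  using assms by (induction K rule: finite_induct) (auto intro: has_sum_add)

text \<open>
  Averaging over a grid of \<open>L\<close>-th roots of unity isolates the indices congruent to \<open>\<beta>\<close> modulo \<open>L\<close>;
  for large \<open>L\<close> all of them except \<open>\<beta>\<close> lie in the tail of an absolutely convergent series.
\<close>

lemma power_series_eq_0:
  fixes c :: "('n::finite \<Rightarrow>\<^sub>0 nat) \<Rightarrow> complex"
  assumes c: "\<And>z. z \<in> polydisk \<Longrightarrow> ((\<lambda>\<alpha>. c \<alpha> * power_monomial z \<alpha>) has_sum 0) UNIV"
  shows "c \<beta> = 0"
proof -
  \<comment> \<open>The radius 1/2 moves the torus, on which the grid lies, into the polydisk; it is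
    absorbed into the coefficients.\<close>
  define h where "h = (\<lambda>\<alpha>. c \<alpha> * (1/2) ^ mdeg \<alpha>)"
  have pm: "((\<lambda>\<alpha>. h \<alpha> * power_monomial z \<alpha>) has_sum 0) UNIV" if "\<And>j. cmod (z $ j) = 1" for z
  proof -
    have "(\<chi> j. (1/2) * z $ j) \<in> polydisk" using that by (simp add: polydisk_def norm_mult)
    from c[OF this] show ?thesis unfolding power_monomial_scale by (simp add: h_def mult_ac)
  qed
  have "((\<lambda>\<alpha>. h \<alpha>) has_sum 0) UNIV"
    using pm[of "1"] by (simp add: power_monomial_def)
  then have "h summable_on UNIV" by (rule has_sum_imp_summable)
  then have ns: "(\<lambda>\<alpha>. norm (h \<alpha>)) summable_on UNIV"
    by (simp add: summable_on_iff_abs_summable_on_complex)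
  have small: "norm (h \<beta>) \<le> 2 * e" if e: "e > 0" for e
  proof -
    obtain S0 where S0: "finite S0" "dist (sum (\<lambda>\<alpha>. norm (h \<alpha>)) S0) (infsum (\<lambda>\<alpha>. norm (h \<alpha>)) UNIV) \<le> e"
      using infsum_finite_approximation[OF ns e] by blast
    define S where "S = insert \<beta> S0"
    have fS: "finite S" using S0 by (simp add: S_def)
    \<comment> \<open>\<open>L\<close> exceeds every exponent occurring in \<open>S\<close>, so two
      members of \<open>S\<close> that are congruent modulo \<open>L\<close> are equal.\<close>
    define L where "L = Suc (Max (mdeg ` S))"
    have L: "lookup \<alpha> j < L" if "\<alpha> \<in> S" for \<alpha> j
    proof -
      have "mdeg \<alpha> \<le> Max (mdeg ` S)" using fS that by simp
      then show ?thesis using lookup_le_mdeg[of \<alpha> j] by (simp add: L_def)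
    qed
    have L0: "L > 0" by (simp add: L_def)
    define d where "d = (\<lambda>\<alpha>. if \<forall>j. lookup \<alpha> j mod L = lookup \<beta> j mod L then h \<alpha> else 0)"
    have "((\<lambda>\<alpha>. \<Sum>k\<in>root_grid L. h \<alpha> * power_monomial (root_point L k) \<alpha> *
        cnj (power_monomial (root_point L k) \<beta>)) has_sum (\<Sum>k\<in>(root_grid L :: ('n \<Rightarrow> nat) set). 0)) UNIV"
    proof (rule has_sum_finite_sum)
      show "finite (root_grid L :: ('n \<Rightarrow> nat) set)" by (intro finite_PiE) auto
      show "((\<lambda>\<alpha>. h \<alpha> * power_monomial (root_point L k) \<alpha> * cnj (power_monomial (root_point L k) \<beta>)) has_sum 0) UNIV"
        for k :: "'n \<Rightarrow> nat"
        using has_sum_cmult_left[OF pm[of "root_point L k"], of "cnj (power_monomial (root_point L k) \<beta>)"] by simp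
    qed
    moreover have "(\<Sum>k\<in>root_grid L. h \<alpha> * power_monomial (root_point L k) \<alpha> *
        cnj (power_monomial (root_point L k) \<beta>)) = of_nat L ^ CARD('n) * d \<alpha>" for \<alpha>
      using root_point_orthogonality[OF L0, of \<alpha> \<beta>] by (simp add: d_def mult.assoc flip: sum_distrib_left)
    ultimately have "((\<lambda>\<alpha>. of_nat L ^ CARD('n) * d \<alpha>) has_sum 0) UNIV" by simp
    from has_sum_cmult_right[OF this, of "inverse (of_nat L ^ CARD('n))"] have "(d has_sum 0) UNIV"
      using L0 by (simp add: mult.assoc[symmetric])
    then have "\<forall>\<^sub>F F in finite_subsets_at_top UNIV. dist (sum d F) 0 < e"
      unfolding has_sum_def using e by (rule tendstoD)
    then obtain X where X: "finite X" "\<And>F. finite F \<Longrightarrow> X \<subseteq> F \<Longrightarrow> norm (sum d F) < e"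
      unfolding eventually_finite_subsets_at_top by auto
    \<comment> \<open>\<open>X\<close> makes the sum over \<open>F\<close> small because the whole
      series is 0, and \<open>S\<close> makes the sum over \<open>F - S\<close> small by absolute
      convergence. What remains is \<open>h \<beta>\<close>, bounded by these two errors.\<close>
    define F where "F = X \<union> S"
    have F: "finite F" "X \<subseteq> F" "S \<subseteq> F" using X fS by (auto simp: F_def)
    have dS: "sum d S = h \<beta>"
    proof -
      have "d \<alpha> = (if \<alpha> = \<beta> then h \<alpha> else 0)" if "\<alpha> \<in> S" for \<alpha>
        using L[OF that] L[of \<beta>] by (auto simp: d_def S_def intro: poly_mapping_eqI)
      then have "sum d S = (\<Sum>\<alpha>\<in>S. if \<alpha> = \<beta> then h \<alpha> else 0)" by (intro sum.cong) auto
      then show ?thesis using fS by (simp add: S_def)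
    qed
    have "norm (sum d (F - S)) \<le> (\<Sum>\<alpha>\<in>F - S. norm (h \<alpha>))"
      by (rule order_trans[OF norm_sum]) (intro sum_mono, simp add: d_def)
    also have "\<dots> = (\<Sum>\<alpha>\<in>F. norm (h \<alpha>)) - (\<Sum>\<alpha>\<in>S. norm (h \<alpha>))"
      using F by (intro sum_diff) auto
    also have "(\<Sum>\<alpha>\<in>F. norm (h \<alpha>)) \<le> infsum (\<lambda>\<alpha>. norm (h \<alpha>)) UNIV"
      using F by (intro finite_sum_le_infsum ns) auto
    also have "(\<Sum>\<alpha>\<in>S0. norm (h \<alpha>)) \<le> (\<Sum>\<alpha>\<in>S. norm (h \<alpha>))"
      using fS by (intro sum_mono2) (auto simp: S_def)
    then have "infsum (\<lambda>\<alpha>. norm (h \<alpha>)) UNIV - (\<Sum>\<alpha>\<in>S. norm (h \<alpha>)) \<le> e"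
      using S0(2) by (simp add: dist_real_def)
    finally have "norm (sum d (F - S)) \<le> e" by simp
    moreover have "sum d F = sum d (F - S) + h \<beta>"
      using F dS sum.subset_diff[of S F d] by simp
    ultimately show ?thesis
      using X(2)[OF F(1,2)] norm_triangle_ineq4[of "sum d F" "sum d (F - S)"] by simp
  qed
  have "norm (h \<beta>) \<le> 0"
    by (rule field_le_epsilon) (use small[of "_ / 2"] in auto)
  then show ?thesis by (simp add: h_def)
qed

text \<open>Both sides are coefficients of expansions of the same function on the polydisk: each
  term of \<open>p\<close> shifts the expansion of \<open>f\<close>, and
  \<open>power_series_eq_0\<close> applies to the difference.\<close>

lemma power_series_times_polynomial:
  fixes f :: "complex ^ 'n::finite \<Rightarrow> complex" and p q :: "'n cpoly"
  assumes a: "polydisk_expansion f a" and pq: "\<And>z. z \<in> polydisk \<Longrightarrow> f z * peval p z = peval q z"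
  shows "(\<Sum>\<gamma>\<in>keys p. lookup p \<gamma> * shift \<gamma> a \<beta>) = lookup q \<beta>"
proof -
  have "(\<Sum>\<gamma>\<in>keys p. lookup p \<gamma> * shift \<gamma> a \<beta>) - lookup q \<beta> = 0"
  proof (rule power_series_eq_0)
    fix z :: "complex ^ 'n" assume z: "z \<in> polydisk"
    have "((\<lambda>\<alpha>. lookup p \<gamma> * shift \<gamma> a \<alpha> * power_monomial z \<alpha>) has_sum
        (lookup p \<gamma> * power_monomial z \<gamma> * f z)) UNIV" for \<gamma>
    proof -
      have "((\<lambda>\<alpha>. a \<alpha> * power_monomial z \<alpha>) has_sum f z) UNIV"
        using a z by (simp add: polydisk_expansion_def)
      from has_sum_cmult_right[OF this, of "lookup p \<gamma> * power_monomial z \<gamma>"]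
      have "(((\<lambda>\<alpha>. lookup p \<gamma> * shift \<gamma> a \<alpha> * power_monomial z \<alpha>) \<circ> (+) \<gamma>) has_sum
          (lookup p \<gamma> * power_monomial z \<gamma> * f z)) UNIV"
        by (simp add: o_def power_monomial_add mult_ac)
      then have "((\<lambda>\<alpha>. lookup p \<gamma> * shift \<gamma> a \<alpha> * power_monomial z \<alpha>) has_sum
          (lookup p \<gamma> * power_monomial z \<gamma> * f z)) (range ((+) \<gamma>))"
        by (subst has_sum_reindex) auto
      then show ?thesis
      proof (rule has_sum_cong_neutral[THEN iffD1, rotated -1])
        fix \<alpha> assume "\<alpha> \<in> UNIV - range ((+) \<gamma>)"
        then have "\<not> below \<gamma> \<alpha>" by (metis DiffD2 below_minus rangeI)
        then show "lookup p \<gamma> * shift \<gamma> a \<alpha> * power_monomial z \<alpha> = 0" by (simp add: shift_def)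
      qed auto
    qed
    then have "((\<lambda>\<alpha>. \<Sum>\<gamma>\<in>keys p. lookup p \<gamma> * shift \<gamma> a \<alpha> * power_monomial z \<alpha>) has_sum
        (\<Sum>\<gamma>\<in>keys p. lookup p \<gamma> * power_monomial z \<gamma> * f z)) UNIV"
      by (intro has_sum_finite_sum) auto
    moreover have "(\<Sum>\<gamma>\<in>keys p. lookup p \<gamma> * power_monomial z \<gamma> * f z) = peval q z"
      using pq[OF z] by (simp add: peval_def mult.commute flip: sum_distrib_left)
    moreover have "((\<lambda>\<alpha>. lookup q \<alpha> * power_monomial z \<alpha>) has_sum peval q z) UNIV"
      unfolding peval_def by (rule has_sum_finite_neutralI) (auto simp: in_keys_iff)
    ultimately have "((\<lambda>\<alpha>. (\<Sum>\<gamma>\<in>keys p. lookup p \<gamma> * shift \<gamma> a \<alpha> * power_monomial z \<alpha>) +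
        (- (lookup q \<alpha> * power_monomial z \<alpha>))) has_sum (peval q z + (- peval q z))) UNIV"
      by (intro has_sum_add has_sum_uminusI) auto
    then show "((\<lambda>\<alpha>. ((\<Sum>\<gamma>\<in>keys p. lookup p \<gamma> * shift \<gamma> a \<alpha>) - lookup q \<alpha>) * power_monomial z \<alpha>) has_sum 0) UNIV"
      by (simp add: algebra_simps sum_distrib_left)
  qed
  then show ?thesis by simp
qed

text \<open>In degree at most \<open>N\<close> both sums run over the \<open>\<gamma>\<close> below
  \<open>\<beta>\<close>, and \<open>\<gamma> \<mapsto> \<beta> - \<gamma>\<close> exchanges them.
  It turns f(T) applied to p, a sum over the coefficients of f, into the product of p with the
  series of f.\<close>

lemma convolution_commute:
  assumes "mdeg \<beta> \<le> N"
  shows "(\<Sum>\<gamma>\<in>indices N. g \<gamma> * shift \<gamma> h \<beta>) = (\<Sum>\<gamma>\<in>indices N. h \<gamma> * shift \<gamma> g (\<beta> :: 'n::finite \<Rightarrow>\<^sub>0 nat))"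
proof -
  have s: "{\<gamma>. below \<gamma> \<beta>} \<subseteq> indices N"
    using assms mdeg_minus[of _ \<beta>] by (fastforce simp: indices_def)
  have e: "(\<Sum>\<gamma>\<in>indices N. u \<gamma> * shift \<gamma> v \<beta>) = (\<Sum>\<gamma>\<in>{\<gamma>. below \<gamma> \<beta>}. u \<gamma> * v (\<beta> - \<gamma>))" for u v
    using s by (intro sum.mono_neutral_cong_right) (auto simp: shift_def)
  have b: "below (\<beta> - \<gamma>) \<beta>" "\<beta> - (\<beta> - \<gamma>) = \<gamma>" if "below \<gamma> \<beta>" for \<gamma>
    using that by (auto simp: below_def lookup_minus intro!: poly_mapping_eqI)
  show ?thesis unfolding e
    by (rule sum.reindex_bij_witness[of _ "\<lambda>\<gamma>. \<beta> - \<gamma>" "\<lambda>\<gamma>. \<beta> - \<gamma>"]) (auto simp: b mult.commute)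
qed

section \<open>The Agler property for truncated shifts\<close>

lemma sum_fun_apply: "(\<Sum>i\<in>S. f i) x = (\<Sum>i\<in>S. f i x)"
  by (induction S rule: infinite_finite_induct) auto

lemma form_scale_vector: "form I a (\<lambda>\<alpha>. of_real r * g \<alpha>) = r\<^sup>2 * form I a g"
proof -
  have "form I a (\<lambda>\<alpha>. of_real r * g \<alpha>) = form I (\<lambda>\<alpha> \<beta>. of_real (r\<^sup>2) * a \<alpha> \<beta>) g"
    unfolding form_def
    by (intro arg_cong[where f=Re] sum.cong refl) (simp add: power2_eq_square mult_ac)
  then show ?thesis by (simp only: form_scale)
qed

lemma form_reindex:
  assumes "bij_betw e J I"
  shows "form J (\<lambda>i k. a (e i) (e k)) (\<lambda>i. g (e i)) = form I a g"
  unfolding form_def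
  by (subst (1 2) sum.reindex_bij_betw[OF assms, symmetric]) (rule refl)

lemma index_list: "distinct (index_list :: 'n::finite list)" "set (index_list :: 'n list) = UNIV"
proof -
  have "\<exists>js :: 'n list. distinct js \<and> set js = UNIV"
    using finite_distinct_list[of "UNIV :: 'n set"] by auto
  from someI_ex[OF this] show "distinct (index_list :: 'n::finite list)" "set (index_list :: 'n list) = UNIV"
    by (auto simp: index_list_def)
qed

lemma sum_single: "(\<Sum>j\<in>UNIV. Poly_Mapping.single j (lookup \<alpha> j)) = (\<alpha> :: 'n::finite \<Rightarrow>\<^sub>0 nat)"
  by (rule poly_mapping_eqI) (simp add: lookup_sum lookup_single when_def)

lemma shift_plus: "shift \<gamma> (\<lambda>\<alpha>. g \<alpha> + h \<alpha>) \<beta> = shift \<gamma> g \<beta> + shift \<gamma> h \<beta>"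
  and shift_times: "shift \<gamma> (\<lambda>\<alpha>. c * g \<alpha>) \<beta> = c * shift \<gamma> g \<beta>"
  by (simp_all add: shift_def)

text \<open>
  In the Hilbert space with Gram matrix \<open>r\<^bsup>|\<alpha>| + |\<beta>|\<^esup> M\<^sub>\<alpha>\<^sub>\<beta>\<close> the truncated shifts have norm at most \<open>r\<close>.
  They are nilpotent, so that \<open>f(T)\<close> is a finite sum, and \<open>f(T)\<close> maps \<open>p\<close> to \<open>q\<close>.
\<close>

lemma agler_form_le_scaled:
  fixes f :: "complex ^ 'n::finite \<Rightarrow> complex" and p q :: "'n cpoly"
  assumes f: "agler_class f"
    and pq: "\<And>z. z \<in> polydisk \<Longrightarrow> f z * peval p z = peval q z"
    and p: "keys p \<subseteq> indices N"
    and herm: "hermitian (indices N) M"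
    and lb: "\<And>g. (\<Sum>\<alpha>\<in>indices N. (cmod (g \<alpha>))\<^sup>2) \<le> form (indices N) M g"
    and contr: "\<And>j g. form (indices N) M (shift (unit_index j) g) \<le> form (indices N) M g"
    and r: "0 < r" "r < 1"
  shows "form (indices N) M (\<lambda>\<alpha>. of_real (r ^ mdeg \<alpha>) * lookup q \<alpha>)
    \<le> form (indices N) M (\<lambda>\<alpha>. of_real (r ^ mdeg \<alpha>) * lookup p \<alpha>)"
proof -
  let ?I = "indices N :: ('n \<Rightarrow>\<^sub>0 nat) set"
  define d where "d = card ?I"
  obtain e where e: "bij_betw e {..<d} ?I"
    using ex_bij_betw_nat_finite[OF finite_indices] unfolding d_def atLeast0LessThan by blast
  have eI: "e i \<in> ?I" if "i < d" for i using bij_betwE[OF e] that by auto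
  \<comment> \<open>The Hilbert spaces in \<open>agler_class\<close> consist of sequences;
    \<open>emb\<close> and \<open>ext\<close> translate between these and coefficient families, with
    \<open>ext\<close> padding by zero above degree \<open>N\<close>.\<close>
  define emb :: "(('n \<Rightarrow>\<^sub>0 nat) \<Rightarrow> complex) \<Rightarrow> cseq" where
    "emb = (\<lambda>g i. if i < d then g (e i) else 0)"
  define ext :: "cseq \<Rightarrow> ('n \<Rightarrow>\<^sub>0 nat) \<Rightarrow> complex" where
    "ext = (\<lambda>x \<beta>. if \<beta> \<in> ?I then x (inv_into {..<d} e \<beta>) else 0)"
  have ext_e: "ext x (e i) = x i" if "i < d" for x i
    using that eI bij_betw_inv_into_left[OF e] by (simp add: ext_def)
  have emb_H: "emb g \<in> fin_space d" for g by (simp add: emb_def fin_space_def)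
  have emb_ext: "emb (ext x) = x" if "x \<in> fin_space d" for x
    using that by (auto simp: emb_def fin_space_def ext_e fun_eq_iff)
  have emb_cong: "emb g = emb h" if "\<And>\<alpha>. \<alpha> \<in> ?I \<Longrightarrow> g \<alpha> = h \<alpha>" for g h
    using that eI by (auto simp: emb_def fun_eq_iff)
  have ext_emb: "ext (emb g) \<alpha> = g \<alpha>" if "\<alpha> \<in> ?I" for g \<alpha>
    using that bij_betw_inv_into_right[OF e that] bij_betwE[OF bij_betw_inv_into[OF e]]
    by (auto simp: ext_def emb_def)
  have ext_add: "ext (x + y) = (\<lambda>\<alpha>. ext x \<alpha> + ext y \<alpha>)" for x y by (auto simp: ext_def)
  have ext_scale: "ext (cscale c x) = (\<lambda>\<alpha>. c * ext x \<alpha>)" for c x by (auto simp: ext_def cscale_def)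
  have shift_ext: "emb (shift \<gamma> (ext (emb g))) = emb (shift \<gamma> g)" for \<gamma> g
    by (intro emb_cong shift_cong ext_emb) (auto simp: indices_def)
  define R where "R = (\<lambda>\<alpha> :: 'n \<Rightarrow>\<^sub>0 nat. r ^ mdeg \<alpha>)"
  define MR where "MR = (\<lambda>\<alpha> \<beta>. of_real (R \<alpha> * R \<beta>) * M \<alpha> \<beta>)"
  define G where "G = (\<lambda>i k. MR (e i) (e k))"
  have form_MR: "form ?I MR g = form ?I M (\<lambda>\<alpha>. of_real (R \<alpha>) * g \<alpha>)" for g
    unfolding form_def MR_def by (intro arg_cong[where f=Re] sum.cong refl) (simp add: mult_ac)
  have form_emb: "form {..<d} G (emb g) = form ?I M (\<lambda>\<alpha>. of_real (R \<alpha>) * g \<alpha>)" for g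
    unfolding form_MR[symmetric] form_reindex[OF e, of MR g, symmetric] G_def
    by (rule form_cong) (auto simp: emb_def)
  let ?ip = "gram_ip d G" and ?H = "fin_space d"
  have R: "r ^ N \<le> R \<alpha>" "0 < R \<alpha>" if "\<alpha> \<in> ?I" for \<alpha>
    using r that by (auto simp: R_def indices_def intro: power_decreasing)
  have hilb: "complex_hilbert ?H ?ip"
  proof (rule complex_hilbert_fin_space)
    show "hermitian {..<d} G"
      unfolding hermitian_def G_def MR_def
    proof (intro ballI)
      fix i k assume "i \<in> {..<d}" "k \<in> {..<d}"
      then have "M (e k) (e i) = cnj (M (e i) (e k))" by (intro hermitianD[OF herm]) (auto intro: eI)
      then show "of_real (R (e k) * R (e i)) * M (e k) (e i) = cnj (of_real (R (e i) * R (e k)) * M (e i) (e k))"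
        by simp
    qed
    \<comment> \<open>Every weight on \<open>indices N\<close> is at least \<open>r ^ N\<close>, and
      \<open>M\<close> dominates the identity; this gives the constant.\<close>
    show "0 < (r ^ N)\<^sup>2" using r by simp
    fix x :: cseq
    define g where "g = ext x"
    have x: "x i = g (e i)" if "i < d" for i using that by (simp add: g_def ext_e)
    have "(r ^ N)\<^sup>2 * (\<Sum>i<d. (cmod (x i))\<^sup>2) = (\<Sum>i<d. (r ^ N)\<^sup>2 * (cmod (g (e i)))\<^sup>2)"
      by (simp add: sum_distrib_left x)
    also have "\<dots> = (\<Sum>\<alpha>\<in>?I. (r ^ N)\<^sup>2 * (cmod (g \<alpha>))\<^sup>2)"
      by (rule sum.reindex_bij_betw[OF e])
    also have "\<dots> \<le> (\<Sum>\<alpha>\<in>?I. (cmod (of_real (R \<alpha>) * g \<alpha>))\<^sup>2)"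
    proof (rule sum_mono)
      fix \<alpha> assume "\<alpha> \<in> ?I"
      from R[OF this] have "(r ^ N)\<^sup>2 \<le> (R \<alpha>)\<^sup>2" using r by (intro power_mono) auto
      then show "(r ^ N)\<^sup>2 * (cmod (g \<alpha>))\<^sup>2 \<le> (cmod (of_real (R \<alpha>) * g \<alpha>))\<^sup>2"
        by (simp add: norm_mult power_mult_distrib mult_right_mono)
    qed
    also have "\<dots> \<le> form ?I M (\<lambda>\<alpha>. of_real (R \<alpha>) * g \<alpha>)" by (rule lb)
    also have "\<dots> = form {..<d} G x"
      unfolding form_emb[symmetric] by (rule form_cong) (auto simp: emb_def x)
    finally show "(r ^ N)\<^sup>2 * (\<Sum>i<d. (cmod (x i))\<^sup>2) \<le> form {..<d} G x" .
  qed
  then interpret complex_hilbert ?H ?ip .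
  define T where "T = (\<lambda>j x. emb (shift (unit_index j) (ext x)))"
  have T_emb: "T j (emb g) = emb (shift (unit_index j) g)" for j g
    by (simp add: T_def shift_ext)
  \<comment> \<open>The same statement covers \<open>T j\<close>, as a sum with one term, and the
    operator \<open>F\<close> below.\<close>
  have lin: "linear_operator ?H (\<lambda>x. emb (\<lambda>\<beta>. \<Sum>\<alpha>\<in>A. c \<alpha> * shift \<alpha> (ext x) \<beta>))" for A c
    unfolding linear_operator_def ext_add ext_scale shift_plus shift_times
    by (auto simp: fin_space_def emb_def fun_eq_iff cscale_def algebra_simps sum.distrib sum_distrib_left)
  have strict: "strict_contraction ?H ?ip (T j)" for j
    unfolding strict_contraction_def
  proof (intro conjI exI)
    show "linear_operator ?H (T j)"
      using lin[of "\<lambda>_. 1" "{unit_index j}"] by (simp add: T_def)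
    show "r < 1" by fact
    show "opnorm_le ?H ?ip (T j) r"
      unfolding opnorm_le_def
    proof
      fix x assume x: "x \<in> ?H"
      define g where "g = ext x"
      have xg: "x = emb g" using emb_ext[OF x] g_def by simp
      have "form {..<d} G (T j x) = form ?I M (\<lambda>\<alpha>. of_real (R \<alpha>) * shift (unit_index j) g \<alpha>)"
        by (simp only: xg T_emb form_emb)
      \<comment> \<open>A shift by \<open>unit_index j\<close> raises the degree by one, so moving
        the weight past it releases exactly one factor \<open>r\<close>.\<close>
      also have "\<dots> = form ?I M (\<lambda>\<alpha>. of_real r * shift (unit_index j) (\<lambda>\<alpha>. of_real (R \<alpha>) * g \<alpha>) \<alpha>)"
        by (intro form_cong refl) (auto simp: shift_def R_def mdeg_minus[of "unit_index j"])
      also have "\<dots> = r\<^sup>2 * form ?I M (shift (unit_index j) (\<lambda>\<alpha>. of_real (R \<alpha>) * g \<alpha>))"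
        by (rule form_scale_vector)
      also have "\<dots> \<le> r\<^sup>2 * form ?I M (\<lambda>\<alpha>. of_real (R \<alpha>) * g \<alpha>)"
        by (intro mult_left_mono contr) auto
      also have "\<dots> = r\<^sup>2 * form {..<d} G x" by (simp only: xg form_emb)
      finally have "sqrt (form {..<d} G (T j x)) \<le> sqrt (r\<^sup>2 * form {..<d} G x)"
        by (rule real_sqrt_le_mono)
      then show "hnorm ?ip (T j x) \<le> r * hnorm ?ip x"
        using r by (simp add: hnorm_def Re_gram_ip real_sqrt_mult)
    qed
  qed
  have comm: "T i (T j x) = T j (T i x)" for i j x
    by (simp add: T_def shift_ext shift_shift add.commute)
  have monomial: "op_monomial T \<alpha> (emb g) = emb (shift \<alpha> g)" for \<alpha> g
  proof -
    have pow: "(T j ^^ k) (emb g) = emb (shift (Poly_Mapping.single j k) g)" for j k g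
    proof (induction k)
      case (Suc k)
      then show ?case by (simp add: T_emb shift_shift single_Suc)
    qed simp
    have "foldr (\<lambda>j S. (T j ^^ lookup \<alpha> j) \<circ> S) js id (emb g) =
        emb (shift (\<Sum>j\<in>set js. Poly_Mapping.single j (lookup \<alpha> j)) g)" if "distinct js" for js
      using that by (induction js) (auto simp: pow shift_shift)
    from this[OF index_list(1)] show ?thesis
      by (simp add: op_monomial_def index_list(2) sum_single)
  qed
  obtain a where a: "polydisk_expansion f a"
    and vN: "\<forall>H ip (T :: 'n \<Rightarrow> cseq \<Rightarrow> cseq) F. complex_hilbert H ip \<longrightarrow>
           (\<forall>j. strict_contraction H ip (T j)) \<longrightarrow>
           (\<forall>i j. \<forall>x\<in>H. T i (T j x) = T j (T i x)) \<longrightarrow>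
           is_functional_calculus H ip a T F \<longrightarrow> opnorm_le H ip F 1"
    using f unfolding agler_class_def by (elim conjE exE)
  define F where "F = (\<lambda>x. emb (\<lambda>\<beta>. \<Sum>\<alpha>\<in>?I. a \<alpha> * shift \<alpha> (ext x) \<beta>))"
  have fc: "is_functional_calculus ?H ?ip a T F"
    unfolding is_functional_calculus_def
  proof (intro conjI allI impI)
    show "linear_operator ?H F" unfolding F_def by (rule lin)
    fix c :: real assume c: "c > 0"
    show "\<forall>\<^sub>F S in finite_subsets_at_top UNIV.
        opnorm_le ?H ?ip (\<lambda>x. F x - (\<Sum>\<alpha>\<in>S. cscale (a \<alpha>) (op_monomial T \<alpha> x))) c"
      unfolding eventually_finite_subsets_at_top
    proof (intro exI[of _ ?I] conjI allI impI)
      fix S assume S: "finite S \<and> ?I \<subseteq> S \<and> S \<subseteq> UNIV"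
      have "F x = (\<Sum>\<alpha>\<in>S. cscale (a \<alpha>) (op_monomial T \<alpha> x))" if x: "x \<in> ?H" for x
      proof
        fix i
        have "op_monomial T \<alpha> x = emb (shift \<alpha> (ext x))" for \<alpha>
          using monomial[of \<alpha> "ext x"] emb_ext[OF x] by simp
        then have "(\<Sum>\<alpha>\<in>S. cscale (a \<alpha>) (op_monomial T \<alpha> x)) i =
            (\<Sum>\<alpha>\<in>S. a \<alpha> * emb (shift \<alpha> (ext x)) i)"
          by (simp add: sum_fun_apply cscale_def)
        also have "\<dots> = (\<Sum>\<alpha>\<in>?I. a \<alpha> * emb (shift \<alpha> (ext x)) i)"
        proof (rule sum.mono_neutral_right)
          show "\<forall>\<alpha>\<in>S - ?I. a \<alpha> * emb (shift \<alpha> (ext x)) i = 0"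
          proof
            fix \<alpha> assume "\<alpha> \<in> S - ?I"
            then have "mdeg (e i) < mdeg \<alpha>" if "i < d" using eI[OF that] by (simp add: indices_def)
            then show "a \<alpha> * emb (shift \<alpha> (ext x)) i = 0" by (simp add: emb_def shift_eq_0)
          qed
        qed (use S in auto)
        finally show "F x i = (\<Sum>\<alpha>\<in>S. cscale (a \<alpha>) (op_monomial T \<alpha> x)) i"
          by (simp add: F_def emb_def)
      qed
      then show "opnorm_le ?H ?ip (\<lambda>x. F x - (\<Sum>\<alpha>\<in>S. cscale (a \<alpha>) (op_monomial T \<alpha> x))) c"
        using c hnorm_nonneg hnorm_eq_0[OF H_zero] by (simp add: opnorm_le_def)
    qed auto
  qed
  have "opnorm_le ?H ?ip F 1"
    by (rule vN[rule_format, OF hilb strict comm fc])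
  then have "hnorm ?ip (F (emb (lookup p))) \<le> hnorm ?ip (emb (lookup p))"
    using emb_H by (simp add: opnorm_le_def)
  also have "F (emb (lookup p)) = emb (lookup q)"
    unfolding F_def
  proof (rule emb_cong)
    fix \<beta> assume b: "\<beta> \<in> ?I"
    have "(\<Sum>\<alpha>\<in>?I. a \<alpha> * shift \<alpha> (ext (emb (lookup p))) \<beta>) = (\<Sum>\<alpha>\<in>?I. a \<alpha> * shift \<alpha> (lookup p) \<beta>)"
      using b by (intro sum.cong refl arg_cong[where f="(*) _"] shift_cong ext_emb) (simp add: indices_def)
    also have "\<dots> = (\<Sum>\<gamma>\<in>?I. lookup p \<gamma> * shift \<gamma> a \<beta>)"
      using b by (intro convolution_commute) (simp add: indices_def)
    also have "\<dots> = (\<Sum>\<gamma>\<in>keys p. lookup p \<gamma> * shift \<gamma> a \<beta>)"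
      using p by (intro sum.mono_neutral_right) (auto simp: in_keys_iff)
    also have "\<dots> = lookup q \<beta>" by (rule power_series_times_polynomial[OF a pq])
    finally show "(\<Sum>\<alpha>\<in>?I. a \<alpha> * shift \<alpha> (ext (emb (lookup p))) \<beta>) = lookup q \<beta>" .
  qed
  finally have "form {..<d} G (emb (lookup q)) \<le> form {..<d} G (emb (lookup p))"
    by (simp add: hnorm_def Re_gram_ip)
  then show ?thesis by (simp add: form_emb R_def)
qed

text \<open>The weights with \<open>r < 1\<close> serve to make the contractions strict. Both
  weighted forms are polynomials in \<open>r\<close>, so the inequality survives as \<open>r\<close>
  tends to 1 from below.\<close>

lemma agler_form_le:
  fixes f :: "complex ^ 'n::finite \<Rightarrow> complex" and p q :: "'n cpoly"
  assumes "agler_class f"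
    and "\<And>z. z \<in> polydisk \<Longrightarrow> f z * peval p z = peval q z"
    and "keys p \<subseteq> indices N"
    and "hermitian (indices N) M"
    and "\<And>g. (\<Sum>\<alpha>\<in>indices N. (cmod (g \<alpha>))\<^sup>2) \<le> form (indices N) M g"
    and "\<And>j g. form (indices N) M (shift (unit_index j) g) \<le> form (indices N) M g"
  shows "form (indices N) M (lookup q) \<le> form (indices N) M (lookup p)"
proof (rule tendsto_le)
  have lim: "((\<lambda>r. form (indices N) M (\<lambda>\<alpha>. of_real (r ^ mdeg \<alpha>) * g \<alpha>)) \<longlongrightarrow> form (indices N) M g) (at_left 1)" for g
  proof -
    have r: "((\<lambda>r. complex_of_real (r ^ m)) \<longlongrightarrow> of_real (1 ^ m)) (at_left 1)" for m
      by (intro tendsto_of_real tendsto_power tendsto_ident_at)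
    have "((\<lambda>r. form (indices N) M (\<lambda>\<alpha>. of_real (r ^ mdeg \<alpha>) * g \<alpha>)) \<longlongrightarrow>
        form (indices N) M (\<lambda>\<alpha>. of_real (1 ^ mdeg \<alpha>) * g \<alpha>)) (at_left 1)"
      unfolding form_def by (intro tendsto_Re tendsto_sum tendsto_mult tendsto_cnj tendsto_const r)
    then show ?thesis by simp
  qed
  show "((\<lambda>r. form (indices N) M (\<lambda>\<alpha>. of_real (r ^ mdeg \<alpha>) * lookup p \<alpha>)) \<longlongrightarrow>
      form (indices N) M (lookup p)) (at_left 1)" by (rule lim)
  show "((\<lambda>r. form (indices N) M (\<lambda>\<alpha>. of_real (r ^ mdeg \<alpha>) * lookup q \<alpha>)) \<longlongrightarrow>
      form (indices N) M (lookup q)) (at_left 1)" by (rule lim)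
  show "\<forall>\<^sub>F r in at_left 1. form (indices N) M (\<lambda>\<alpha>. of_real (r ^ mdeg \<alpha>) * lookup q \<alpha>) \<le>
      form (indices N) M (\<lambda>\<alpha>. of_real (r ^ mdeg \<alpha>) * lookup p \<alpha>)"
    unfolding eventually_at_left_field
    using agler_form_le_scaled[OF assms] by (intro exI[of _ 0]) auto
qed auto

section \<open>Duality for truncated Agler decompositions\<close>

text \<open>On coefficients this is the product of a kernel a(z,w) with the monomial of exponent
  \<open>\<gamma>\<close> in z and its conjugate in w.\<close>

definition kernel_shift :: "('n \<Rightarrow>\<^sub>0 nat) \<Rightarrow> (('n \<Rightarrow>\<^sub>0 nat) \<Rightarrow> ('n \<Rightarrow>\<^sub>0 nat) \<Rightarrow> complex) \<Rightarrow>
    ('n \<Rightarrow>\<^sub>0 nat) \<Rightarrow> ('n \<Rightarrow>\<^sub>0 nat) \<Rightarrow> complex" where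
  "kernel_shift \<gamma> a \<alpha> \<beta> = (if below \<gamma> \<alpha> \<and> below \<gamma> \<beta> then a (\<alpha> - \<gamma>) (\<beta> - \<gamma>) else 0)"

text \<open>The coefficients of \<open>\<Sum>\<^sub>j (1 - z\<^sub>j w\<^sub>j\<^sup>*) A\<^sub>j(z,w)\<close>.\<close>

definition agler_sum :: "('n::finite \<Rightarrow> ('n \<Rightarrow>\<^sub>0 nat) \<Rightarrow> ('n \<Rightarrow>\<^sub>0 nat) \<Rightarrow> complex) \<Rightarrow>
    ('n \<Rightarrow>\<^sub>0 nat) \<Rightarrow> ('n \<Rightarrow>\<^sub>0 nat) \<Rightarrow> complex" where
  "agler_sum A \<alpha> \<beta> = (\<Sum>j\<in>UNIV. A j \<alpha> \<beta> - kernel_shift (unit_index j) (A j) \<alpha> \<beta>)"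

lemma kernel_shift_rank_one:
  "kernel_shift \<gamma> (\<lambda>\<alpha> \<beta>. g \<alpha> * cnj (h \<beta>)) \<alpha> \<beta> = shift \<gamma> g \<alpha> * cnj (shift \<gamma> h \<beta>)"
  by (simp add: kernel_shift_def shift_def)

text \<open>The shifted entries have smaller degree, so the sum never looks outside
  \<open>indices N\<close>; kernels may be set to zero there.\<close>

lemma agler_sum_cong:
  assumes "\<And>j \<alpha> \<beta>. \<alpha> \<in> indices N \<Longrightarrow> \<beta> \<in> indices N \<Longrightarrow> A j \<alpha> \<beta> = B j \<alpha> \<beta>"
    and "\<alpha> \<in> indices N" "\<beta> \<in> indices N"
  shows "agler_sum A \<alpha> \<beta> = agler_sum B \<alpha> \<beta>"
  unfolding agler_sum_def
proof (intro sum.cong refl)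
  fix j
  have "\<alpha> - unit_index j \<in> indices N \<and> \<beta> - unit_index j \<in> indices N"
    if "below (unit_index j) \<alpha>" "below (unit_index j) \<beta>"
    using assms(2,3) mdeg_minus[OF that(1)] mdeg_minus[OF that(2)] by (simp add: indices_def)
  then show "A j \<alpha> \<beta> - kernel_shift (unit_index j) (A j) \<alpha> \<beta> =
      B j \<alpha> \<beta> - kernel_shift (unit_index j) (B j) \<alpha> \<beta>"
    using assms by (simp add: kernel_shift_def)
qed

lemma agler_sum_linear:
  "agler_sum (\<lambda>j \<alpha> \<beta>. s * A j \<alpha> \<beta> + t * B j \<alpha> \<beta>) \<alpha> \<beta> = s * agler_sum A \<alpha> \<beta> + t * agler_sum B \<alpha> \<beta>"
  unfolding agler_sum_def sum_distrib_left sum.distrib[symmetric]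
  by (intro sum.cong refl) (simp add: kernel_shift_def algebra_simps)

lemma agler_sum_hermitian:
  fixes A :: "'n::finite \<Rightarrow> ('n \<Rightarrow>\<^sub>0 nat) \<Rightarrow> ('n \<Rightarrow>\<^sub>0 nat) \<Rightarrow> complex"
  assumes "\<And>j. hermitian (indices N) (A j)"
  shows "hermitian (indices N) (agler_sum A)"
  unfolding hermitian_def
proof (intro ballI)
  fix \<alpha> \<beta> :: "'n \<Rightarrow>\<^sub>0 nat" assume ab: "\<alpha> \<in> indices N" "\<beta> \<in> indices N"
  have "A j \<beta> \<alpha> - kernel_shift (unit_index j) (A j) \<beta> \<alpha> =
      cnj (A j \<alpha> \<beta> - kernel_shift (unit_index j) (A j) \<alpha> \<beta>)" for j
  proof -
    have 1: "A j \<beta> \<alpha> = cnj (A j \<alpha> \<beta>)" by (rule hermitianD[OF assms ab])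
    have 2: "A j (\<beta> - unit_index j) (\<alpha> - unit_index j) = cnj (A j (\<alpha> - unit_index j) (\<beta> - unit_index j))"
      if "below (unit_index j) \<alpha>" "below (unit_index j) \<beta>"
      using ab mdeg_minus[OF that(1)] mdeg_minus[OF that(2)]
      by (intro hermitianD[OF assms]) (simp_all add: indices_def)
    show ?thesis using 1 2 by (simp add: kernel_shift_def)
  qed
  then show "agler_sum A \<beta> \<alpha> = cnj (agler_sum A \<alpha> \<beta>)"
    unfolding agler_sum_def by (simp add: cnj_sum)
qed

text \<open>The sum telescopes: the shifted diagonal reproduces the entries of degree below
  \<open>m\<close>, and only degree \<open>m\<close> survives. All \<open>m\<close> up to
  \<open>N\<close> are used to bound the kernels, and \<open>m = N\<close> later kills their top
  degree.\<close>

lemma agler_sum_trace: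
  "(\<Sum>\<alpha>\<in>indices m. agler_sum A \<alpha> \<alpha>) = (\<Sum>j\<in>UNIV. \<Sum>\<alpha> | mdeg \<alpha> = m. A j \<alpha> \<alpha>)"
proof -
  have "(\<Sum>\<alpha>\<in>indices m. A j \<alpha> \<alpha> - kernel_shift (unit_index j) (A j) \<alpha> \<alpha>) = (\<Sum>\<alpha> | mdeg \<alpha> = m. A j \<alpha> \<alpha>)" for j
  proof -
    let ?u = "unit_index j"
    have "(\<Sum>\<alpha>\<in>indices m. kernel_shift ?u (A j) \<alpha> \<alpha>) = (\<Sum>\<alpha> | \<alpha> \<in> indices m \<and> below ?u \<alpha>. A j (\<alpha> - ?u) (\<alpha> - ?u))"
      by (intro sum.mono_neutral_cong_right) (auto simp: kernel_shift_def)
    also have "\<dots> = (\<Sum>\<alpha> | mdeg \<alpha> < m. A j \<alpha> \<alpha>)"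
    proof (rule sum.reindex_bij_witness[of _ "\<lambda>\<alpha>. ?u + \<alpha>" "\<lambda>\<alpha>. \<alpha> - ?u"])
      fix \<alpha> assume "\<alpha> \<in> {\<alpha>. \<alpha> \<in> indices m \<and> below ?u \<alpha>}"
      then show "?u + (\<alpha> - ?u) = \<alpha>" "\<alpha> - ?u \<in> {\<alpha>. mdeg \<alpha> < m}"
        using mdeg_minus[of ?u \<alpha>] by (auto simp: below_minus indices_def)
    qed (auto simp: indices_def mdeg_add)
    finally have s: "(\<Sum>\<alpha>\<in>indices m. kernel_shift ?u (A j) \<alpha> \<alpha>) = (\<Sum>\<alpha> | mdeg \<alpha> < m. A j \<alpha> \<alpha>)" .
    have I: "indices m = {\<alpha>. mdeg \<alpha> < m} \<union> {\<alpha> :: 'a \<Rightarrow>\<^sub>0 nat. mdeg \<alpha> = m}" by (auto simp: indices_def)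
    have f: "finite ({\<alpha>. mdeg \<alpha> < m} \<union> {\<alpha> :: 'a \<Rightarrow>\<^sub>0 nat. mdeg \<alpha> = m})"
      unfolding I[symmetric] by (rule finite_indices)
    have "(\<Sum>\<alpha>\<in>indices m. A j \<alpha> \<alpha>) = (\<Sum>\<alpha> | mdeg \<alpha> < m. A j \<alpha> \<alpha>) + (\<Sum>\<alpha> | mdeg \<alpha> = m. A j \<alpha> \<alpha>)"
      unfolding I using f by (intro sum.union_disjoint) auto
    then show ?thesis by (simp add: sum_subtractf s)
  qed
  then show ?thesis unfolding agler_sum_def by (subst sum.swap) simp
qed

section \<open>The nearest point of the cone of truncated Agler sums\<close>

lemma compact_PiE_UNIV:
  fixes S :: "'a \<Rightarrow> 'b::topological_space set"
  assumes "\<And>i. compact (S i)"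
  shows "compact (Pi\<^sub>E UNIV S)"
  using assms compactin_PiE[of "\<lambda>_. euclidean" UNIV S]
  by (simp add: euclidean_product_topology flip: compactin_euclidean_iff)

text \<open>The real part of the Hilbert-Schmidt inner product. It conjugates its first argument,
  unlike the pairing of \<open>M\<close> with \<open>P\<close> in the duality; this is why the test
  matrix contains the conjugate of the residual.\<close>

definition hs_inner :: "'i set \<Rightarrow> ('i \<Rightarrow> 'i \<Rightarrow> complex) \<Rightarrow> ('i \<Rightarrow> 'i \<Rightarrow> complex) \<Rightarrow> real" where
  "hs_inner I R Y = Re (\<Sum>\<alpha>\<in>I. \<Sum>\<beta>\<in>I. cnj (R \<alpha> \<beta>) * Y \<alpha> \<beta>)"

lemma hs_inner_self: "hs_inner I R R = (\<Sum>\<alpha>\<in>I. \<Sum>\<beta>\<in>I. (cmod (R \<alpha> \<beta>))\<^sup>2)"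
  by (simp add: hs_inner_def cmod_power2) (simp add: power2_eq_square)

lemma hs_inner_cong:
  "(\<And>\<alpha> \<beta>. \<alpha> \<in> I \<Longrightarrow> \<beta> \<in> I \<Longrightarrow> R \<alpha> \<beta> = R' \<alpha> \<beta>) \<Longrightarrow> (\<And>\<alpha> \<beta>. \<alpha> \<in> I \<Longrightarrow> \<beta> \<in> I \<Longrightarrow> Y \<alpha> \<beta> = Y' \<alpha> \<beta>) \<Longrightarrow>
    hs_inner I R Y = hs_inner I R' Y'"
  unfolding hs_inner_def by (intro arg_cong[where f=Re] sum.cong) auto

lemma hs_inner_expand:
  "hs_inner I (\<lambda>\<alpha> \<beta>. R \<alpha> \<beta> - of_real t * Y \<alpha> \<beta>) (\<lambda>\<alpha> \<beta>. R \<alpha> \<beta> - of_real t * Y \<alpha> \<beta>) =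
    hs_inner I R R - 2 * t * hs_inner I R Y + t\<^sup>2 * hs_inner I Y Y"
proof -
  have "Re (cnj (r - of_real t * y) * (r - of_real t * y)) =
    Re (cnj r * r) - 2 * t * Re (cnj r * y) + t\<^sup>2 * Re (cnj y * y)" for r y :: complex
    by (simp add: algebra_simps power2_eq_square)
  then show ?thesis
    unfolding hs_inner_def Re_sum
    by (simp only: sum.distrib sum_subtractf sum_distrib_left)
qed

text \<open>The first-order condition at a minimum: divide by \<open>t\<close> and let
  \<open>t\<close> tend to 0 from the right.\<close>

lemma nonneg_of_quadratic:
  fixes b c :: real
  assumes "\<And>t. 0 < t \<Longrightarrow> t \<le> 1 \<Longrightarrow> 0 \<le> t * b + t\<^sup>2 * c"
  shows "0 \<le> b"
proof (rule tendsto_lowerbound)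
  have "((\<lambda>t. b + t * c) \<longlongrightarrow> b + 0 * c) (at_right 0)" by (intro tendsto_intros)
  then show "((\<lambda>t. b + t * c) \<longlongrightarrow> b) (at_right 0)" by simp
  have "0 \<le> b + t * c" if "0 < t" "t < 1" for t
  proof -
    have "0 \<le> t * (b + t * c)" using assms[of t] that by (simp add: algebra_simps power2_eq_square)
    then show ?thesis using that by (simp add: zero_le_mult_iff)
  qed
  then show "\<forall>\<^sub>F t in at_right 0. 0 \<le> b + t * c"
    unfolding eventually_at_right_field by (intro exI[of _ 1]) auto
qed auto

text \<open>
  The trace identity above bounds the diagonals of the \<open>A\<^sub>j\<close> in terms of \<open>agler_sum A\<close>, which makes the
  minimization problem compact.
\<close>

lemma ex_nearest_agler_sum:
  fixes P :: "('n::finite \<Rightarrow>\<^sub>0 nat) \<Rightarrow> ('n \<Rightarrow>\<^sub>0 nat) \<Rightarrow> complex" and N :: nat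
  defines "obj \<equiv> \<lambda>A. \<Sum>\<alpha>\<in>indices N. \<Sum>\<beta>\<in>indices N. (cmod (P \<alpha> \<beta> - agler_sum A \<alpha> \<beta>))\<^sup>2"
  shows "\<exists>A0. (\<forall>j. psd (indices N) (A0 j)) \<and> (\<forall>A. (\<forall>j. psd (indices N) (A j)) \<longrightarrow> obj A0 \<le> obj A)"
proof -
  let ?I = "indices N :: ('n \<Rightarrow>\<^sub>0 nat) set"
  define Z where "Z = (\<lambda>(j::'n) (\<alpha> :: 'n \<Rightarrow>\<^sub>0 nat) (\<beta> :: 'n \<Rightarrow>\<^sub>0 nat). 0 :: complex)"
  \<comment> \<open>The distance from \<open>P\<close> to the zero family. Kernels that do worse
    than zero can be ignored.\<close>
  define s where "s = sqrt (obj Z)"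
  \<comment> \<open>The diagonal of the Agler sum of a competitor is at most \<open>2 * s\<close>,
    namely \<open>s\<close> for \<open>P\<close> and \<open>s\<close> for the error. The trace
    identity turns this into \<open>card ?I * (2 * s)\<close> for the diagonals of the kernels, and
    \<open>psd_bound\<close> doubles it for arbitrary entries.\<close>
  define B where "B = 2 * (card ?I * (2 * s))"
  define box where "box = (Pi\<^sub>E UNIV (\<lambda>j::'n. Pi\<^sub>E UNIV (\<lambda>\<alpha>. Pi\<^sub>E UNIV (\<lambda>\<beta>.
      cball (0::complex) (if \<alpha> \<in> ?I \<and> \<beta> \<in> ?I then B else 0)))))"
  define K where "K = box \<inter> {A. \<forall>j. psd ?I (A j)}"
  have Z0: "agler_sum Z \<alpha> \<beta> = 0" for \<alpha> \<beta> by (simp add: agler_sum_def Z_def kernel_shift_def)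
  have psdZ: "psd ?I (Z j)" for j by (simp add: psd_def hermitian_def form_def Z_def)
  have cont: "continuous_on S (\<lambda>A :: 'n \<Rightarrow> ('n \<Rightarrow>\<^sub>0 nat) \<Rightarrow> ('n \<Rightarrow>\<^sub>0 nat) \<Rightarrow> complex. A j \<alpha> \<beta>)" for S j \<alpha> \<beta>
    by (rule continuous_on_product_then_coordinatewise[OF continuous_on_product_then_coordinatewise
          [OF continuous_on_product_then_coordinatewise[OF continuous_on_id]]])
  \<comment> \<open>The kernels live on infinitely many multi-indices, so this is Tychonoff's
    theorem; radius 0 outside \<open>indices N\<close> forces zero entries there.\<close>
  have "compact box"
    unfolding box_def by (intro compact_PiE_UNIV compact_cball)
  moreover have "closed {A :: 'n \<Rightarrow> ('n \<Rightarrow>\<^sub>0 nat) \<Rightarrow> ('n \<Rightarrow>\<^sub>0 nat) \<Rightarrow> complex. \<forall>j. psd ?I (A j)}"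
    unfolding psd_def hermitian_def Ball_def form_def
    by (intro closed_Collect_all closed_Collect_conj closed_Collect_imp closed_Collect_eq closed_Collect_le
        open_Collect_const continuous_intros cont)
  ultimately have "compact K" unfolding K_def by (rule compact_Int_closed)
  moreover have obj0: "0 \<le> obj A" for A unfolding obj_def by (intro sum_nonneg) auto
  have B: "0 \<le> B" using obj0 by (simp add: B_def s_def)
  have "Z \<in> K" using psdZ B by (auto simp: K_def box_def Z_def)
  moreover have "continuous_on K obj"
  proof -
    have "continuous_on K (\<lambda>A. kernel_shift \<gamma> (A j) \<alpha> \<beta>)" for \<gamma> j \<alpha> \<beta>
      unfolding kernel_shift_def by (cases "below \<gamma> \<alpha>"; cases "below \<gamma> \<beta>") (simp_all add: cont)
    then show ?thesis unfolding obj_def agler_sum_def by (intro continuous_intros cont)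
  qed
  ultimately obtain A0 where A0: "A0 \<in> K" "\<And>A. A \<in> K \<Longrightarrow> obj A0 \<le> obj A"
    using continuous_attains_inf[of K obj] by blast
  \<comment> \<open>A competitor at least as good as \<open>Z\<close> has the same objective as its
    restriction \<open>A'\<close>, which lies in \<open>K\<close>; a worse one already loses against
    \<open>Z\<close>.\<close>
  have "obj A0 \<le> obj A" if A: "\<And>j. psd ?I (A j)" for A
  proof (cases "obj A \<le> obj Z")
    case True
    define A' where "A' = (\<lambda>j \<alpha> \<beta>. if \<alpha> \<in> ?I \<and> \<beta> \<in> ?I then A j \<alpha> \<beta> else 0)"
    have "obj A' = obj A"
      unfolding obj_def by (intro sum.cong refl arg_cong[where f="\<lambda>x. (cmod (_ - x))\<^sup>2"] agler_sum_cong[of N])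
        (auto simp: A'_def)
    have entry: "cmod (P \<alpha> \<beta> - agler_sum C \<alpha> \<beta>) \<le> sqrt (obj C)" if "\<alpha> \<in> ?I" "\<beta> \<in> ?I" for C \<alpha> \<beta>
    proof (rule real_le_rsqrt)
      have "(cmod (P \<alpha> \<beta> - agler_sum C \<alpha> \<beta>))\<^sup>2 \<le> (\<Sum>\<beta>\<in>?I. (cmod (P \<alpha> \<beta> - agler_sum C \<alpha> \<beta>))\<^sup>2)"
        using that by (intro member_le_sum) auto
      also have "\<dots> \<le> obj C"
        unfolding obj_def using that
        by (intro member_le_sum[of \<alpha> _ "\<lambda>\<alpha>. \<Sum>\<beta>\<in>?I. (cmod (P \<alpha> \<beta> - agler_sum C \<alpha> \<beta>))\<^sup>2"]) (auto intro: sum_nonneg)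
      finally show "(cmod (P \<alpha> \<beta> - agler_sum C \<alpha> \<beta>))\<^sup>2 \<le> obj C" .
    qed
    have X: "cmod (agler_sum A \<alpha> \<alpha>) \<le> 2 * s" if "\<alpha> \<in> ?I" for \<alpha>
    proof -
      have "cmod (P \<alpha> \<alpha> - agler_sum A \<alpha> \<alpha>) \<le> s"
        using entry[OF that that, of A] True unfolding s_def by (meson order_trans real_sqrt_le_mono)
      moreover have "cmod (P \<alpha> \<alpha>) \<le> s" using entry[OF that that, of Z] by (simp add: Z0 s_def)
      ultimately show ?thesis using norm_triangle_ineq4[of "P \<alpha> \<alpha>" "P \<alpha> \<alpha> - agler_sum A \<alpha> \<alpha>"] by simp
    qed
    have diag: "Re (A j \<alpha> \<alpha>) \<le> card ?I * (2 * s)" if \<alpha>: "\<alpha> \<in> ?I" for j \<alpha>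
    proof -
      define m where "m = mdeg \<alpha>"
      have m: "m \<le> N" using \<alpha> by (simp add: m_def indices_def)
      have sub: "indices m \<subseteq> ?I" "{\<alpha>. mdeg \<alpha> = m} \<subseteq> ?I" using m by (auto simp: indices_def)
      have pos: "0 \<le> Re (A i \<beta> \<beta>)" if "mdeg \<beta> = m" for i \<beta>
        using psd_diag(1)[OF finite_indices A, of \<beta>] sub that by auto
      have fin: "finite {\<alpha> :: 'n \<Rightarrow>\<^sub>0 nat. mdeg \<alpha> = m}" using finite_subset[OF sub(2)] by simp
      have "Re (A j \<alpha> \<alpha>) \<le> (\<Sum>\<alpha> | mdeg \<alpha> = m. Re (A j \<alpha> \<alpha>))"
        using pos fin by (intro member_le_sum[of \<alpha> _ "\<lambda>\<alpha>. Re (A j \<alpha> \<alpha>)"]) (auto simp: m_def)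
      also have "\<dots> \<le> (\<Sum>j\<in>UNIV. \<Sum>\<alpha> | mdeg \<alpha> = m. Re (A j \<alpha> \<alpha>))"
        using pos by (intro member_le_sum[of j _ "\<lambda>j. \<Sum>\<alpha> | mdeg \<alpha> = m. Re (A j \<alpha> \<alpha>)"]) (auto intro!: sum_nonneg)
      also have "\<dots> = Re (\<Sum>\<alpha>\<in>indices m. agler_sum A \<alpha> \<alpha>)"
        unfolding agler_sum_trace Re_sum ..
      also have "\<dots> \<le> (\<Sum>\<alpha>\<in>indices m. cmod (agler_sum A \<alpha> \<alpha>))"
        by (rule order_trans[OF complex_Re_le_cmod norm_sum])
      also have "\<dots> \<le> (\<Sum>\<alpha>\<in>?I. cmod (agler_sum A \<alpha> \<alpha>))"
        using sub by (intro sum_mono2) auto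
      also have "\<dots> \<le> card ?I * (2 * s)" using X by (intro sum_bounded_above) auto
      finally show ?thesis .
    qed
    have bd: "cmod (A j \<alpha> \<beta>) \<le> B" if "\<alpha> \<in> ?I" "\<beta> \<in> ?I" for j \<alpha> \<beta>
      using psd_bound[OF finite_indices A that, of j] diag[OF that(1), of j] diag[OF that(2), of j]
      by (simp add: B_def)
    have "psd ?I (A' j)" for j
      unfolding psd_def hermitian_def
    proof (intro conjI ballI allI)
      show "A' j \<beta> \<alpha> = cnj (A' j \<alpha> \<beta>)" if "\<alpha> \<in> ?I" "\<beta> \<in> ?I" for \<alpha> \<beta>
        using psdD(1)[OF A that] that by (simp add: A'_def)
      fix g
      have "form ?I (A' j) g = form ?I (A j) g" by (rule form_cong) (auto simp: A'_def)
      then show "0 \<le> form ?I (A' j) g" using psdD(2)[OF A] by simp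
    qed
    then have "A' \<in> K" using bd by (auto simp: K_def box_def A'_def)
    then show ?thesis using A0(2) \<open>obj A' = obj A\<close> by metis
  next
    case False
    then show ?thesis using A0(2)[OF \<open>Z \<in> K\<close>] by simp
  qed
  then show ?thesis using A0(1) by (auto simp: K_def)
qed

text \<open>
  The residual \<open>R\<close> of the best approximation separates; the test matrix is \<open>M = 1 - R\<^sup>*\<close> (entrywise
  conjugate). Adding the identity makes \<open>M\<close> definite and, since \<open>P\<close> has trace \<open>0\<close>, costs nothing.
\<close>

lemma agler_sum_duality:
  fixes P :: "('n::finite \<Rightarrow>\<^sub>0 nat) \<Rightarrow> ('n \<Rightarrow>\<^sub>0 nat) \<Rightarrow> complex"
  assumes herm: "hermitian (indices N) P"
    and trace: "Re (\<Sum>\<alpha>\<in>indices N. P \<alpha> \<alpha>) = 0"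
    and dual: "\<And>M. hermitian (indices N) M \<Longrightarrow>
        (\<And>g. (\<Sum>\<alpha>\<in>indices N. (cmod (g \<alpha>))\<^sup>2) \<le> form (indices N) M g) \<Longrightarrow>
        (\<And>j g. form (indices N) M (shift (unit_index j) g) \<le> form (indices N) M g) \<Longrightarrow>
        0 \<le> Re (\<Sum>\<alpha>\<in>indices N. \<Sum>\<beta>\<in>indices N. M \<alpha> \<beta> * P \<alpha> \<beta>)"
  shows "\<exists>A. (\<forall>j. psd (indices N) (A j)) \<and>
    (\<forall>\<alpha>\<in>indices N. \<forall>\<beta>\<in>indices N. P \<alpha> \<beta> = agler_sum A \<alpha> \<beta>)"
proof -
  let ?I = "indices N :: ('n \<Rightarrow>\<^sub>0 nat) set"
  from ex_nearest_agler_sum[where N=N and P=P] obtain A0 where A0': "\<forall>j. psd ?I (A0 j)"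
    and min': "\<forall>A. (\<forall>j. psd ?I (A j)) \<longrightarrow>
      (\<Sum>\<alpha>\<in>?I. \<Sum>\<beta>\<in>?I. (cmod (P \<alpha> \<beta> - agler_sum A0 \<alpha> \<beta>))\<^sup>2) \<le>
      (\<Sum>\<alpha>\<in>?I. \<Sum>\<beta>\<in>?I. (cmod (P \<alpha> \<beta> - agler_sum A \<alpha> \<beta>))\<^sup>2)"
    by (elim exE conjE)
  note A0 = A0'[rule_format] and min = min'[rule_format]
  define R where "R = (\<lambda>\<alpha> \<beta>. P \<alpha> \<beta> - agler_sum A0 \<alpha> \<beta>)"
  have minR: "hs_inner ?I R R \<le> hs_inner ?I R R - 2 * t * hs_inner ?I R Y + t\<^sup>2 * hs_inner ?I Y Y"
    if "\<And>j. psd ?I (A j)" "\<And>\<alpha> \<beta>. P \<alpha> \<beta> - agler_sum A \<alpha> \<beta> = R \<alpha> \<beta> - of_real t * Y \<alpha> \<beta>" for A t Y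
  proof -
    have "hs_inner ?I R R \<le> hs_inner ?I (\<lambda>\<alpha> \<beta>. P \<alpha> \<beta> - agler_sum A \<alpha> \<beta>) (\<lambda>\<alpha> \<beta>. P \<alpha> \<beta> - agler_sum A \<alpha> \<beta>)"
      unfolding hs_inner_self R_def by (rule min[OF that(1)])
    then show ?thesis unfolding that(2) hs_inner_expand .
  qed
  \<comment> \<open>The admissible families form a cone, so \<open>A0\<close> may be moved in the
    direction of any \<open>A\<close>. Minimality makes the first variation nonnegative.\<close>
  have polar: "hs_inner ?I R (agler_sum A) \<le> 0" if A: "\<And>j. psd ?I (A j)" for A
  proof -
    have "0 \<le> - 2 * hs_inner ?I R (agler_sum A)"
    proof (rule nonneg_of_quadratic)
      fix t :: real assume t: "0 < t" "t \<le> 1"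
      have "psd ?I (\<lambda>\<alpha> \<beta>. of_real 1 * A0 j \<alpha> \<beta> + of_real t * A j \<alpha> \<beta>)" for j
        using t by (intro psd_scale_add A0 A) auto
      from minR[where A="\<lambda>j \<alpha> \<beta>. of_real 1 * A0 j \<alpha> \<beta> + of_real t * A j \<alpha> \<beta>", OF this, where t=t and Y="agler_sum A"]
      show "0 \<le> t * (- 2 * hs_inner ?I R (agler_sum A)) + t\<^sup>2 * hs_inner ?I (agler_sum A) (agler_sum A)"
        unfolding agler_sum_linear by (simp add: R_def algebra_simps)
    qed
    then show ?thesis by simp
  qed
  \<comment> \<open>Here \<open>A0\<close> is shrunk to \<open>(1 - t) * A0\<close>, which is
    admissible for \<open>t \<le> 1\<close>; the summand with factor 0 only fits this into the
    two-term shape of \<open>psd_scale_add\<close>.\<close>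
  have self: "0 \<le> hs_inner ?I R (agler_sum A0)"
  proof -
    have "0 \<le> 2 * hs_inner ?I R (agler_sum A0)"
    proof (rule nonneg_of_quadratic)
      fix t :: real assume t: "0 < t" "t \<le> 1"
      have "psd ?I (\<lambda>\<alpha> \<beta>. of_real (1 - t) * A0 j \<alpha> \<beta> + of_real 0 * A0 j \<alpha> \<beta>)" for j
        using t by (intro psd_scale_add A0) auto
      from minR[where A="\<lambda>j \<alpha> \<beta>. of_real (1 - t) * A0 j \<alpha> \<beta> + of_real 0 * A0 j \<alpha> \<beta>", OF this, where t="- t" and Y="agler_sum A0"]
      show "0 \<le> t * (2 * hs_inner ?I R (agler_sum A0)) + t\<^sup>2 * hs_inner ?I (agler_sum A0) (agler_sum A0)"
        unfolding agler_sum_linear by (simp add: R_def algebra_simps)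
    qed
    then show ?thesis by simp
  qed
  define M where "M = (\<lambda>\<alpha> \<beta>. (if \<alpha> = \<beta> then 1 else 0) - cnj (R \<alpha> \<beta>))"
  define \<phi> where "\<phi> = (\<lambda>g. - hs_inner ?I R (\<lambda>\<alpha> \<beta>. g \<alpha> * cnj (g \<beta>)))"
  have formM: "form ?I M g = (\<Sum>\<alpha>\<in>?I. (cmod (g \<alpha>))\<^sup>2) + \<phi> g" for g
  proof -
    have "form ?I M g = form ?I (\<lambda>\<alpha> \<beta>. if \<alpha> = \<beta> then 1 else 0) g - form ?I (\<lambda>\<alpha> \<beta>. cnj (R \<alpha> \<beta>)) g"
      unfolding M_def by (rule form_diff)
    also have "form ?I (\<lambda>\<alpha> \<beta>. if \<alpha> = \<beta> then 1 else 0) g = (\<Sum>\<alpha>\<in>?I. Re (g \<alpha> * cnj (g \<alpha>)))"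
      by (simp add: form_def if_distrib[of "\<lambda>x. x * _"] cong: if_cong)
    also have "\<dots> = (\<Sum>\<alpha>\<in>?I. (cmod (g \<alpha>))\<^sup>2)"
      by (simp only: complex_norm_square[symmetric] Re_complex_of_real)
    finally show ?thesis by (simp add: \<phi>_def hs_inner_def form_def mult.assoc)
  qed
  have \<phi>_shift: "\<phi> (shift (unit_index j) g) \<le> \<phi> g" for j g
  proof -
    \<comment> \<open>The rank one kernel of \<open>g\<close> is put into slot \<open>j\<close>
      alone. Its Agler sum is the kernel of \<open>g\<close> minus that of the shifted
      \<open>g\<close>, so \<open>polar\<close> compares the two values of
      \<open>\<phi>\<close>.\<close>
    define A where "A = (\<lambda>i \<alpha> \<beta>. if i = j then g \<alpha> * cnj (g \<beta>) else 0)"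
    have A: "psd ?I (A i)" for i
      using psd_rank_one[of ?I g] psd_rank_one[of ?I "\<lambda>_. 0"] by (cases "i = j") (simp_all add: A_def)
    have "agler_sum A \<alpha> \<beta> = (\<Sum>i\<in>UNIV. if i = j then g \<alpha> * cnj (g \<beta>) -
        shift (unit_index j) g \<alpha> * cnj (shift (unit_index j) g \<beta>) else 0)" for \<alpha> \<beta>
      unfolding agler_sum_def kernel_shift_rank_one[symmetric]
      by (intro sum.cong refl) (auto simp: A_def kernel_shift_def)
    then have "agler_sum A \<alpha> \<beta> = g \<alpha> * cnj (g \<beta>) - shift (unit_index j) g \<alpha> * cnj (shift (unit_index j) g \<beta>)" for \<alpha> \<beta>
      by simp
    then have "hs_inner ?I R (agler_sum A) = \<phi> (shift (unit_index j) g) - \<phi> g"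
      by (simp add: \<phi>_def hs_inner_def right_diff_distrib sum_subtractf)
    then show ?thesis using polar[of A, OF A] by simp
  qed
  \<comment> \<open>Along repeated shifts in one variable \<open>\<phi>\<close> does not increase,
    and after \<open>N + 1\<close> of them nothing of degree at most \<open>N\<close> is
    left.\<close>
  have \<phi>_nonneg: "0 \<le> \<phi> g" for g
  proof -
    fix j :: 'n
    have "\<phi> (shift (Poly_Mapping.single j k) g) \<le> \<phi> g" for k
    proof (induction k)
      case (Suc k)
      then show ?case
        using \<phi>_shift[of j "shift (Poly_Mapping.single j k) g"] by (simp add: shift_shift single_Suc)
    qed simp
    moreover have "\<phi> (shift (Poly_Mapping.single j (Suc N)) g) = \<phi> (\<lambda>_. 0)"
      unfolding \<phi>_def using shift_eq_0[of _ "Poly_Mapping.single j (Suc N)" g]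
      by (intro arg_cong[where f=uminus] hs_inner_cong refl) (simp add: indices_def)
    ultimately have "\<phi> (\<lambda>_. 0) \<le> \<phi> g" by metis
    then show "0 \<le> \<phi> g" by (simp add: \<phi>_def hs_inner_def)
  qed
  have "0 \<le> Re (\<Sum>\<alpha>\<in>?I. \<Sum>\<beta>\<in>?I. M \<alpha> \<beta> * P \<alpha> \<beta>)"
  proof (rule dual)
    have hA: "hermitian ?I (agler_sum A0)" using A0 by (intro agler_sum_hermitian) (simp add: psd_def)
    show "hermitian ?I M"
      unfolding hermitian_def
    proof (intro ballI)
      fix \<alpha> \<beta> assume ab: "\<alpha> \<in> ?I" "\<beta> \<in> ?I"
      show "M \<beta> \<alpha> = cnj (M \<alpha> \<beta>)"
        using hermitianD[OF herm ab] hermitianD[OF hA ab] by (auto simp: M_def R_def)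
    qed
    show "(\<Sum>\<alpha>\<in>?I. (cmod (g \<alpha>))\<^sup>2) \<le> form ?I M g" for g using \<phi>_nonneg by (simp add: formM)
    show "form ?I M (shift (unit_index j) g) \<le> form ?I M g" for j g
    proof -
      \<comment> \<open>For the identity part of \<open>M\<close>: a truncated shift relabels
        coefficients injectively or drops them, so their sum of squares cannot grow.\<close>
      let ?u = "unit_index j"
      have "(\<Sum>\<alpha>\<in>?I. (cmod (shift ?u g \<alpha>))\<^sup>2) = (\<Sum>\<alpha> | \<alpha> \<in> ?I \<and> below ?u \<alpha>. (cmod (g (\<alpha> - ?u)))\<^sup>2)"
        by (intro sum.mono_neutral_cong_right) (auto simp: shift_def)
      also have "\<dots> = (\<Sum>\<alpha>\<in>(\<lambda>\<alpha>. \<alpha> - ?u) ` {\<alpha>. \<alpha> \<in> ?I \<and> below ?u \<alpha>}. (cmod (g \<alpha>))\<^sup>2)"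
        by (subst sum.reindex) (auto simp: inj_on_def dest: below_minus, metis below_minus)
      also have "\<dots> \<le> (\<Sum>\<alpha>\<in>?I. (cmod (g \<alpha>))\<^sup>2)"
        using mdeg_minus[of ?u] by (intro sum_mono2 finite_indices) (auto simp: indices_def)
      finally show ?thesis using \<phi>_shift[of j g] by (simp add: formM)
    qed
  qed
  \<comment> \<open>The pairing equals the trace of \<open>P\<close>, which is 0, minus the squared
    norm of \<open>R\<close> minus \<open>hs_inner ?I R (agler_sum A0)\<close>. As the last pairing
    is nonnegative, \<open>dual\<close> leaves only \<open>R = 0\<close>.\<close>
  moreover have "Re (\<Sum>\<alpha>\<in>?I. \<Sum>\<beta>\<in>?I. M \<alpha> \<beta> * P \<alpha> \<beta>) = Re (\<Sum>\<alpha>\<in>?I. P \<alpha> \<alpha>) - hs_inner ?I R P"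
    by (simp add: M_def hs_inner_def left_diff_distrib sum_subtractf if_distrib[of "\<lambda>x. x * _"] cong: if_cong)
  moreover have "hs_inner ?I R P = hs_inner ?I R R + hs_inner ?I R (agler_sum A0)"
    by (simp add: hs_inner_def R_def algebra_simps sum.distrib sum_subtractf)
  ultimately have "(\<Sum>\<alpha>\<in>?I. \<Sum>\<beta>\<in>?I. (cmod (R \<alpha> \<beta>))\<^sup>2) \<le> 0"
    using trace self unfolding hs_inner_self[symmetric] by linarith
  then have "(\<Sum>\<alpha>\<in>?I. \<Sum>\<beta>\<in>?I. (cmod (R \<alpha> \<beta>))\<^sup>2) = 0"
    by (intro antisym sum_nonneg) auto
  then have "\<forall>\<alpha>\<in>?I. \<forall>\<beta>\<in>?I. R \<alpha> \<beta> = 0"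
    by (simp add: sum_nonneg_eq_0_iff sum_nonneg)
  then show ?thesis using A0 by (intro exI[of _ A0]) (simp add: R_def)
qed

section \<open>Finite dimensional realizations\<close>

definition std_ip :: "nat \<Rightarrow> cseq \<Rightarrow> cseq \<Rightarrow> complex" where
  "std_ip D = gram_ip D (\<lambda>i k. if i = k then 1 else 0)"

lemma std_ip_eq: "std_ip D x y = (\<Sum>i<D. x i * cnj (y i))"
  by (simp add: std_ip_def gram_ip_def if_distrib[of "\<lambda>x. x * _"] cong: if_cong)

lemma Re_std_ip: "Re (std_ip D x x) = (\<Sum>i<D. (cmod (x i))\<^sup>2)"
  unfolding std_ip_eq Re_sum by (simp only: complex_norm_square[symmetric] Re_complex_of_real)

lemma hnorm_std_ip: "(hnorm (std_ip D) x)\<^sup>2 = (\<Sum>i<D. (cmod (x i))\<^sup>2)"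
  by (simp add: hnorm_def Re_std_ip sum_nonneg)

lemma complex_hilbert_std_ip: "complex_hilbert (fin_space D) (std_ip D)"
  unfolding std_ip_def
proof (rule complex_hilbert_fin_space)
  show "(0::real) < 1" by simp
  show "1 * (\<Sum>i<D. (cmod (x i))\<^sup>2) \<le> form {..<D} (\<lambda>i k. if i = k then 1 else 0) x" for x
    unfolding Re_gram_ip[symmetric] std_ip_def[symmetric] Re_std_ip by simp
qed (simp add: hermitian_def)

text \<open>The orthogonal summands are coordinate subspaces, encoded by a label \<open>h i\<close>
  on each coordinate, so that E(z) simply multiplies coordinate \<open>i\<close> by
  \<open>z $ h i\<close>.\<close>

definition block :: "nat \<Rightarrow> (nat \<Rightarrow> 'n) \<Rightarrow> 'n \<Rightarrow> cseq set" where
  "block D h j = {x \<in> fin_space D. \<forall>i. h i \<noteq> j \<longrightarrow> x i = 0}"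

lemma subspace_block: "cseq.subspace (block D h j)"
  unfolding cseq.subspace_def block_def fin_space_def
  by (simp add: cscale_def)

lemma block_finite_dim: "\<exists>S. finite S \<and> block D h j = cseq.span S"
proof -
  define b :: "nat \<Rightarrow> cseq" where "b = (\<lambda>i k. if k = i then 1 else 0)"
  define S where "S = b ` {i. i < D \<and> h i = j}"
  have "S \<subseteq> block D h j" by (auto simp: S_def b_def block_def fin_space_def split: if_splits)
  then have 1: "cseq.span S \<subseteq> block D h j" using subspace_block by (rule cseq.span_minimal)
  have 2: "x \<in> cseq.span S" if x: "x \<in> block D h j" for x
  proof -
    have "x = (\<Sum>i | i < D \<and> h i = j. cscale (x i) (b i))"
    proof
      fix k
      have "(\<Sum>i | i < D \<and> h i = j. cscale (x i) (b i)) k = (if k < D \<and> h k = j then x k else 0)"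
        by (simp add: sum_fun_apply cscale_def b_def if_distrib[of "\<lambda>x. _ * x"] cong: if_cong)
      also have "\<dots> = x k"
        using x by (auto simp: block_def fin_space_def)
      finally show "x k = (\<Sum>i | i < D \<and> h i = j. cscale (x i) (b i)) k" ..
    qed
    also have "\<dots> \<in> cseq.span S"
      by (intro cseq.span_sum cseq.span_scale cseq.span_base) (auto simp: S_def)
    finally show ?thesis .
  qed
  have "finite S" by (simp add: S_def)
  then show ?thesis using 1 2 by blast
qed

lemma block_decomposition:
  fixes h :: "nat \<Rightarrow> 'n::finite"
  assumes x: "x \<in> fin_space D"
  shows "\<forall>j. (\<lambda>i. if h i = j then x i else 0) \<in> block D h j"
    and "x = (\<Sum>j\<in>UNIV. (\<lambda>i. if h i = j then x i else 0))"
  using x by (auto simp: block_def fin_space_def sum_fun_apply fun_eq_iff)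

lemma block_coordinate:
  fixes h :: "nat \<Rightarrow> 'n::finite"
  assumes "\<forall>j. xs j \<in> block D h j"
  shows "(\<Sum>j\<in>UNIV. c j * xs j i) = c (h i) * xs (h i) i"
proof -
  have "c j * xs j i = (if j = h i then c (h i) * xs (h i) i else 0)" for j
    using assms by (auto simp: block_def)
  then have "(\<Sum>j\<in>UNIV. c j * xs j i) = (\<Sum>j\<in>UNIV. if j = h i then c (h i) * xs (h i) i else 0)"
    by (rule sum.cong[OF refl])
  also have "\<dots> = c (h i) * xs (h i) i" by simp
  finally show ?thesis .
qed

lemma block_orthogonal_decomposition:
  "orthogonal_decomposition (fin_space D) (std_ip D) (block D (h :: nat \<Rightarrow> 'n::finite))"
  unfolding orthogonal_decomposition_def
proof (intro conjI allI impI ballI subspace_block)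
  fix i j :: 'n and x y assume "i \<noteq> j" "x \<in> block D h i" "y \<in> block D h j"
  then show "std_ip D x y = 0" 
    unfolding std_ip_eq by (intro sum.neutral ballI) (auto simp: block_def)
next
  show "fin_space D = {\<Sum>j\<in>UNIV. xs j |xs. \<forall>j. xs j \<in> block D h j}"
  proof (intro equalityI subsetI)
    fix x assume "x \<in> fin_space D"
    from block_decomposition[OF this, of h] show "x \<in> {\<Sum>j\<in>UNIV. xs j |xs. \<forall>j. xs j \<in> block D h j}"
      by blast
  next
    fix x assume "x \<in> {\<Sum>j\<in>UNIV. xs j |xs. \<forall>j. xs j \<in> block D h j}"
    then show "x \<in> fin_space D" by (auto simp: block_def fin_space_def sum_fun_apply)
  qed
qed

lemma block_diagonal_block:
  fixes h :: "nat \<Rightarrow> 'n::finite"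
  assumes x: "x \<in> fin_space D"
  shows "block_diagonal (block D h) z x = (\<lambda>i. z $ h i * x i)"
proof -
  define ys where "ys = (\<lambda>j i. if h i = j then x i else 0)"
  have "(THE xs. (\<forall>j. xs j \<in> block D h j) \<and> x = (\<Sum>j\<in>UNIV. xs j)) = ys"
  proof (rule the_equality)
    show "(\<forall>j. ys j \<in> block D h j) \<and> x = (\<Sum>j\<in>UNIV. ys j)"
      using block_decomposition[OF x, of h] by (simp add: ys_def)
    fix xs assume xs: "(\<forall>j. xs j \<in> block D h j) \<and> x = (\<Sum>j\<in>UNIV. xs j)"
    then have b: "xs j \<in> block D h j" for j by simp
    \<comment> \<open>Coordinate \<open>i\<close> of a sum of block vectors comes from the block
      \<open>h i\<close> alone, which determines every summand.\<close>
    have "x i = xs (h i) i" for i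
      using xs block_coordinate[of xs D h "\<lambda>_. 1" i] by (simp add: sum_fun_apply)
    then show "xs = ys" using b by (auto simp: fun_eq_iff ys_def block_def)
  qed
  then have "block_diagonal (block D h) z x = (\<Sum>j\<in>UNIV. cscale (z $ j) (ys j))"
    by (simp add: block_diagonal_def)
  then show ?thesis by (simp add: fun_eq_iff sum_fun_apply cscale_def ys_def if_distrib[of "\<lambda>x. _ * x"] cong: if_cong)
qed

text \<open>Identifies the orthogonal sum of the scalars and \<open>fin_space D\<close> with
  \<open>fin_space (Suc D)\<close>, so that \<open>isometry_extension\<close> can produce the
  operator \<open>V\<close>.\<close>

definition join :: "complex \<Rightarrow> cseq \<Rightarrow> cseq" where
  "join b x = (\<lambda>i. case i of 0 \<Rightarrow> b | Suc i \<Rightarrow> x i)"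

lemma join_simps [simp]: "join b x 0 = b" "join b x (Suc i) = x i"
  by (simp_all add: join_def)

lemma join_eq_iff: "y = join b x \<longleftrightarrow> y 0 = b \<and> (\<forall>i. y (Suc i) = x i)"
  by (auto simp: fun_eq_iff join_def split: nat.split)

lemma join_split: "join (y 0) (\<lambda>i. y (Suc i)) = y"
  by (auto simp: fun_eq_iff join_def split: nat.split)

lemma join_fin_space [simp]: "join b x \<in> fin_space (Suc D) \<longleftrightarrow> x \<in> fin_space D"
proof
  show "x \<in> fin_space D" if "join b x \<in> fin_space (Suc D)"
    unfolding fin_space_def
  proof (intro CollectI allI impI)
    fix i assume "D \<le> i"
    then have "join b x (Suc i) = 0" using that by (simp add: fin_space_def del: join_simps)
    then show "x i = 0" by simp
  qed
qed (auto simp: fin_space_def join_def split: nat.split)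

lemma join_add: "join (b + c) (x + y) = join b x + join c y"
  and join_scale: "join (t * b) (cscale t x) = cscale t (join b x)"
  by (auto simp: join_def fun_eq_iff cscale_def split: nat.split)

lemma std_ip_join: "std_ip (Suc D) (join b x) (join c y) = b * cnj c + std_ip D x y"
  by (simp add: std_ip_eq sum.lessThan_Suc_shift del: sum.lessThan_Suc)

section \<open>The lurking isometry\<close>

definition coeff_eval :: "nat \<Rightarrow> (('n::finite \<Rightarrow>\<^sub>0 nat) \<Rightarrow> complex) \<Rightarrow> complex ^ 'n \<Rightarrow> complex" where
  "coeff_eval N g z = (\<Sum>\<alpha>\<in>indices N. g \<alpha> * power_monomial z \<alpha>)"

text \<open>With \<open>g\<close> supported in degrees below \<open>N\<close>, its product with a
  variable still has degree at most \<open>N\<close>, so the truncated sum loses nothing.\<close>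

lemma coeff_eval_shift:
  assumes "\<And>\<alpha>. N \<le> mdeg \<alpha> \<Longrightarrow> g \<alpha> = 0"
  shows "coeff_eval N (shift (unit_index j) g) z = z $ j * coeff_eval N g z"
proof -
  let ?u = "unit_index j"
  have "coeff_eval N (shift ?u g) z = (\<Sum>\<alpha> | \<alpha> \<in> indices N \<and> below ?u \<alpha>. g (\<alpha> - ?u) * power_monomial z \<alpha>)"
    unfolding coeff_eval_def by (intro sum.mono_neutral_cong_right) (auto simp: shift_def)
  also have "\<dots> = (\<Sum>\<alpha> | mdeg \<alpha> < N. z $ j * (g \<alpha> * power_monomial z \<alpha>))"
  proof (rule sum.reindex_bij_witness[of _ "\<lambda>\<alpha>. ?u + \<alpha>" "\<lambda>\<alpha>. \<alpha> - ?u"])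
    fix \<alpha> assume "\<alpha> \<in> {\<alpha>. \<alpha> \<in> indices N \<and> below ?u \<alpha>}"
    then have a: "mdeg \<alpha> \<le> N" "below ?u \<alpha>" by (auto simp: indices_def)
    show "?u + (\<alpha> - ?u) = \<alpha>" "\<alpha> - ?u \<in> {\<alpha>. mdeg \<alpha> < N}"
      using a mdeg_minus[OF a(2)] by (auto simp: below_minus)
    show "z $ j * (g (\<alpha> - ?u) * power_monomial z (\<alpha> - ?u)) = g (\<alpha> - ?u) * power_monomial z \<alpha>"
      using power_monomial_add[of z ?u "\<alpha> - ?u"] by (simp add: below_minus[OF a(2)])
  qed (auto simp: indices_def mdeg_add)
  also have "\<dots> = (\<Sum>\<alpha>\<in>indices N. z $ j * (g \<alpha> * power_monomial z \<alpha>))"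
    using assms by (intro sum.mono_neutral_left) (auto simp: indices_def finite_indices[unfolded indices_def])
  finally show ?thesis by (simp add: coeff_eval_def sum_distrib_left)
qed

lemma peval_coeff_eval: "keys p \<subseteq> indices N \<Longrightarrow> peval p z = coeff_eval N (lookup p) z"
  unfolding coeff_eval_def by (rule peval_superset) auto

text \<open>The assumption \<open>gram\<close> says that the vectors \<open>\<xi> \<alpha>\<close>
  and \<open>\<eta> \<alpha>\<close> have equal Gram matrices, so an isometry maps one family to the
  other. Summing against the monomials gives \<open>V (p(z), E(z) y) = (q(z), y)\<close>. Dividing
  by p(z), the second component reads C + D E(z) x = x, which determines x, and the first reads A +
  B E(z) x = f(z).\<close>

lemma lurking_isometry_realization:
  fixes f :: "complex ^ 'n::finite \<Rightarrow> complex" and p q :: "'n cpoly"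
    and v :: "'n \<Rightarrow> nat \<Rightarrow> ('n \<Rightarrow>\<^sub>0 nat) \<Rightarrow> complex"
  assumes gram: "\<And>\<alpha> \<beta>. lookup p \<alpha> * cnj (lookup p \<beta>) +
      (\<Sum>j\<in>UNIV. \<Sum>k<K. shift (unit_index j) (v j k) \<alpha> * cnj (shift (unit_index j) (v j k) \<beta>)) =
      lookup q \<alpha> * cnj (lookup q \<beta>) + (\<Sum>j\<in>UNIV. \<Sum>k<K. v j k \<alpha> * cnj (v j k \<beta>))"
    and supp: "\<And>j k \<alpha>. N \<le> mdeg \<alpha> \<Longrightarrow> v j k \<alpha> = 0"
    and pN: "keys p \<subseteq> indices N" and qN: "keys q \<subseteq> indices N"
    and p0: "\<And>z. z \<in> polydisk \<Longrightarrow> peval p z \<noteq> 0"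
    and fpq: "\<And>z. z \<in> polydisk \<Longrightarrow> f z = peval q z / peval p z"
  shows "has_finite_dim_realization f"
proof -
  \<comment> \<open>One coordinate for each pair of a variable and a square; \<open>e\<close>
    enumerates the pairs, and \<open>h\<close> keeps the variable as block label.\<close>
  define D where "D = CARD('n) * K"
  have "card ((UNIV :: 'n set) \<times> {..<K}) = D" by (simp add: D_def card_cartesian_product)
  then obtain e where e: "bij_betw e {..<D} ((UNIV :: 'n set) \<times> {..<K})"
    using ex_bij_betw_nat_finite[of "(UNIV :: 'n set) \<times> {..<K}"] by (auto simp: atLeast0LessThan)
  define h where "h = fst \<circ> e"
  define c where "c = (\<lambda>i. v (h i) (snd (e i)))"
  define \<xi> where "\<xi> = (\<lambda>\<alpha>. join (lookup p \<alpha>) (\<lambda>i. if i < D then shift (unit_index (h i)) (c i) \<alpha> else 0))"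
  define \<eta> where "\<eta> = (\<lambda>\<alpha>. join (lookup q \<alpha>) (\<lambda>i. if i < D then c i \<alpha> else 0))"
  let ?H = "fin_space D" and ?H1 = "fin_space (Suc D)" and ?I = "indices N :: ('n \<Rightarrow>\<^sub>0 nat) set"
  interpret H1: complex_hilbert ?H1 "std_ip (Suc D)" by (rule complex_hilbert_std_ip)
  interpret H: complex_hilbert ?H "std_ip D" by (rule complex_hilbert_std_ip)
  have sumD: "(\<Sum>i<D. F (h i) (snd (e i))) = (\<Sum>j\<in>UNIV. \<Sum>k<K. F j k)" for F :: "'n \<Rightarrow> nat \<Rightarrow> complex"
    using sum.reindex_bij_betw[OF e, of "\<lambda>(j, k). F j k"]
    by (simp add: h_def case_prod_unfold sum.cartesian_product)
  have "\<exists>V. linear_operator ?H1 V \<and> (\<forall>x\<in>?H1. \<forall>y\<in>?H1. std_ip (Suc D) (V x) (V y) = std_ip (Suc D) x y) \<and>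
      (\<forall>\<alpha>\<in>?I. V (\<xi> \<alpha>) = \<eta> \<alpha>)"
  proof (rule H1.isometry_extension)
    show "\<xi> \<alpha> \<in> ?H1" "\<eta> \<alpha> \<in> ?H1" for \<alpha> by (auto simp: \<xi>_def \<eta>_def fin_space_def[of D])
    show "std_ip (Suc D) (\<xi> \<alpha>) (\<xi> \<beta>) = std_ip (Suc D) (\<eta> \<alpha>) (\<eta> \<beta>)" for \<alpha> \<beta>
      using gram[of \<alpha> \<beta>]
        sumD[of "\<lambda>j k. shift (unit_index j) (v j k) \<alpha> * cnj (shift (unit_index j) (v j k) \<beta>)"]
        sumD[of "\<lambda>j k. v j k \<alpha> * cnj (v j k \<beta>)"]
      by (simp add: \<xi>_def \<eta>_def std_ip_join std_ip_eq[of D] c_def)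
  qed simp
  then obtain V0 where V0: "linear_operator ?H1 V0"
    "\<And>x y. x \<in> ?H1 \<Longrightarrow> y \<in> ?H1 \<Longrightarrow> std_ip (Suc D) (V0 x) (V0 y) = std_ip (Suc D) x y"
    "\<And>\<alpha>. \<alpha> \<in> ?I \<Longrightarrow> V0 (\<xi> \<alpha>) = \<eta> \<alpha>"
    by blast
  have V0H: "V0 x \<in> ?H1" and V0add: "V0 (x + y) = V0 x + V0 y" and V0scale: "V0 (cscale t x) = cscale t (V0 x)"
    if "x \<in> ?H1" "y \<in> ?H1" for x y t
    using V0(1) that by (auto simp: linear_operator_def)
  have V0sum: "V0 (\<Sum>\<alpha>\<in>A. cscale (t \<alpha>) (x \<alpha>)) = (\<Sum>\<alpha>\<in>A. cscale (t \<alpha>) (V0 (x \<alpha>)))"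
    if "finite A" "\<And>\<alpha>. x \<alpha> \<in> ?H1" for A t and x :: "('n \<Rightarrow>\<^sub>0 nat) \<Rightarrow> cseq"
    using that(1)
  proof (induction A rule: finite_induct)
    case empty
    have "V0 (cscale 0 0) = cscale 0 (V0 0)" using H1.H_zero by (rule V0scale[OF _ H1.H_zero])
    then show ?case by (simp add: cscale_def fun_eq_iff zero_fun_def)
  next
    case (insert a A)
    have "V0 (cscale (t a) (x a) + (\<Sum>\<alpha>\<in>A. cscale (t \<alpha>) (x \<alpha>))) =
        V0 (cscale (t a) (x a)) + V0 (\<Sum>\<alpha>\<in>A. cscale (t \<alpha>) (x \<alpha>))"
      using that(2) by (intro V0add H1.H_scale H1.H_sum)
    also have "V0 (cscale (t a) (x a)) = cscale (t a) (V0 (x a))"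
      by (rule V0scale[OF that(2) H1.H_zero])
    finally show ?case by (simp only: sum.insert[OF insert.hyps] insert.IH)
  qed
  define V where "V = (\<lambda>(b, x). (V0 (join b x) 0, \<lambda>i. V0 (join b x) (Suc i)))"
  have Vjoin: "join (fst (V (b, x))) (snd (V (b, x))) = V0 (join b x)" for b x
    by (simp add: V_def join_split)
  have VH: "snd (V (b, x)) \<in> ?H" if "x \<in> ?H" for b x
    using V0H[of "join b x" 0] that H1.H_zero unfolding Vjoin[symmetric] by simp
  have Vadd: "V (b + b', x + x') = V (b, x) + V (b', x')" if "x \<in> ?H" "x' \<in> ?H" for b b' x x'
  proof -
    have "V0 (join (b + b') (x + x')) = V0 (join b x) + V0 (join b' x')"
      unfolding join_add using that by (intro V0add) simp_all
    then show ?thesis by (simp only: V_def prod.case) (simp add: fun_eq_iff)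
  qed
  have Vscale: "V (t * b, cscale t x) = (t * fst (V (b, x)), cscale t (snd (V (b, x))))" if "x \<in> ?H" for t b x
    using that H1.H_zero by (simp add: V_def join_scale V0scale[of _ 0]) (simp add: cscale_def)
  have Vnorm: "(cmod (fst (V (b, x))))\<^sup>2 + (hnorm (std_ip D) (snd (V (b, x))))\<^sup>2 =
      (cmod b)\<^sup>2 + (hnorm (std_ip D) x)\<^sup>2" if "x \<in> ?H" for b x
  proof -
    have n: "(hnorm (std_ip (Suc D)) (join b x))\<^sup>2 = (cmod b)\<^sup>2 + (hnorm (std_ip D) x)\<^sup>2" for b x
      by (simp add: hnorm_std_ip sum.lessThan_Suc_shift del: sum.lessThan_Suc)
    have "hnorm (std_ip (Suc D)) (V0 (join b x)) = hnorm (std_ip (Suc D)) (join b x)"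
      using that by (simp add: hnorm_def V0(2))
    then show ?thesis using n[of "fst (V (b, x))" "snd (V (b, x))"] n[of b x] by (simp add: Vjoin)
  qed
  have iso: "isometric_operator ?H (std_ip D) V"
    unfolding isometric_operator_def
    using VH Vadd Vscale Vnorm by (auto simp: mem_Times_iff)
  let ?Hs = "block D h"
  let ?E = "block_diagonal ?Hs" and ?D = "\<lambda>x. snd (V (0, x))" and ?C = "snd (V (1, 0))"
  have E: "?E z x = (\<lambda>i. z $ h i * x i)" "?E z x \<in> ?H" if "x \<in> ?H" for z x
    using that by (simp_all add: block_diagonal_block) (simp add: fin_space_def)
  have bij: "bij_betw (\<lambda>x. x - ?D (?E z x)) ?H ?H" if z: "z \<in> polydisk" for z
  proof (rule H.bij_betw_id_minus)
    define r where "r = Max (range (\<lambda>j. cmod (z $ j)))"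
    have rz: "cmod (z $ j) \<le> r" for j by (simp add: r_def)
    show "r < 1" using z by (simp add: r_def polydisk_def)
    have r0: "0 \<le> r" using rz norm_ge_zero order_trans by blast
    show "linear_operator ?H (\<lambda>x. ?D (?E z x))"
      unfolding linear_operator_def
    proof (intro conjI ballI allI)
      fix x y t assume x: "x \<in> ?H" and y: "y \<in> ?H"
      show "?D (?E z x) \<in> ?H" using VH E(2) x by simp
      have "?E z (x + y) = ?E z x + ?E z y"
        using x y by (simp add: E H.H_add fun_eq_iff algebra_simps)
      then show "?D (?E z (x + y)) = ?D (?E z x) + ?D (?E z y)"
        using Vadd[OF E(2)[OF x] E(2)[OF y], of 0 0] by simp
    next
      fix x t assume x: "x \<in> ?H"
      have "?E z (cscale t x) = cscale t (?E z x)"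
        using x by (simp add: E H.H_scale) (simp add: cscale_def fun_eq_iff)
      then show "?D (?E z (cscale t x)) = cscale t (?D (?E z x))"
        using Vscale[OF E(2)[OF x], of t 0] by simp
    qed
    show "opnorm_le ?H (std_ip D) (\<lambda>x. ?D (?E z x)) r"
      unfolding opnorm_le_def
    proof
      fix x assume x: "x \<in> ?H"
      \<comment> \<open>D is a compression of the isometry \<open>V\<close>, hence contractive, and
        E(z) has norm at most \<open>r\<close>, the largest modulus of a coordinate of
        \<open>z\<close>.\<close>
      have "(hnorm (std_ip D) (?D (?E z x)))\<^sup>2 \<le> (hnorm (std_ip D) (?E z x))\<^sup>2"
        using Vnorm[OF E(2)[OF x], of 0] by (metis le_add_same_cancel2 norm_zero add.left_neutral zero_le_power2 zero_power2)
      also have "\<dots> = (\<Sum>i<D. (cmod (z $ h i))\<^sup>2 * (cmod (x i))\<^sup>2)"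
        by (simp add: hnorm_std_ip E[OF x] norm_mult power_mult_distrib)
      also have "\<dots> \<le> (\<Sum>i<D. r\<^sup>2 * (cmod (x i))\<^sup>2)"
        using rz by (intro sum_mono mult_right_mono power_mono) auto
      also have "\<dots> = (r * hnorm (std_ip D) x)\<^sup>2"
        by (simp add: power_mult_distrib hnorm_std_ip sum_distrib_left)
      finally show "hnorm (std_ip D) (?D (?E z x)) \<le> r * hnorm (std_ip D) x"
        using r0 H.hnorm_nonneg[OF x] by (meson mult_nonneg_nonneg power2_le_imp_le)
    qed
  qed
  have val: "f z = fst (V (1, 0)) + fst (V (0, ?E z (the_inv_into ?H (\<lambda>x. x - ?D (?E z x)) ?C)))"
    if z: "z \<in> polydisk" for z
  proof -
    define P Q where "P = peval p z" and "Q = peval q z"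
    have P: "P \<noteq> 0" using p0[OF z] by (simp add: P_def)
    define y where "y = (\<lambda>i. if i < D then coeff_eval N (c i) z else 0)"
    have y: "y \<in> ?H" by (simp add: y_def fin_space_def)
    have \<xi>H: "\<xi> \<alpha> \<in> ?H1" for \<alpha> by (auto simp: \<xi>_def fin_space_def[of D])
    have s: "c i \<alpha> = 0" if "N \<le> mdeg \<alpha>" for i \<alpha> using supp[OF that] by (simp add: c_def)
    have "(\<Sum>\<alpha>\<in>?I. cscale (power_monomial z \<alpha>) (\<xi> \<alpha>)) = join P (?E z y)"
      unfolding join_eq_iff
    proof (intro conjI allI)
      show "(\<Sum>\<alpha>\<in>?I. cscale (power_monomial z \<alpha>) (\<xi> \<alpha>)) 0 = P"
        by (simp add: sum_fun_apply cscale_def \<xi>_def P_def peval_coeff_eval[OF pN] coeff_eval_def mult.commute)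
      show "(\<Sum>\<alpha>\<in>?I. cscale (power_monomial z \<alpha>) (\<xi> \<alpha>)) (Suc i) = ?E z y i" for i
        using coeff_eval_shift[where g="c i" and N=N and j="h i" and z=z, OF s]
        unfolding E(1)[OF y]
        by (cases "i < D") (simp_all add: sum_fun_apply cscale_def \<xi>_def y_def coeff_eval_def mult.commute)
    qed
    moreover have "(\<Sum>\<alpha>\<in>?I. cscale (power_monomial z \<alpha>) (\<eta> \<alpha>)) = join Q y"
      unfolding join_eq_iff
      by (auto simp: sum_fun_apply cscale_def \<eta>_def Q_def y_def peval_coeff_eval[OF qN] coeff_eval_def mult.commute)
    moreover have "V0 (\<Sum>\<alpha>\<in>?I. cscale (power_monomial z \<alpha>) (\<xi> \<alpha>)) =
        (\<Sum>\<alpha>\<in>?I. cscale (power_monomial z \<alpha>) (\<eta> \<alpha>))"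
      by (simp add: V0sum[OF finite_indices \<xi>H] V0(3))
    ultimately have "V0 (join P (?E z y)) = join Q y" by simp
    then have VP: "V (P, ?E z y) = (Q, y)" by (simp add: V_def)
    \<comment> \<open>Scaling makes the scalar component of the input equal to 1, so that
      \<open>V\<close> acts through the columns A and C.\<close>
    define x where "x = cscale (1 / P) y"
    have x: "x \<in> ?H" using y H.H_scale x_def by simp
    have Ex: "?E z x = cscale (1 / P) (?E z y)"
      using x y by (simp add: E) (simp add: x_def cscale_def fun_eq_iff)
    have "V (1 / P * P, cscale (1 / P) (?E z y)) = (1 / P * Q, cscale (1 / P) y)"
      using Vscale[OF E(2)[OF y], of "1 / P" P z] by (simp add: VP)
    then have V1: "V (1, ?E z x) = (Q / P, x)" using P Ex by (simp add: x_def)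
    have V2: "V (1, ?E z x) = V (1, 0) + V (0, ?E z x)"
      using Vadd[OF H.H_zero E(2)[OF x], of 1 0] by simp
    have "x - ?D (?E z x) = ?C"
    proof -
      have "x = ?C + ?D (?E z x)" using arg_cong[OF V2, of snd] V1 by simp
      then show ?thesis by (rule diff_eq_eq[THEN iffD2])
    qed
    then have inv: "the_inv_into ?H (\<lambda>x. x - ?D (?E z x)) ?C = x"
      using bij_betw_imp_inj_on[OF bij[OF z]] x by (intro the_inv_into_f_eq)
    have "fst (V (1, ?E z x)) = fst (V (1, 0)) + fst (V (0, ?E z x))" using V2 by simp
    then show ?thesis unfolding inv using V1 fpq[OF z] by (simp add: P_def Q_def)
  qed
  have "transfer_function_realization f ?H (std_ip D) ?Hs V"
    unfolding transfer_function_realization_def Let_def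
    by (intro conjI ballI complex_hilbert_std_ip block_orthogonal_decomposition iso bij val)
  then show ?thesis
    unfolding has_finite_dim_realization_def
    by (intro exI[of _ ?H] exI[of _ "std_ip D"] exI[of _ ?Hs] exI[of _ V] conjI allI block_finite_dim)
qed

section \<open>Rational inner functions on the torus\<close>

lemma continuous_on_peval:
  assumes "\<And>j. continuous_on S (\<lambda>x. g x $ j)"
  shows "continuous_on S (\<lambda>x. peval p (g x))"
  unfolding peval_def power_monomial_def
  by (intro continuous_on_sum continuous_on_mult continuous_on_const continuous_on_prod continuous_on_power assms)

text \<open>Approach \<open>z\<close> radially: \<open>r * z\<close> lies in the polydisk for
  \<open>0 \<le> r < 1\<close>, and both sides are continuous in \<open>r\<close>.\<close>

lemma eq_on_torus:
  fixes p q :: "'n::finite cpoly" and p' q' :: "'n cpoly"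
  assumes eq: "\<And>z. z \<in> polydisk \<Longrightarrow> peval p z * peval q' z = peval q z * peval p' z"
    and z: "\<And>j. cmod (z $ j) = 1"
  shows "peval p z * peval q' z = peval q z * peval p' z"
proof -
  define g where "g = (\<lambda>r :: real. (\<chi> j. of_real r * z $ j) :: complex ^ 'n)"
  define F where "F = (\<lambda>r. peval p (g r) * peval q' (g r) - peval q (g r) * peval p' (g r))"
  have "continuous_on (closure {0..<1}) F"
    unfolding F_def g_def by (intro continuous_intros continuous_on_peval)
  moreover have "F r = 0" if "r \<in> {0..<1}" for r
  proof -
    have "g r \<in> polydisk" using that z by (simp add: g_def polydisk_def norm_mult)
    then show ?thesis using eq by (simp add: F_def)
  qed
  moreover have "1 \<in> closure {0..<1::real}" by simp
  ultimately have "F 1 = 0" by (rule continuous_constant_on_closure)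
  moreover have "g 1 = z" by (simp add: g_def vec_eq_iff)
  ultimately show ?thesis by (simp add: F_def)
qed

text \<open>The set where \<open>g\<close> is nonzero is open, and a nonempty open set has positive
  measure.\<close>

lemma AE_lborel_eq_0:
  fixes g :: "'a::euclidean_space \<Rightarrow> real"
  assumes "continuous_on UNIV g" "AE x in lborel. g x = 0"
  shows "g x = 0"
proof (rule ccontr)
  assume "g x \<noteq> 0"
  define U where "U = {x. g x \<noteq> 0}"
  have "open U"
    unfolding U_def by (intro open_Collect_neq assms continuous_on_const)
  then have "U \<in> null_sets lborel"
    using assms(2) AE_iff_null_sets[of U lborel] by (simp add: U_def borel_open)
  then have "negligible U"
    unfolding negligible_iff_null_sets by (rule null_sets_completionI)
  then show False
    using open_not_negligible[OF \<open>open U\<close>] \<open>g x \<noteq> 0\<close> by (auto simp: U_def)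
qed

text \<open>The fraction supplied by \<open>rational_inner\<close> may differ from q/p, so the
  moduli are compared through the cross-multiplied identity. Continuity upgrades almost everywhere
  to everywhere, as is essential for \<open>parseval\<close>: the grid is a null set.\<close>

lemma rational_inner_torus:
  fixes f :: "complex ^ 'n::finite \<Rightarrow> complex"
  assumes f: "rational_inner f"
    and p: "\<And>z. z \<in> polydisk \<Longrightarrow> peval p z \<noteq> 0"
    and fpq: "\<And>z. z \<in> polydisk \<Longrightarrow> f z = peval q z / peval p z"
    and z: "\<And>j. cmod (z $ j) = 1"
  shows "cmod (peval p z) = cmod (peval q z)"
proof -
  obtain q' p' where q': "\<And>z. z \<in> polydisk \<Longrightarrow> peval p' z \<noteq> 0"
      "\<And>z. z \<in> polydisk \<Longrightarrow> f z = peval q' z / peval p' z"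
    and AE: "AE \<theta> :: real ^ 'n in lborel.
      cmod (peval q' (\<chi> j. cis (\<theta> $ j)) / peval p' (\<chi> j. cis (\<theta> $ j))) = 1"
    using f unfolding rational_inner_def by blast
  define w where "w = (\<lambda>\<theta> :: real ^ 'n. (\<chi> j. cis (\<theta> $ j)) :: complex ^ 'n)"
  define g where "g = (\<lambda>\<theta>. cmod (peval p (w \<theta>)) - cmod (peval q (w \<theta>)))"
  have cross: "peval p z * peval q' z = peval q z * peval p' z" if "z \<in> polydisk" for z
    using fpq[OF that] q'[OF that] p[OF that] by (simp add: field_simps)
  have g0: "g \<theta> = 0" if "cmod (peval q' (w \<theta>) / peval p' (w \<theta>)) = 1" for \<theta>
  proof -
    have nz: "cmod (peval p' (w \<theta>)) \<noteq> 0" and eq: "cmod (peval q' (w \<theta>)) = cmod (peval p' (w \<theta>))"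
      using that by (auto simp: norm_divide divide_eq_1_iff)
    have "peval p (w \<theta>) * peval q' (w \<theta>) = peval q (w \<theta>) * peval p' (w \<theta>)"
      by (rule eq_on_torus[OF cross]) (simp_all add: w_def)
    then have "cmod (peval p (w \<theta>)) * cmod (peval q' (w \<theta>)) = cmod (peval q (w \<theta>)) * cmod (peval p' (w \<theta>))"
      by (metis norm_mult)
    then show ?thesis using nz by (simp add: g_def eq)
  qed
  have "AE \<theta> in lborel. g \<theta> = 0"
    using AE by (rule eventually_mono) (rule g0, simp add: w_def)
  moreover have "continuous_on UNIV g"
    unfolding g_def w_def
    by (intro continuous_intros continuous_on_peval)
  ultimately have "g (\<chi> j. Arg (z $ j)) = 0" by (intro AE_lborel_eq_0)
  moreover have "w (\<chi> j. Arg (z $ j)) = z"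
    using z rcis_cmod_Arg[of "z $ _"] by (simp add: w_def vec_eq_iff rcis_def)
  ultimately show ?thesis by (simp add: g_def)
qed

section \<open>Sums of squares\<close>

text \<open>The shifted terms stand beside \<open>p\<close> and the others beside \<open>q\<close>,
  so every sign is positive. In this shape the same family \<open>v\<close> gives both the sums of
  squares and the two Gram matrices for the realization.\<close>

lemma sos_coefficients:
  fixes f :: "complex ^ 'n::finite \<Rightarrow> complex" and p q :: "'n cpoly"
  assumes inner: "rational_inner f" and agler: "agler_class f"
    and p0: "\<And>z. z \<in> polydisk \<Longrightarrow> peval p z \<noteq> 0"
    and fpq: "\<And>z. z \<in> polydisk \<Longrightarrow> f z = peval q z / peval p z"
    and pN: "keys p \<subseteq> indices N" and qN: "keys q \<subseteq> indices N"
  obtains K and v :: "'n \<Rightarrow> nat \<Rightarrow> ('n \<Rightarrow>\<^sub>0 nat) \<Rightarrow> complex" where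
    "\<And>j k \<alpha>. N \<le> mdeg \<alpha> \<Longrightarrow> v j k \<alpha> = 0"
    "\<And>\<alpha> \<beta>. lookup p \<alpha> * cnj (lookup p \<beta>) +
      (\<Sum>j\<in>UNIV. \<Sum>k<K. shift (unit_index j) (v j k) \<alpha> * cnj (shift (unit_index j) (v j k) \<beta>)) =
      lookup q \<alpha> * cnj (lookup q \<beta>) + (\<Sum>j\<in>UNIV. \<Sum>k<K. v j k \<alpha> * cnj (v j k \<beta>))"
proof -
  let ?I = "indices N :: ('n \<Rightarrow>\<^sub>0 nat) set"
  define P where "P = (\<lambda>\<alpha> \<beta>. lookup p \<alpha> * cnj (lookup p \<beta>) - lookup q \<alpha> * cnj (lookup q \<beta>))"
  have sq: "Re (x * cnj x) = (cmod x)\<^sup>2" for x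
    by (simp only: complex_norm_square[symmetric] Re_complex_of_real)
  have "real (Suc N) ^ CARD('n) * (\<Sum>\<alpha>\<in>?I. (cmod (lookup p \<alpha>))\<^sup>2) =
      real (Suc N) ^ CARD('n) * (\<Sum>\<alpha>\<in>?I. (cmod (lookup q \<alpha>))\<^sup>2)"
    unfolding parseval[OF pN lessI, symmetric] parseval[OF qN lessI, symmetric]
    using rational_inner_torus[OF inner p0 fpq] by simp
  then have norms: "(\<Sum>\<alpha>\<in>?I. (cmod (lookup p \<alpha>))\<^sup>2) = (\<Sum>\<alpha>\<in>?I. (cmod (lookup q \<alpha>))\<^sup>2)"
    by simp
  have trace: "Re (\<Sum>\<alpha>\<in>?I. P \<alpha> \<alpha>) = 0"
    using norms by (simp only: P_def sum_subtractf minus_complex.simps Re_sum sq)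
  have "\<exists>A. (\<forall>j. psd ?I (A j)) \<and> (\<forall>\<alpha>\<in>?I. \<forall>\<beta>\<in>?I. P \<alpha> \<beta> = agler_sum A \<alpha> \<beta>)"
  proof (rule agler_sum_duality[where P=P and N=N])
    show "hermitian ?I P" unfolding hermitian_def P_def by simp
    show "Re (\<Sum>\<alpha>\<in>?I. P \<alpha> \<alpha>) = 0" by (rule trace)
    fix M assume M: "hermitian ?I M" "\<And>g. (\<Sum>\<alpha>\<in>?I. (cmod (g \<alpha>))\<^sup>2) \<le> form ?I M g"
      "\<And>j g. form ?I M (shift (unit_index j) g) \<le> form ?I M g"
    have "f z * peval p z = peval q z" if "z \<in> polydisk" for z
      using p0[OF that] fpq[OF that] by simp
    then have "form ?I M (lookup q) \<le> form ?I M (lookup p)"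
      by (rule agler_form_le[OF agler _ pN M])
    also have "form ?I M (lookup p) = form ?I M (lookup q) + Re (\<Sum>\<alpha>\<in>?I. \<Sum>\<beta>\<in>?I. M \<alpha> \<beta> * P \<alpha> \<beta>)"
      by (simp add: form_def P_def algebra_simps sum_subtractf)
    finally show "0 \<le> Re (\<Sum>\<alpha>\<in>?I. \<Sum>\<beta>\<in>?I. M \<alpha> \<beta> * P \<alpha> \<beta>)" by simp
  qed
  then obtain A where A: "\<And>j. psd ?I (A j)" and PA: "\<And>\<alpha> \<beta>. \<alpha> \<in> ?I \<Longrightarrow> \<beta> \<in> ?I \<Longrightarrow> P \<alpha> \<beta> = agler_sum A \<alpha> \<beta>"
    by blast
  have pos: "0 \<le> Re (A j \<alpha> \<alpha>)" if "\<alpha> \<in> ?I" for j \<alpha>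
    using psd_diag(1)[OF finite_indices A that] .
  have top: "A j \<alpha> \<alpha> = 0" if "mdeg \<alpha> = N" for j \<alpha>
  proof -
    have sub: "{\<alpha> :: 'n \<Rightarrow>\<^sub>0 nat. mdeg \<alpha> = N} \<subseteq> ?I" by (auto simp: indices_def)
    then have fin: "finite {\<alpha> :: 'n \<Rightarrow>\<^sub>0 nat. mdeg \<alpha> = N}" by (rule finite_subset) simp
    have "(\<Sum>j\<in>UNIV. \<Sum>\<alpha> | mdeg \<alpha> = N. Re (A j \<alpha> \<alpha>)) = Re (\<Sum>\<alpha>\<in>?I. agler_sum A \<alpha> \<alpha>)"
      unfolding agler_sum_trace Re_sum ..
    also have "(\<Sum>\<alpha>\<in>?I. agler_sum A \<alpha> \<alpha>) = (\<Sum>\<alpha>\<in>?I. P \<alpha> \<alpha>)"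
      by (intro sum.cong refl) (simp add: PA)
    finally have "(\<Sum>j\<in>UNIV. \<Sum>\<alpha> | mdeg \<alpha> = N. Re (A j \<alpha> \<alpha>)) = 0" using trace by simp
    then have "(\<Sum>\<alpha> | mdeg \<alpha> = N. Re (A j \<alpha> \<alpha>)) = 0"
      by (subst (asm) sum_nonneg_eq_0_iff) (use pos sub in \<open>auto intro!: sum_nonneg\<close>)
    then have "Re (A j \<alpha> \<alpha>) = 0"
      by (subst (asm) sum_nonneg_eq_0_iff[OF fin]) (use pos sub that in auto)
    moreover have "\<alpha> \<in> ?I" using sub that by blast
    ultimately show ?thesis using psd_diag(2)[OF finite_indices A, of \<alpha> j] by simp
  qed
  define K where "K = card ?I"
  have "\<forall>j. \<exists>v. \<forall>\<alpha>\<in>?I. \<forall>\<beta>\<in>?I. A j \<alpha> \<beta> = (\<Sum>k<K. v k \<alpha> * cnj (v k \<beta>))"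
    unfolding K_def by (intro allI psd_factor finite_indices A)
  then obtain w where w: "\<And>j \<alpha> \<beta>. \<alpha> \<in> ?I \<Longrightarrow> \<beta> \<in> ?I \<Longrightarrow> A j \<alpha> \<beta> = (\<Sum>k<K. w j k \<alpha> * cnj (w j k \<beta>))"
    by metis
  \<comment> \<open>The diagonal entry is the sum of the squared moduli of these coefficients, and
    \<open>top\<close> makes it 0.\<close>
  have w0: "w j k \<alpha> = 0" if "mdeg \<alpha> = N" "k < K" for j k \<alpha>
  proof -
    have "\<alpha> \<in> ?I" using that by (simp add: indices_def)
    then have "(\<Sum>k<K. (cmod (w j k \<alpha>))\<^sup>2) = Re (A j \<alpha> \<alpha>)" by (simp only: w Re_sum sq)
    then have "(\<Sum>k<K. (cmod (w j k \<alpha>))\<^sup>2) = 0" using top[OF that(1)] by simp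
    then show ?thesis using that(2) by (subst (asm) sum_nonneg_eq_0_iff) auto
  qed
  \<comment> \<open>The factorization says nothing about \<open>w\<close> outside
    \<open>indices N\<close>, where its values are arbitrary; \<open>v\<close> is zero there and
    agrees with \<open>w\<close> inside for \<open>k < K\<close>.\<close>
  define v where "v = (\<lambda>j k \<alpha>. if mdeg \<alpha> < N then w j k \<alpha> else 0)"
  have v0: "v j k \<alpha> = 0" if "N \<le> mdeg \<alpha>" for j k \<alpha> using that by (simp add: v_def)
  have Av: "A j \<alpha> \<beta> = (\<Sum>k<K. v j k \<alpha> * cnj (v j k \<beta>))" if "\<alpha> \<in> ?I" "\<beta> \<in> ?I" for j \<alpha> \<beta>
  proof -
    have "w j k \<alpha> = v j k \<alpha>" if "\<alpha> \<in> ?I" "k < K" for k \<alpha>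
      using that w0[of \<alpha> k j] by (auto simp: v_def indices_def)
    then show ?thesis unfolding w[OF that] using that by (intro sum.cong refl) simp
  qed
  define B where "B = (\<lambda>j \<alpha> \<beta>. \<Sum>k<K. v j k \<alpha> * cnj (v j k \<beta>))"
  have sv0: "shift (unit_index j) (v j k) \<alpha> = 0" if "\<alpha> \<notin> ?I" for j k \<alpha>
    using that v0[of "\<alpha> - unit_index j"] mdeg_minus[of "unit_index j" \<alpha>] by (auto simp: shift_def indices_def)
  have B: "agler_sum B \<alpha> \<beta> = (\<Sum>j\<in>UNIV. (\<Sum>k<K. v j k \<alpha> * cnj (v j k \<beta>)) -
      (\<Sum>k<K. shift (unit_index j) (v j k) \<alpha> * cnj (shift (unit_index j) (v j k) \<beta>)))" for \<alpha> \<beta>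
    unfolding agler_sum_def
  proof (intro sum.cong refl)
    fix j :: 'n
    have "kernel_shift (unit_index j) (B j) \<alpha> \<beta> =
        (\<Sum>k<K. shift (unit_index j) (v j k) \<alpha> * cnj (shift (unit_index j) (v j k) \<beta>))"
      by (cases "below (unit_index j) \<alpha>"; cases "below (unit_index j) \<beta>")
        (simp_all add: B_def kernel_shift_def shift_def)
    then show "B j \<alpha> \<beta> - kernel_shift (unit_index j) (B j) \<alpha> \<beta> = (\<Sum>k<K. v j k \<alpha> * cnj (v j k \<beta>)) -
        (\<Sum>k<K. shift (unit_index j) (v j k) \<alpha> * cnj (shift (unit_index j) (v j k) \<beta>))"
      by (simp add: B_def)
  qed
  \<comment> \<open>Outside \<open>indices N\<close> everything vanishes, including the shifted
    terms, because \<open>v\<close> has degree below \<open>N\<close>. The truncated identity is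
    thus an identity for all indices.\<close>
  have PB: "P \<alpha> \<beta> = agler_sum B \<alpha> \<beta>" for \<alpha> \<beta>
  proof (cases "\<alpha> \<in> ?I \<and> \<beta> \<in> ?I")
    case True
    have "agler_sum A \<alpha> \<beta> = agler_sum B \<alpha> \<beta>"
      using True by (intro agler_sum_cong[of N]) (auto simp: Av B_def)
    then show ?thesis using True PA by simp
  next
    case False
    then have "lookup p \<alpha> * cnj (lookup p \<beta>) = 0" "lookup q \<alpha> * cnj (lookup q \<beta>) = 0"
      using pN qN by (auto simp: in_keys_iff subset_iff)
    moreover have "v j k \<alpha> * cnj (v j k \<beta>) = 0"
      "shift (unit_index j) (v j k) \<alpha> * cnj (shift (unit_index j) (v j k) \<beta>) = 0" for j k
      using False v0 sv0 by (auto simp: indices_def)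
    ultimately show ?thesis by (simp only: B P_def sum.neutral_const diff_self)
  qed
  show thesis
  proof (rule that[where v=v and K=K])
    show "lookup p \<alpha> * cnj (lookup p \<beta>) +
      (\<Sum>j\<in>UNIV. \<Sum>k<K. shift (unit_index j) (v j k) \<alpha> * cnj (shift (unit_index j) (v j k) \<beta>)) =
      lookup q \<alpha> * cnj (lookup q \<beta>) + (\<Sum>j\<in>UNIV. \<Sum>k<K. v j k \<alpha> * cnj (v j k \<beta>))" for \<alpha> \<beta>
      using PB[of \<alpha> \<beta>] unfolding B P_def sum_subtractf by (simp add: algebra_simps)
  qed (rule v0)
qed

text \<open>Setting w = z in the kernel identity: the linear map \<open>E\<close> evaluates a kernel
  on the diagonal and turns each rank one kernel into a squared modulus.\<close>

lemma sos_of_coefficients: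
  fixes p q :: "'n::finite cpoly"
  assumes supp: "\<And>j k \<alpha>. N \<le> mdeg \<alpha> \<Longrightarrow> v j k \<alpha> = 0"
    and gram: "\<And>\<alpha> \<beta>. lookup p \<alpha> * cnj (lookup p \<beta>) +
      (\<Sum>j\<in>UNIV. \<Sum>k<K. shift (unit_index j) (v j k) \<alpha> * cnj (shift (unit_index j) (v j k) \<beta>)) =
      lookup q \<alpha> * cnj (lookup q \<beta>) + (\<Sum>j\<in>UNIV. \<Sum>k<K. v j k \<alpha> * cnj (v j k \<beta>))"
    and pN: "keys p \<subseteq> indices N" and qN: "keys q \<subseteq> indices N"
  shows "(cmod (peval p z))\<^sup>2 - (cmod (peval q z))\<^sup>2 =
    (\<Sum>j\<in>UNIV. (1 - (cmod (z $ j))\<^sup>2) * (\<Sum>k<K. (cmod (coeff_eval N (v j k) z))\<^sup>2))"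
proof -
  let ?I = "indices N :: ('n \<Rightarrow>\<^sub>0 nat) set"
  define E where "E = (\<lambda>a. \<Sum>\<alpha>\<in>?I. \<Sum>\<beta>\<in>?I. a \<alpha> \<beta> * (power_monomial z \<alpha> * cnj (power_monomial z \<beta>)))"
  have E_add: "E (\<lambda>\<alpha> \<beta>. a \<alpha> \<beta> + b \<alpha> \<beta>) = E a + E b" for a b
    by (simp add: E_def algebra_simps sum.distrib)
  have E_sum: "E (\<lambda>\<alpha> \<beta>. \<Sum>i\<in>S. a i \<alpha> \<beta>) = (\<Sum>i\<in>S. E (a i))" for S and a :: "'b \<Rightarrow> _"
  proof (induction S rule: infinite_finite_induct)
    case (insert i S)
    then show ?case using E_add[of "a i" "\<lambda>\<alpha> \<beta>. \<Sum>i\<in>S. a i \<alpha> \<beta>"] by simp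
  qed (simp_all add: E_def)
  have E_sq: "E (\<lambda>\<alpha> \<beta>. g \<alpha> * cnj (g \<beta>)) = of_real ((cmod (coeff_eval N g z))\<^sup>2)" for g
    unfolding complex_norm_square coeff_eval_def E_def by (simp add: cnj_sum sum_product mult_ac)
  have "E (\<lambda>\<alpha> \<beta>. lookup p \<alpha> * cnj (lookup p \<beta>) +
      (\<Sum>j\<in>UNIV. \<Sum>k<K. shift (unit_index j) (v j k) \<alpha> * cnj (shift (unit_index j) (v j k) \<beta>))) =
    E (\<lambda>\<alpha> \<beta>. lookup q \<alpha> * cnj (lookup q \<beta>) + (\<Sum>j\<in>UNIV. \<Sum>k<K. v j k \<alpha> * cnj (v j k \<beta>)))"
    by (simp only: gram)
  then have "complex_of_real ((cmod (peval p z))\<^sup>2 +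
      (\<Sum>j\<in>UNIV. \<Sum>k<K. (cmod (z $ j * coeff_eval N (v j k) z))\<^sup>2)) =
    complex_of_real ((cmod (peval q z))\<^sup>2 + (\<Sum>j\<in>UNIV. \<Sum>k<K. (cmod (coeff_eval N (v j k) z))\<^sup>2))"
    unfolding E_add E_sum E_sq of_real_add of_real_sum
    by (simp only: coeff_eval_shift[OF supp] peval_coeff_eval[OF pN] peval_coeff_eval[OF qN])
  then have "(cmod (peval p z))\<^sup>2 + (\<Sum>j\<in>UNIV. \<Sum>k<K. (cmod (z $ j * coeff_eval N (v j k) z))\<^sup>2) =
    (cmod (peval q z))\<^sup>2 + (\<Sum>j\<in>UNIV. \<Sum>k<K. (cmod (coeff_eval N (v j k) z))\<^sup>2)"
    by (simp only: of_real_eq_iff)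
  then show ?thesis
    by (simp add: norm_mult power_mult_distrib left_diff_distrib sum_subtractf flip: sum_distrib_left)
qed

theorem theorem2p9:
  fixes f :: "complex ^ 'n::finite \<Rightarrow> complex" and p q :: "'n cpoly"
  assumes "rational_inner f"
    and "agler_class f"
    and "\<forall>z\<in>polydisk. peval p z \<noteq> 0"
    and "\<forall>z\<in>polydisk. f z = peval q z / peval p z"
  shows "(\<exists>(N :: 'n \<Rightarrow> nat) (A :: 'n \<Rightarrow> nat \<Rightarrow> 'n cpoly). \<forall>z :: complex ^ 'n.
            (cmod (peval p z))\<^sup>2 - (cmod (peval q z))\<^sup>2 =
            (\<Sum>j\<in>UNIV. (1 - (cmod (z $ j))\<^sup>2) * (\<Sum>k=1..N j. (cmod (peval (A j k) z))\<^sup>2))) \<and>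
         has_finite_dim_realization f"
proof -
  \<comment> \<open>Inserting 0 keeps the set nonempty if both polynomials are zero.\<close>
  define N where "N = Max (insert 0 (mdeg ` (keys p \<union> keys q)))"
  have "mdeg \<alpha> \<le> N" if "\<alpha> \<in> keys p \<union> keys q" for \<alpha>
    unfolding N_def using that by (intro Max_ge) auto
  then have pN: "keys p \<subseteq> indices N" and qN: "keys q \<subseteq> indices N" by (auto simp: indices_def)
  note p0 = assms(3)[rule_format] and fpq = assms(4)[rule_format]
  show ?thesis
  proof (rule sos_coefficients[OF assms(1,2) p0 fpq pN qN])
    fix K and v :: "'n \<Rightarrow> nat \<Rightarrow> ('n \<Rightarrow>\<^sub>0 nat) \<Rightarrow> complex"
    assume supp: "\<And>j k \<alpha>. N \<le> mdeg \<alpha> \<Longrightarrow> v j k \<alpha> = 0"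
      and gram: "\<And>\<alpha> \<beta>. lookup p \<alpha> * cnj (lookup p \<beta>) +
        (\<Sum>j\<in>UNIV. \<Sum>k<K. shift (unit_index j) (v j k) \<alpha> * cnj (shift (unit_index j) (v j k) \<beta>)) =
        lookup q \<alpha> * cnj (lookup q \<beta>) + (\<Sum>j\<in>UNIV. \<Sum>k<K. v j k \<alpha> * cnj (v j k \<beta>))"
    \<comment> \<open>The squares are numbered from 1 in the statement and from 0 in
      \<open>v\<close>, hence \<open>k - 1\<close>.\<close>
    have "\<forall>j k. \<exists>A :: 'n cpoly. \<forall>z. peval A z = coeff_eval N (v j (k - 1)) z"
      unfolding coeff_eval_def by (intro allI ex_peval finite_indices)
    then obtain A :: "'n \<Rightarrow> nat \<Rightarrow> 'n cpoly" where A: "\<And>j k z. peval (A j k) z = coeff_eval N (v j (k - 1)) z"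
      by metis
    have "(\<Sum>k=1..K. (cmod (peval (A j k) z))\<^sup>2) = (\<Sum>k<K. (cmod (coeff_eval N (v j k) z))\<^sup>2)" for j z
      unfolding A by (rule sum.reindex_bij_witness[of _ Suc "\<lambda>k. k - 1"]) auto
    then have "\<forall>z. (cmod (peval p z))\<^sup>2 - (cmod (peval q z))\<^sup>2 =
        (\<Sum>j\<in>UNIV. (1 - (cmod (z $ j))\<^sup>2) * (\<Sum>k=1..K. (cmod (peval (A j k) z))\<^sup>2))"
      using sos_of_coefficients[OF supp gram pN qN] by simp
    moreover have "has_finite_dim_realization f"
      by (rule lurking_isometry_realization[OF gram supp pN qN p0 fpq])
    ultimately show ?thesis by (intro conjI exI[of _ "\<lambda>_. K"] exI[of _ A])
  qed
qed

end
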